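(* (i) The set of all graphons (modulo $\delta_1$-equivalence) is complete for the metric $\delta_1$. (ii) For every $p>1$ and $C<\infty$, the set of nonnegative graphons $W$ with $W\in L^p$ and $\|W\|_{L^1}\le C$ is complete for the metric $\delta_p$.
   Context: A graphon $(W,S,\mathcal F,\mu)$ is a symmetric real-valued function $W\in L^1(S\times S,\mu\times\mu)$, $(S,\mathcal F,\mu)$ a $\sigma$-finite measure space; graphons equal a.e. are identified. Pull-back: $W^{\varphi}(x,y)=W(\varphi(x),\varphi(y))$. Coupling of $(S_1,\mu_1),(S_2,\mu_2)$: a pair of measure-preserving maps $\varphi_i:S\to S_i$ from a common $\sigma$-finite space. For $1\le p<\infty$ and $\mu_1(S_1)=\mu_2(S_2)$, $\delta_p(W_1,W_2):=\inf\|W_1^{\varphi_1}-W_2^{\varphi_2}\|_{L^p}$ over couplings; in general, computed after extending each $W_i$ by zero to a larger measure space so that total masses agree (well defined for $p=1$, and for $p>1$ for nonnegative graphons in $L^1\cap L^p$). Completeness is in the metric space of equivalence classes $\{\delta_p=0\}$: every Cauchy sequence in the set converges to an element of the set. *)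

theory Defs
  imports "HOL-Analysis.Analysis"
begin

type_synonym 'a graphon = "'a measure \<times> ('a \<Rightarrow> 'a \<Rightarrow> real)"

definition graphon :: "'a graphon \<Rightarrow> bool" where
  "graphon G \<longleftrightarrow> (case G of (M, W) \<Rightarrow>
     sigma_finite_measure M \<and>
     (\<forall>x\<in>space M. \<forall>y\<in>space M. W x y = W y x) \<and>
     integrable (M \<Otimes>\<^sub>M M) (\<lambda>(x, y). W x y))"

definition nonneg_graphon :: "'a graphon \<Rightarrow> bool" where
  "nonneg_graphon G \<longleftrightarrow> graphon G \<and>
     (\<forall>x\<in>space (fst G). \<forall>y\<in>space (fst G). 0 \<le> snd G x y)"

definition graphon_in_Lp :: "real \<Rightarrow> 'a graphon \<Rightarrow> bool" where
  "graphon_in_Lp p G \<longleftrightarrow>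
     (\<integral>\<^sup>+ z. ennreal (\<bar>snd G (fst z) (snd z)\<bar> powr p) \<partial>(fst G \<Otimes>\<^sub>M fst G)) < \<infinity>"

definition graphon_L1_norm :: "'a graphon \<Rightarrow> real" where
  "graphon_L1_norm G = (\<integral> z. \<bar>snd G (fst z) (snd z)\<bar> \<partial>(fst G \<Otimes>\<^sub>M fst G))"

definition ext_space :: "'a measure \<Rightarrow> ('a + real) measure" where
  "ext_space M = measure_of (Inl ` space M \<union> range Inr)
     {Inl ` A \<union> Inr ` B | A B. A \<in> sets M \<and> B \<in> sets borel}
     (\<lambda>C. emeasure M (Inl -` C) + emeasure lborel (Inr -` C))"

fun ext_fun :: "('a \<Rightarrow> 'a \<Rightarrow> real) \<Rightarrow> 'a + real \<Rightarrow> 'a + real \<Rightarrow> real" where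
  "ext_fun W (Inl x) (Inl y) = W x y"
| "ext_fun W _ _ = 0"

text \<open>Couplings of (S1,mu1) and (S2,mu2), realised (via push-forward) as sigma-finite
  measures nu on S1 x S2 whose coordinate projections are measure-preserving.\<close>
definition couplings :: "'a measure \<Rightarrow> 'b measure \<Rightarrow> ('a \<times> 'b) measure set" where
  "couplings M1 M2 = {\<nu>. sets \<nu> = sets (M1 \<Otimes>\<^sub>M M2) \<and> sigma_finite_measure \<nu> \<and>
       distr \<nu> M1 fst = M1 \<and> distr \<nu> M2 snd = M2}"

definition enn_root :: "real \<Rightarrow> ennreal \<Rightarrow> ennreal" where
  "enn_root p x = (if x = \<infinity> then \<infinity> else ennreal (enn2real x powr (1 / p)))"

text \<open>delta_p(W1, W2): infimum over couplings of the L^p norm of the difference of the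
  pull-backs, after extending both graphons by zero to spaces of equal (infinite) mass.\<close>
definition delta :: "real \<Rightarrow> 'a graphon \<Rightarrow> 'b graphon \<Rightarrow> ennreal" where
  "delta p G1 G2 = (INF \<nu>\<in>couplings (ext_space (fst G1)) (ext_space (fst G2)).
      enn_root p (\<integral>\<^sup>+ z. ennreal (\<bar>ext_fun (snd G1) (fst (fst z)) (fst (snd z))
                                  - ext_fun (snd G2) (snd (fst z)) (snd (snd z))\<bar> powr p)
                    \<partial>(\<nu> \<Otimes>\<^sub>M \<nu>)))"

definition delta_Cauchy :: "real \<Rightarrow> (nat \<Rightarrow> 'a graphon) \<Rightarrow> bool" where
  "delta_Cauchy p X \<longleftrightarrow>
     (\<forall>\<epsilon>>0. \<exists>N. \<forall>m\<ge>N. \<forall>n\<ge>N. delta p (X m) (X n) < ennreal \<epsilon>)"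

definition delta_converges :: "real \<Rightarrow> (nat \<Rightarrow> 'a graphon) \<Rightarrow> 'b graphon \<Rightarrow> bool" where
  "delta_converges p X G \<longleftrightarrow> (\<forall>\<epsilon>>0. \<exists>N. \<forall>n\<ge>N. delta p (X n) G < ennreal \<epsilon>)"

end

theory Submission
  imports Defs
begin

text \<open>Up to small error a graphon is a step function \<open>U (c x) (c y)\<close> with \<open>c\<close> taking countably many
  values, and then only the law of \<open>c\<close> matters. A coupling of two such graphons becomes a joint law on
  \<open>nat \<times> nat\<close>, which can be realised on a half-line with Lebesgue measure starting from any labelling
  with the correct first marginal, by splitting each cell into pieces of prescribed measure.
  Hence a sufficiently sparse subsequence of a Cauchy sequence can be represented by step functions
  \<open>U\<^sub>k (f\<^sub>k x) (f\<^sub>k y)\<close> on one fixed space whose consecutive distances decay geometrically, and these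
  converge in \<open>L\<^sup>p\<close>. Two spaces carrying labellings with the same law are coupled by taking conditional
  product measures on the cells, which takes the limit back to the given graphons; no regularity of
  the underlying measure spaces is needed. Fatou's lemma gives the bound on the \<open>L\<^sup>1\<close> norm.\<close>

section \<open>Integrals of p-th powers\<close>

text \<open>The obstacle is gluing. Representing a whole Cauchy sequence on one space means
  composing couplings along a shared middle space, which calls for disintegration, and that can fail
  on arbitrary sigma-finite spaces. Countable labels replace it: conditioning on a cell of positive
  finite mass is elementary. The price is an approximation error at every link, chosen as small as
  desired before the chain is built. Estimates are kept as p-th powers of norms, so a triangle
  inequality costs a factor \<open>2 powr p\<close>; the chain itself is summed through a weighted
  pointwise series, so these factors do not accumulate along it. For p > 1, \<open>delta p\<close>
  does not control L1 norms; step functions therefore approximate in L1 and L^p at once, which lets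
  the bound \<open>C\<close> reach the limit exactly. The real line attached by
  \<open>ext_space\<close> is cut into unit cells with odd labels: this stock of equal cells, on
  which all step functions vanish, has infinite total mass and can absorb another copy of itself, so
  the line attached to the limit space costs nothing.\<close>

definition Lp_int :: "real \<Rightarrow> 'a measure \<Rightarrow> ('a \<Rightarrow> real) \<Rightarrow> ennreal" where
  "Lp_int p M f = (\<integral>\<^sup>+ z. ennreal (\<bar>f z\<bar> powr p) \<partial>M)"

text \<open>The larger summand is doubled; the resulting factor \<open>2 powr p\<close> is harmless
  because each use chains only a bounded number of such inequalities.\<close>

lemma abs_add_powr_le:
  fixes a b p :: real
  assumes "0 \<le> p"
  shows "\<bar>a + b\<bar> powr p \<le> 2 powr p * (\<bar>a\<bar> powr p + \<bar>b\<bar> powr p)"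
proof -
  have "\<bar>a + b\<bar> powr p \<le> (2 * max \<bar>a\<bar> \<bar>b\<bar>) powr p"
    using assms by (intro powr_mono2) auto
  also have "\<dots> = 2 powr p * max \<bar>a\<bar> \<bar>b\<bar> powr p"
    by (simp add: powr_mult)
  also have "\<dots> \<le> 2 powr p * (\<bar>a\<bar> powr p + \<bar>b\<bar> powr p)"
    by (intro mult_left_mono) (auto simp: max_def)
  finally show ?thesis .
qed

lemma Lp_int_add_le:
  assumes [measurable]: "f \<in> borel_measurable M" "g \<in> borel_measurable M" and "0 \<le> p"
  shows "Lp_int p M (\<lambda>z. f z + g z) \<le> ennreal (2 powr p) * (Lp_int p M f + Lp_int p M g)"
proof -
  have "Lp_int p M (\<lambda>z. f z + g z)
      \<le> (\<integral>\<^sup>+ z. ennreal (2 powr p) * (ennreal (\<bar>f z\<bar> powr p) + ennreal (\<bar>g z\<bar> powr p)) \<partial>M)"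
    unfolding Lp_int_def
  proof (intro nn_integral_mono)
    fix z
    have "ennreal (\<bar>f z + g z\<bar> powr p) \<le> ennreal (2 powr p * (\<bar>f z\<bar> powr p + \<bar>g z\<bar> powr p))"
      by (rule ennreal_leI) (rule abs_add_powr_le[OF \<open>0 \<le> p\<close>])
    then show "ennreal (\<bar>f z + g z\<bar> powr p)
        \<le> ennreal (2 powr p) * (ennreal (\<bar>f z\<bar> powr p) + ennreal (\<bar>g z\<bar> powr p))"
      by (simp add: ennreal_mult)
  qed
  also have "\<dots> = ennreal (2 powr p) * (Lp_int p M f + Lp_int p M g)"
    unfolding Lp_int_def by (simp add: nn_integral_cmult nn_integral_add)
  finally show ?thesis .
qed

lemma Lp_int_triangle:
  assumes [measurable]: "f \<in> borel_measurable M" "g \<in> borel_measurable M" "h \<in> borel_measurable M"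
    and "0 \<le> p"
  shows "Lp_int p M (\<lambda>z. f z - h z)
    \<le> ennreal (2 powr p) * (Lp_int p M (\<lambda>z. f z - g z) + Lp_int p M (\<lambda>z. g z - h z))"
  using Lp_int_add_le[of "\<lambda>z. f z - g z" M "\<lambda>z. g z - h z" p] assms by simp

lemma Lp_int_minus_commute: "Lp_int p M (\<lambda>z. f z - g z) = Lp_int p M (\<lambda>z. g z - f z)"
  by (simp add: Lp_int_def abs_minus_commute)

lemma Lp_int_mono:
  assumes "\<And>z. z \<in> space M \<Longrightarrow> \<bar>f z\<bar> \<le> \<bar>g z\<bar>" "0 \<le> p"
  shows "Lp_int p M f \<le> Lp_int p M g"
  unfolding Lp_int_def using assms by (intro nn_integral_mono ennreal_leI powr_mono2) auto

lemma Lp_int_cong: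
  assumes "\<And>z. z \<in> space M \<Longrightarrow> f z = g z"
  shows "Lp_int p M f = Lp_int p M g"
  unfolding Lp_int_def using assms by (intro nn_integral_cong) auto

lemma Lp_int_cong_AE:
  assumes "AE z in M. f z = g z"
  shows "Lp_int p M f = Lp_int p M g"
  unfolding Lp_int_def using assms by (intro nn_integral_cong_AE) auto

lemma Lp_int_bound_add:
  assumes [measurable]: "f \<in> borel_measurable M" "g \<in> borel_measurable M" and "0 \<le> p"
  shows "Lp_int p M f \<le> ennreal (2 powr p) * (Lp_int p M (\<lambda>z. f z - g z) + Lp_int p M g)"
  using Lp_int_add_le[of "\<lambda>z. f z - g z" M g p] assms by simp

text \<open>At exponent 1 there is no extra factor. This matters for the bound \<open>C\<close> on
  the L1 norms, which has to pass to the limit unchanged.\<close>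

lemma Lp_int_1_triangle:
  assumes [measurable]: "f \<in> borel_measurable M" "g \<in> borel_measurable M"
  shows "Lp_int 1 M f \<le> Lp_int 1 M (\<lambda>z. f z - g z) + Lp_int 1 M g"
proof -
  have "Lp_int 1 M f \<le> (\<integral>\<^sup>+ z. ennreal \<bar>f z - g z\<bar> + ennreal \<bar>g z\<bar> \<partial>M)"
    unfolding Lp_int_def by (intro nn_integral_mono) (simp flip: ennreal_plus)
  then show ?thesis by (simp add: Lp_int_def nn_integral_add)
qed

section \<open>Limits of rapidly convergent sequences\<close>

lemma geometric_increments_limit:
  fixes x :: "nat \<Rightarrow> real"
  assumes d: "\<And>j. \<bar>x (Suc j) - x j\<bar> \<le> T / 2 ^ j" 
  shows "Cauchy x" "\<bar>x k - lim x\<bar> \<le> 2 * T / 2 ^ k"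
proof -
  have s: "summable (\<lambda>j. T / 2 ^ j)"
    using summable_mult[OF summable_geometric[of "1/2::real"], of T] by (simp add: power_divide)
  have sa: "summable (\<lambda>j. norm (x (Suc j) - x j))"
    by (rule summable_comparison_test[OF _ s]) (use d in auto)
  have sd: "summable (\<lambda>j. x (Suc j) - x j)"
    using sa by (rule summable_norm_cancel)
  have "(\<lambda>n. (\<Sum>j<n. x (Suc j) - x j) + x 0) \<longlonglongrightarrow> (\<Sum>j. x (Suc j) - x j) + x 0"
    by (intro tendsto_intros summable_LIMSEQ sd)
  then have conv: "convergent x"
    by (auto simp: sum_lessThan_telescope convergent_def)
  then show "Cauchy x" by (rule convergent_Cauchy)
  have L: "x \<longlonglongrightarrow> lim x" using conv by (simp add: convergent_LIMSEQ_iff)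
  \<comment> \<open>The right-hand side is the exact value of T/2^k + ... + T/2^(k+n-1); the
    subtracted term is what lets the induction close.\<close>
  have b: "\<bar>x k - x (k + n)\<bar> \<le> 2 * T / 2 ^ k - 2 * T / 2 ^ (k + n)" for n
  proof (induction n)
    case (Suc n)
    have "\<bar>x k - x (k + Suc n)\<bar> \<le> \<bar>x k - x (k + n)\<bar> + \<bar>x (Suc (k + n)) - x (k + n)\<bar>"
      by simp
    also have "\<dots> \<le> (2 * T / 2 ^ k - 2 * T / 2 ^ (k + n)) + T / 2 ^ (k + n)"
      using Suc.IH d[of "k + n"] by linarith
    also have "\<dots> = 2 * T / 2 ^ k - 2 * T / 2 ^ (k + Suc n)"
      by simp
    finally show ?case .
  qed simp
  have T0: "0 \<le> T" using d[of 0] by simp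
  have "\<bar>x k - x (n + k)\<bar> \<le> 2 * T / 2 ^ k" for n
  proof -
    have "0 \<le> 2 * T / 2 ^ (k + n)" using T0 by simp
    then show ?thesis using b[of n] by (simp add: add.commute)
  qed
  moreover have "(\<lambda>n. \<bar>x k - x (n + k)\<bar>) \<longlonglongrightarrow> \<bar>x k - lim x\<bar>"
    by (intro tendsto_intros LIMSEQ_ignore_initial_segment L)
  ultimately show "\<bar>x k - lim x\<bar> \<le> 2 * T / 2 ^ k"
    using LIMSEQ_le_const2 by blast
qed

text \<open>The increments are controlled pointwise by the weighted tail sums
  \<open>\<Sum>j. 2\<^bsup>p(j+k)\<^esup> \<bar>F (j+k+1) - F (j+k)\<bar>\<^bsup>p\<^esup>\<close>, whose integrals are at most \<open>2 / 2\<^bsup>k\<^esup>\<close>.\<close>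
lemma Lp_int_fast_limit:
  fixes F :: "nat \<Rightarrow> 'a \<Rightarrow> real"
  assumes [measurable]: "\<And>k. F k \<in> borel_measurable M" and p: "1 \<le> p"
    and fast: "\<And>k. Lp_int p M (\<lambda>z. F (Suc k) z - F k z) \<le> ennreal ((1 / (2 * 2 powr p)) ^ k)"
  shows "AE z in M. (\<lambda>k. F k z) \<longlonglongrightarrow> lim (\<lambda>k. F k z)"
    and "Lp_int p M (\<lambda>z. F k z - lim (\<lambda>k. F k z)) \<le> ennreal (2 powr p * (2 / 2 ^ k))"
proof -
  define T where "T k z = (\<Sum>j. ennreal (2 powr (p * real (j + k)) * \<bar>F (Suc (j + k)) z - F (j + k) z\<bar> powr p))"
    for k z
  have [measurable]: "T k \<in> borel_measurable M" for k
    unfolding T_def by measurable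
  have IT: "(\<integral>\<^sup>+ z. T k z \<partial>M) \<le> ennreal (2 / 2 ^ k)" for k
  proof -
    have "(\<integral>\<^sup>+ z. T k z \<partial>M) = (\<Sum>j. ennreal (2 powr (p * real (j + k))) * Lp_int p M (\<lambda>z. F (Suc (j + k)) z - F (j + k) z))"
      unfolding T_def Lp_int_def by (simp add: nn_integral_suminf ennreal_mult nn_integral_cmult)
    also have "\<dots> \<le> (\<Sum>j. ennreal ((1/2) ^ (j + k)))"
    proof (intro suminf_le summableI)
      fix j
      \<comment> \<open>This explains the rate \<open>1 / (2 * 2 powr p)\<close> in the hypothesis:
        \<open>2 powr p\<close> pays for the weight, and the remaining factor 1/2 makes the series
        of integrals geometric.\<close>
      have "2 powr (p * real (j + k)) = (2 powr p) ^ (j + k)"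
        by (simp flip: powr_powr powr_realpow)
      then have "2 powr (p * real (j + k)) * (1 / (2 * 2 powr p)) ^ (j + k) = (1 / 2) ^ (j + k)"
        by (simp add: power_divide power_mult_distrib)
      then show "ennreal (2 powr (p * real (j + k))) * Lp_int p M (\<lambda>z. F (Suc (j + k)) z - F (j + k) z)
          \<le> ennreal ((1/2) ^ (j + k))"
        using mult_left_mono[OF fast[of "j + k"], of "ennreal (2 powr (p * real (j + k)))"]
        by (simp flip: ennreal_mult)
    qed
    also have "\<dots> = ennreal (2 / 2 ^ k)"
    proof -
      have "(\<lambda>j. (1/2::real) ^ j * (1/2) ^ k) sums (1 / (1 - 1/2) * (1/2) ^ k)"
        by (intro sums_mult2 geometric_sums) simp
      then have "(\<lambda>j. (1/2::real) ^ (j + k)) sums (2 / 2 ^ k)"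
        by (simp add: power_add power_divide)
      then show ?thesis by (subst suminf_ennreal_eq) auto
    qed
    finally show ?thesis .
  qed
  \<comment> \<open>Each term of a finite tail sum is at most the sum, so increment j after
    \<open>k\<close> is at most \<open>t powr (1/p) / 2 ^ j\<close>. The geometric lemma then gives
    convergence and the bound; its factor 2, raised to the power \<open>p\<close>, is the constant
    \<open>2 powr p\<close>.\<close>
  have key: "Cauchy (\<lambda>k. F k z) \<and> \<bar>F k z - lim (\<lambda>k. F k z)\<bar> powr p \<le> 2 powr p * enn2real (T k z)"
    if fin: "T k z < \<infinity>" for k z
  proof -
    define t where "t = enn2real (T k z)"
    have t0: "0 \<le> t" by (simp add: t_def)
    have bd: "\<bar>F (Suc (j + k)) z - F (j + k) z\<bar> \<le> t powr (1/p) / 2 ^ j" for j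
    proof -
      let ?d = "\<bar>F (Suc (j + k)) z - F (j + k) z\<bar>"
      have "ennreal (2 powr (p * real (j + k)) * ?d powr p) \<le> T k z"
      proof -
        let ?g = "\<lambda>j. ennreal (2 powr (p * real (j + k)) * \<bar>F (Suc (j + k)) z - F (j + k) z\<bar> powr p)"
        have "sum ?g {j} \<le> suminf ?g" by (rule sum_le_suminf) auto
        then show ?thesis by (simp only: T_def sum.insert sum.empty finite.emptyI empty_iff not_False_eq_True add_0_right)
      qed
      also have "T k z = ennreal t" using fin by (simp add: t_def less_top)
      finally have 1: "2 powr (p * real (j + k)) * ?d powr p \<le> t"
        using t0 by (simp)
      have "(2 powr real j * ?d) powr p = 2 powr (p * real j) * ?d powr p"
        by (simp add: powr_mult powr_powr mult.commute)
      \<comment> \<open>The weight is lowered from exponent \<open>p * (j + k)\<close> to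
        \<open>p * j\<close>; the decay in \<open>k\<close> is regained from the integral of
        \<open>T k\<close>.\<close>
      also have "\<dots> \<le> 2 powr (p * real (j + k)) * ?d powr p"
        using p by (intro mult_right_mono powr_mono) auto
      also note 1
      finally have "((2 powr real j * ?d) powr p) powr (1/p) \<le> t powr (1/p)"
        using p by (intro powr_mono2) auto
      then have "2 ^ j * ?d \<le> t powr (1/p)" 
        using p by (simp add: powr_powr powr_realpow)
      then show ?thesis by (simp add: field_simps)
    qed
    have C: "Cauchy (\<lambda>j. F (j + k) z)" and B: "\<bar>F k z - lim (\<lambda>j. F (j + k) z)\<bar> \<le> 2 * t powr (1/p)"
      using geometric_increments_limit(1)[of "\<lambda>j. F (j + k) z" "t powr (1/p)"]
        geometric_increments_limit(2)[of "\<lambda>j. F (j + k) z" "t powr (1/p)" 0] bd by auto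
    have C': "convergent (\<lambda>j. F j z)"
      using Cauchy_convergent[OF C] by (simp add: convergent_ignore_initial_segment[of "\<lambda>j. F j z" k])
    have "lim (\<lambda>j. F (j + k) z) = lim (\<lambda>j. F j z)"
      using C' by (intro limI LIMSEQ_ignore_initial_segment[of "\<lambda>j. F j z"]) (simp add: convergent_LIMSEQ_iff)
    then have "\<bar>F k z - lim (\<lambda>j. F j z)\<bar> powr p \<le> (2 * t powr (1/p)) powr p"
      using B p by (intro powr_mono2) auto
    also have "\<dots> = 2 powr p * t" using p t0 by (simp add: powr_mult powr_powr)
    finally show ?thesis using convergent_Cauchy[OF C'] by (simp add: t_def)
  qed
  have fin: "AE z in M. T k z < \<infinity>" for k
    using nn_integral_PInf_AE[of "T k" M] le_less_trans[OF IT[of k] ennreal_less_top]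
    by (auto simp: less_top)
  show "AE z in M. (\<lambda>k. F k z) \<longlonglongrightarrow> lim (\<lambda>k. F k z)"
    using fin[of 0] by eventually_elim
      (metis key Cauchy_convergent_iff convergent_LIMSEQ_iff infinity_ennreal_def)
  have "Lp_int p M (\<lambda>z. F k z - lim (\<lambda>k. F k z)) \<le> (\<integral>\<^sup>+ z. ennreal (2 powr p) * T k z \<partial>M)"
    unfolding Lp_int_def
  proof (rule nn_integral_mono_AE, use fin[of k] in eventually_elim)
    fix z assume f: "T k z < \<infinity>"
    then have "T k z = ennreal (enn2real (T k z))" by (simp add: less_top)
    then show "ennreal (\<bar>F k z - lim (\<lambda>k. F k z)\<bar> powr p) \<le> ennreal (2 powr p) * T k z"
      using key[OF f] by (metis ennreal_leI ennreal_mult enn2real_nonneg powr_ge_zero)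
  qed
  also have "\<dots> \<le> ennreal (2 powr p) * ennreal (2 / 2 ^ k)"
    by (simp add: nn_integral_cmult mult_left_mono IT)
  finally show "Lp_int p M (\<lambda>z. F k z - lim (\<lambda>k. F k z)) \<le> ennreal (2 powr p * (2 / 2 ^ k))"
    by (simp add: ennreal_mult mult.assoc flip: times_divide_eq_right)
qed

section \<open>Approximation by step functions\<close>

text \<open>On countable label types the product of the full sigma-algebras is again the full power
  set, so a function of two labels is measurable whatever \<open>U\<close> is. Kernels on labels
  thus never raise a measurability question of their own.\<close>

lemma measurable_step:
  fixes U :: "'i :: countable \<Rightarrow> 'j :: countable \<Rightarrow> 'b"
  assumes "c \<in> measurable M (count_space UNIV)" "d \<in> measurable M (count_space UNIV)"
    and "\<And>i j. U i j \<in> space N"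
  shows "(\<lambda>z. U (c z) (d z)) \<in> measurable M N"
proof -
  have "(\<lambda>z. (c z, d z)) \<in> measurable M (count_space UNIV \<Otimes>\<^sub>M count_space UNIV)"
    using assms by measurable
  then have "(\<lambda>z. (c z, d z)) \<in> measurable M (count_space UNIV)"
    by (simp add: pair_measure_countable)
  then have "(\<lambda>z. case_prod U (c z, d z)) \<in> measurable M N"
    by (rule measurable_compose) (auto simp: assms)
  then show ?thesis by simp
qed

lemma measurable_fst_snd_step:
  fixes U :: "'i :: countable \<Rightarrow> 'j :: countable \<Rightarrow> 'b"
  assumes "c \<in> measurable M (count_space UNIV)" "d \<in> measurable N (count_space UNIV)"
    and "\<And>i j. U i j \<in> space L"
  shows "(\<lambda>z. U (c (fst z)) (d (snd z))) \<in> measurable (M \<Otimes>\<^sub>M N) L"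
  by (rule measurable_step[OF measurable_compose[OF measurable_fst assms(1)]
        measurable_compose[OF measurable_snd assms(2)] assms(3)])

text \<open>Serves to merge finitely many labellings into one: a list of countable labels is again a
  countable label.\<close>

lemma measurable_map_upt:
  assumes "\<And>i. c i \<in> measurable M (count_space UNIV)"
  shows "(\<lambda>x. map (\<lambda>i. c i x :: 'i :: countable) [0..<N]) \<in> measurable M (count_space UNIV)"
proof (induction N)
  case (Suc N)
  show ?case
    using measurable_step[OF Suc assms[of N], of "\<lambda>l a. l @ [a]" "count_space UNIV"] by simp
qed simp

text \<open>Induction over the generated sigma-algebra: approximability inside
  \<open>B \<times> B\<close> holds for rectangles and survives complements and countable unions.
  Finite mass of \<open>B\<close> serves the union case, where the tail of the union must have small
  measure.\<close>

lemma product_set_step_approx: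
  assumes "sigma_finite_measure M" and B[measurable]: "B \<in> sets M" and fin: "emeasure M B < \<infinity>"
    and H: "H \<in> sets (M \<Otimes>\<^sub>M M)" and "0 < e"
  shows "\<exists>(c :: 'a \<Rightarrow> nat) S. c \<in> measurable M (count_space UNIV) \<and>
    emeasure (M \<Otimes>\<^sub>M M) {z \<in> B \<times> B. (z \<in> H) \<noteq> ((c (fst z), c (snd z)) \<in> S)} < ennreal e"
proof -
  interpret sigma_finite_measure M by fact
  have BB: "B \<times> B \<in> sets (M \<Otimes>\<^sub>M M)" by measurable
  have finB: "emeasure (M \<Otimes>\<^sub>M M) (B \<times> B) < \<infinity>"
    using fin by (simp add: emeasure_pair_measure_Times ennreal_mult_less_top)
  have Bsp: "B \<times> B \<subseteq> space M \<times> space M" using sets.sets_into_space[OF B] by auto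
  have step_pred: "Measurable.pred (M \<Otimes>\<^sub>M M) (\<lambda>z. (c (fst z), c (snd z)) \<in> S)"
    if "c \<in> measurable M (count_space UNIV)" for c :: "'a \<Rightarrow> nat" and S
  proof -
    show ?thesis
      by (rule measurable_fst_snd_step[OF that that, of "\<lambda>i j. (i, j) \<in> S"]) simp
  qed
  from H have "H \<in> sigma_sets (space M \<times> space M) {a \<times> b | a b. a \<in> sets M \<and> b \<in> sets M}"
    by (simp add: sets_pair_measure)
  then show ?thesis using \<open>0 < e\<close>
  proof (induction arbitrary: e)
    case (Basic H)
    then obtain a b where H: "H = a \<times> b" and [measurable]: "a \<in> sets M" "b \<in> sets M" by auto
    \<comment> \<open>The two bits of the label record membership in \<open>a\<close> and in
      \<open>b\<close>: the label is odd on \<open>a\<close> and at least 2 on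
      \<open>b\<close>.\<close>
    let ?c = "\<lambda>x. (if x \<in> a then 1 else 0) + (if x \<in> b then 2 else 0) :: nat"
    let ?S = "{(i :: nat, j :: nat). odd i \<and> 2 \<le> j}"
    have "z \<in> H \<longleftrightarrow> (?c (fst z), ?c (snd z)) \<in> ?S" for z
      by (cases z) (simp add: H)
    then have "{z \<in> B \<times> B. (z \<in> H) \<noteq> ((?c (fst z), ?c (snd z)) \<in> ?S)} = {}"
      by blast
    then have "emeasure (M \<Otimes>\<^sub>M M) {z \<in> B \<times> B. (z \<in> H) \<noteq> ((?c (fst z), ?c (snd z)) \<in> ?S)} < ennreal e"
      using Basic.prems by (simp only: emeasure_empty ennreal_less_zero_iff)
    moreover have "?c \<in> measurable M (count_space UNIV)" by measurable
    ultimately show ?case by blast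
  next
    case Empty
    then have "emeasure (M \<Otimes>\<^sub>M M) {z \<in> B \<times> B. (z \<in> {}) \<noteq> ((0 :: nat, 0 :: nat) \<in> {})} < ennreal e"
      by simp
    moreover have "(\<lambda>_. 0 :: nat) \<in> measurable M (count_space UNIV)" by simp
    ultimately show ?case by blast
  next
    case (Compl H)
    then obtain c :: "'a \<Rightarrow> nat" and S where c: "c \<in> measurable M (count_space UNIV)"
      "emeasure (M \<Otimes>\<^sub>M M) {z \<in> B \<times> B. (z \<in> H) \<noteq> ((c (fst z), c (snd z)) \<in> S)} < ennreal e"
      by blast
    have "{z \<in> B \<times> B. (z \<in> space M \<times> space M - H) \<noteq> ((c (fst z), c (snd z)) \<in> - S)}
       = {z \<in> B \<times> B. (z \<in> H) \<noteq> ((c (fst z), c (snd z)) \<in> S)}"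
      using Bsp by auto
    with c have "emeasure (M \<Otimes>\<^sub>M M)
        {z \<in> B \<times> B. (z \<in> space M \<times> space M - H) \<noteq> ((c (fst z), c (snd z)) \<in> - S)} < ennreal e"
      by (simp only:)
    with c(1) show ?case by blast
  next
    case (Union H)
    have H[measurable]: "H i \<in> sets (M \<Otimes>\<^sub>M M)" for i
      using Union.hyps by (simp add: sets_pair_measure)
    \<comment> \<open>What the first \<open>n\<close> sets miss; it decreases to the empty set
      inside a set of finite measure.\<close>
    let ?R = "\<lambda>n. B \<times> B \<inter> (\<Union> (range H) - (\<Union>i<n. H i))"
    have "(\<lambda>n. emeasure (M \<Otimes>\<^sub>M M) (?R n)) \<longlonglongrightarrow> emeasure (M \<Otimes>\<^sub>M M) (\<Inter>n. ?R n)"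
    proof (rule Lim_emeasure_decseq)
      show "emeasure (M \<Otimes>\<^sub>M M) (?R n) \<noteq> \<infinity>" for n
        using emeasure_mono[of "?R n" "B \<times> B" "M \<Otimes>\<^sub>M M"] finB BB by (auto simp: top_unique)
      show "decseq ?R" by (auto simp: decseq_def)
      show "range ?R \<subseteq> sets (M \<Otimes>\<^sub>M M)" using BB by auto
    qed
    also have "(\<Inter>n. ?R n) = {}" by blast
    finally have "(\<lambda>n. emeasure (M \<Otimes>\<^sub>M M) (?R n)) \<longlonglongrightarrow> 0" by simp
    then have "eventually (\<lambda>n. emeasure (M \<Otimes>\<^sub>M M) (?R n) < ennreal (e / 2)) sequentially"
      using Union.prems by (intro order_tendstoD) auto
    then obtain N where N: "emeasure (M \<Otimes>\<^sub>M M) (?R N) < ennreal (e / 2)"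
      by (auto simp: eventually_sequentially)
    \<comment> \<open>\<open>N\<close> errors of this size add up to at most \<open>e / 2\<close>;
      the + 1 guards against \<open>N = 0\<close>.\<close>
    define e' where "e' = e / (2 * (N + 1))"
    have e': "0 < e'" using Union.prems by (simp add: e'_def)
    let ?P = "\<lambda>i (c :: 'a \<Rightarrow> nat) S. c \<in> measurable M (count_space UNIV) \<and>
        emeasure (M \<Otimes>\<^sub>M M) {z \<in> B \<times> B. (z \<in> H i) \<noteq> ((c (fst z), c (snd z)) \<in> S)} < ennreal e'"
    have "\<forall>i. \<exists>c S. ?P i c S"
      using Union.IH e' by blast
    from choice[OF this] obtain c where "\<forall>i. \<exists>S. ?P i (c i) S" by blast
    from choice[OF this] obtain S where c: "\<And>i. c i \<in> measurable M (count_space UNIV)"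
      and S: "\<And>i. emeasure (M \<Otimes>\<^sub>M M) {z \<in> B \<times> B. (z \<in> H i) \<noteq> ((c i (fst z), c i (snd z)) \<in> S i)} < ennreal e'"
      by blast
    let ?D = "\<lambda>i. {z \<in> B \<times> B. (z \<in> H i) \<noteq> ((c i (fst z), c i (snd z)) \<in> S i)}"
    \<comment> \<open>One label stores the labels of all \<open>N\<close> approximations as an
      encoded list, and \<open>T\<close> decodes it to form the union of the
      \<open>S i\<close>.\<close>
    define C where "C x = to_nat (map (\<lambda>i. c i x) [0..<N])" for x
    define T where "T = {(a, b). \<exists>i<N. ((from_nat a :: nat list) ! i, (from_nat b :: nat list) ! i) \<in> S i}"
    have T: "(C x, C y) \<in> T \<longleftrightarrow> (\<exists>i<N. (c i x, c i y) \<in> S i)" for x y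
      by (auto simp: C_def T_def)
    have C: "C \<in> measurable M (count_space UNIV)"
      unfolding C_def by (rule measurable_compose[OF measurable_map_upt[OF c]]) simp
    have D[measurable]: "?D i \<in> sets (M \<Otimes>\<^sub>M M)" for i
    proof -
      have "?D i = {z \<in> space (M \<Otimes>\<^sub>M M). z \<in> B \<times> B \<and> (z \<in> H i) \<noteq> ((c i (fst z), c i (snd z)) \<in> S i)}"
        using Bsp by (auto simp: space_pair_measure)
      also have "\<dots> \<in> sets (M \<Otimes>\<^sub>M M)" using step_pred[OF c] BB by measurable
      finally show ?thesis .
    qed
    have R: "?R N \<in> sets (M \<Otimes>\<^sub>M M)" using BB by auto
    have UD: "(\<Union>i<N. ?D i) \<in> sets (M \<Otimes>\<^sub>M M)" by (rule sets.finite_UN[OF finite_lessThan D])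
    have "emeasure (M \<Otimes>\<^sub>M M) {z \<in> B \<times> B. (z \<in> \<Union> (range H)) \<noteq> ((C (fst z), C (snd z)) \<in> T)}
        \<le> emeasure (M \<Otimes>\<^sub>M M) (?R N \<union> (\<Union>i<N. ?D i))"
      by (rule emeasure_mono[OF _ sets.Un[OF R UD]]) (auto simp: T)
    also have "\<dots> \<le> emeasure (M \<Otimes>\<^sub>M M) (?R N) + emeasure (M \<Otimes>\<^sub>M M) (\<Union>i<N. ?D i)"
      by (rule emeasure_subadditive[OF R UD])
    also have "\<dots> \<le> emeasure (M \<Otimes>\<^sub>M M) (?R N) + (\<Sum>i<N. emeasure (M \<Otimes>\<^sub>M M) (?D i))"
      using D by (intro add_left_mono emeasure_subadditive_finite image_subsetI) simp_all
    also have "\<dots> \<le> emeasure (M \<Otimes>\<^sub>M M) (?R N) + (\<Sum>i<N. ennreal e')"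
      using S by (intro add_left_mono sum_mono less_imp_le)
    also have "\<dots> \<le> emeasure (M \<Otimes>\<^sub>M M) (?R N) + ennreal (e / 2)"
      using e' Union.prems
      by (intro add_left_mono)
        (simp add: ennreal_of_nat_eq_real_of_nat e'_def field_simps flip: ennreal_mult)
    also have "emeasure (M \<Otimes>\<^sub>M M) (?R N) + ennreal (e / 2) < ennreal (e / 2) + ennreal (e / 2)"
      using N by (simp add: add_strict_right_mono ennreal_add_left_cancel_less add.commute)
    also have "\<dots> = ennreal e" using Union.prems by (simp flip: ennreal_plus)
    finally show ?case using C by blast
  qed
qed

text \<open>Controls the L1 norm and the p-th power of the L^p norm by one quantity. For p > 1 an
  L^p error alone would leave the L1 norms of the step functions uncontrolled, and the bound
  \<open>C\<close> could not be passed on.\<close>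

definition L1p_int :: "real \<Rightarrow> 'a measure \<Rightarrow> ('a \<Rightarrow> real) \<Rightarrow> ennreal" where
  "L1p_int p M f = Lp_int 1 M f + Lp_int p M f"

lemma L1p_int_add_le:
  assumes [measurable]: "f \<in> borel_measurable M" "g \<in> borel_measurable M" and p: "1 \<le> p"
  shows "L1p_int p M (\<lambda>z. f z + g z) \<le> ennreal (2 powr p) * (L1p_int p M f + L1p_int p M g)"
proof -
  have "Lp_int 1 M (\<lambda>z. f z + g z) \<le> ennreal (2 powr 1) * (Lp_int 1 M f + Lp_int 1 M g)"
    by (rule Lp_int_add_le) auto
  also have "\<dots> \<le> ennreal (2 powr p) * (Lp_int 1 M f + Lp_int 1 M g)"
    using p by (intro mult_right_mono ennreal_leI powr_mono) auto
  finally have "Lp_int 1 M (\<lambda>z. f z + g z) + Lp_int p M (\<lambda>z. f z + g z)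
    \<le> ennreal (2 powr p) * (Lp_int 1 M f + Lp_int 1 M g) + ennreal (2 powr p) * (Lp_int p M f + Lp_int p M g)"
    using p by (intro add_mono Lp_int_add_le) auto
  also have "\<dots> = ennreal (2 powr p) * (L1p_int p M f + L1p_int p M g)"
    by (simp add: L1p_int_def distrib_left add.assoc add.left_commute)
  finally show ?thesis by (simp add: L1p_int_def)
qed

lemma L1p_int_triangle:
  assumes [measurable]: "f \<in> borel_measurable M" "g \<in> borel_measurable M" "h \<in> borel_measurable M"
    and "1 \<le> p"
  shows "L1p_int p M (\<lambda>z. f z - h z)
    \<le> ennreal (2 powr p) * (L1p_int p M (\<lambda>z. f z - g z) + L1p_int p M (\<lambda>z. g z - h z))"
  using L1p_int_add_le[of "\<lambda>z. f z - g z" M "\<lambda>z. g z - h z" p] assms by simp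

lemma L1p_int_mono:
  assumes "\<And>z. z \<in> space M \<Longrightarrow> \<bar>f z\<bar> \<le> \<bar>g z\<bar>" "1 \<le> p"
  shows "L1p_int p M f \<le> L1p_int p M g"
  unfolding L1p_int_def using assms by (intro add_mono Lp_int_mono) auto

lemma L1p_int_cong:
  assumes "\<And>z. z \<in> space M \<Longrightarrow> f z = g z"
  shows "L1p_int p M f = L1p_int p M g"
  unfolding L1p_int_def by (simp add: Lp_int_cong[OF assms])

lemma Lp_int_cmult:
  assumes [measurable]: "f \<in> borel_measurable M"
  shows "Lp_int p M (\<lambda>z. a * f z) = ennreal (\<bar>a\<bar> powr p) * Lp_int p M f"
  unfolding Lp_int_def by (simp add: abs_mult powr_mult ennreal_mult nn_integral_cmult)

text \<open>The two summands scale with different powers of \<open>\<bar>a\<bar>\<close>, whence the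
  sum of both powers as a common factor.\<close>

lemma L1p_int_cmult_le:
  assumes "f \<in> borel_measurable M"
  shows "L1p_int p M (\<lambda>z. a * f z) \<le> ennreal (\<bar>a\<bar> + \<bar>a\<bar> powr p) * L1p_int p M f"
proof -
  have "L1p_int p M (\<lambda>z. a * f z) = ennreal \<bar>a\<bar> * Lp_int 1 M f + ennreal (\<bar>a\<bar> powr p) * Lp_int p M f"
    using assms by (simp add: L1p_int_def Lp_int_cmult)
  also have "\<dots> \<le> ennreal (\<bar>a\<bar> + \<bar>a\<bar> powr p) * Lp_int 1 M f + ennreal (\<bar>a\<bar> + \<bar>a\<bar> powr p) * Lp_int p M f"
    by (intro add_mono mult_right_mono ennreal_leI) auto
  finally show ?thesis by (simp add: L1p_int_def distrib_left)
qed

text \<open>Both coordinates are read through the same labelling, so a step function amounts to a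
  kernel on labels and one law on labels, which is all that the later transport preserves. Symmetry,
  positivity and finite cells are added to the approximation afterwards.\<close>

definition step_approximable :: "real \<Rightarrow> 'a measure \<Rightarrow> ('a \<times> 'a \<Rightarrow> real) \<Rightarrow> bool" where
  "step_approximable p M F \<longleftrightarrow> (\<forall>e>0. \<exists>(c :: 'a \<Rightarrow> nat) U. c \<in> measurable M (count_space UNIV) \<and>
     L1p_int p (M \<Otimes>\<^sub>M M) (\<lambda>z. F z - U (c (fst z)) (c (snd z))) < ennreal e)"

lemma borel_measurable_step [measurable (raw)]:
  fixes U :: "nat \<Rightarrow> nat \<Rightarrow> real"
  assumes "c \<in> measurable M (count_space UNIV)" "d \<in> measurable N (count_space UNIV)"
  shows "(\<lambda>z. U (c (fst z)) (d (snd z))) \<in> borel_measurable (M \<Otimes>\<^sub>M N)"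
  by (rule measurable_fst_snd_step[OF assms]) simp

section \<open>Closure properties and density of step functions\<close>

lemma step_approximable_add:
  assumes [measurable]: "F \<in> borel_measurable (M \<Otimes>\<^sub>M M)" "G \<in> borel_measurable (M \<Otimes>\<^sub>M M)"
    and F: "step_approximable p M F" and G: "step_approximable p M G" and p: "1 \<le> p"
  shows "step_approximable p M (\<lambda>z. F z + G z)"
  unfolding step_approximable_def
proof (intro allI impI)
  fix e :: real assume "0 < e"
  \<comment> \<open>Solves \<open>2 powr p * (e' + e') = e\<close>.\<close>
  define e' where "e' = e / (2 * 2 powr p)"
  have e': "0 < e'" using \<open>0 < e\<close> by (simp add: e'_def)
  obtain c :: "'a \<Rightarrow> nat" and U where c[measurable]: "c \<in> measurable M (count_space UNIV)"
    and U: "L1p_int p (M \<Otimes>\<^sub>M M) (\<lambda>z. F z - U (c (fst z)) (c (snd z))) < ennreal e'"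
    using F e' unfolding step_approximable_def by blast
  obtain d :: "'a \<Rightarrow> nat" and V where d[measurable]: "d \<in> measurable M (count_space UNIV)"
    and V: "L1p_int p (M \<Otimes>\<^sub>M M) (\<lambda>z. G z - V (d (fst z)) (d (snd z))) < ennreal e'"
    using G e' unfolding step_approximable_def by blast
  \<comment> \<open>Common refinement: on pairs of labels both step functions are step functions
    again.\<close>
  define C where "C x = prod_encode (c x, d x)" for x
  define W where "W i j = U (fst (prod_decode i)) (fst (prod_decode j)) + V (snd (prod_decode i)) (snd (prod_decode j))" for i j
  have C: "C \<in> measurable M (count_space UNIV)"
    unfolding C_def by (rule measurable_step[OF c d]) simp
  have "L1p_int p (M \<Otimes>\<^sub>M M) (\<lambda>z. (F z + G z) - W (C (fst z)) (C (snd z)))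
     = L1p_int p (M \<Otimes>\<^sub>M M) (\<lambda>z. (F z - U (c (fst z)) (c (snd z))) + (G z - V (d (fst z)) (d (snd z))))"
    by (intro L1p_int_cong) (simp add: W_def C_def)
  also have "\<dots> \<le> ennreal (2 powr p) * (L1p_int p (M \<Otimes>\<^sub>M M) (\<lambda>z. F z - U (c (fst z)) (c (snd z)))
      + L1p_int p (M \<Otimes>\<^sub>M M) (\<lambda>z. G z - V (d (fst z)) (d (snd z))))"
    using c d p by (intro L1p_int_add_le) measurable
  also have "\<dots> < ennreal (2 powr p) * (ennreal e' + ennreal e')"
    using U V by (intro ennreal_mult_strict_left_mono add_strict_mono) auto
  also have "\<dots> = ennreal e"
    using e' by (simp add: e'_def field_simps flip: ennreal_plus ennreal_mult)
  finally show "\<exists>(c :: 'a \<Rightarrow> nat) U. c \<in> measurable M (count_space UNIV) \<and>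
     L1p_int p (M \<Otimes>\<^sub>M M) (\<lambda>z. F z + G z - U (c (fst z)) (c (snd z))) < ennreal e"
    using C by blast
qed

lemma step_approximable_cmult:
  assumes [measurable]: "F \<in> borel_measurable (M \<Otimes>\<^sub>M M)" and F: "step_approximable p M F"
  shows "step_approximable p M (\<lambda>z. a * F z)"
  unfolding step_approximable_def
proof (intro allI impI)
  fix e :: real assume "0 < e"
  define b where "b = \<bar>a\<bar> + \<bar>a\<bar> powr p"
  have b: "0 \<le> b" by (simp add: b_def)
  \<comment> \<open>\<open>b + 1\<close> instead of \<open>b\<close> avoids division by zero when
    \<open>a = 0\<close> and makes the final inequality strict.\<close>
  have "0 < e / (b + 1)" using \<open>0 < e\<close> b by simp
  then obtain c :: "'a \<Rightarrow> nat" and U where c[measurable]: "c \<in> measurable M (count_space UNIV)"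
    and U: "L1p_int p (M \<Otimes>\<^sub>M M) (\<lambda>z. F z - U (c (fst z)) (c (snd z))) < ennreal (e / (b + 1))"
    using F unfolding step_approximable_def by blast
  have "L1p_int p (M \<Otimes>\<^sub>M M) (\<lambda>z. a * F z - a * U (c (fst z)) (c (snd z)))
    = L1p_int p (M \<Otimes>\<^sub>M M) (\<lambda>z. a * (F z - U (c (fst z)) (c (snd z))))"
    by (simp add: right_diff_distrib)
  also have "\<dots> \<le> ennreal b * L1p_int p (M \<Otimes>\<^sub>M M) (\<lambda>z. F z - U (c (fst z)) (c (snd z)))"
    unfolding b_def using c by (intro L1p_int_cmult_le) measurable
  also have "\<dots> \<le> ennreal b * ennreal (e / (b + 1))"
    using U by (intro mult_left_mono) auto
  also have "\<dots> < ennreal e"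
    using b \<open>0 < e\<close> by (simp add: ennreal_less_iff field_simps flip: ennreal_mult)
  finally show "\<exists>(c :: 'a \<Rightarrow> nat) U. c \<in> measurable M (count_space UNIV) \<and>
     L1p_int p (M \<Otimes>\<^sub>M M) (\<lambda>z. a * F z - U (c (fst z)) (c (snd z))) < ennreal e"
    using c by (intro exI[of _ c] exI[of _ "\<lambda>i j. a * U i j"] conjI)
qed

lemma step_approximable_sum:
  fixes M :: "'a measure"
  assumes "finite I" "\<And>i. i \<in> I \<Longrightarrow> F i \<in> borel_measurable (M \<Otimes>\<^sub>M M)"
    "\<And>i. i \<in> I \<Longrightarrow> step_approximable p M (F i)" "1 \<le> p"
  shows "step_approximable p M (\<lambda>z. \<Sum>i\<in>I. F i z)"
  using assms(1-3)
proof (induction I)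
  case empty
  show ?case
    unfolding step_approximable_def L1p_int_def Lp_int_def
  proof (intro allI impI)
    fix e :: real assume "0 < e"
    then show "\<exists>(c :: 'a \<Rightarrow> nat) U. c \<in> measurable M (count_space UNIV) \<and>
       (\<integral>\<^sup>+ z. ennreal (\<bar>sum (\<lambda>i. F i z) {} - U (c (fst z)) (c (snd z))\<bar> powr 1) \<partial>(M \<Otimes>\<^sub>M M))
       + (\<integral>\<^sup>+ z. ennreal (\<bar>sum (\<lambda>i. F i z) {} - U (c (fst z)) (c (snd z))\<bar> powr p) \<partial>(M \<Otimes>\<^sub>M M)) < ennreal e"
      by (intro exI[of _ "\<lambda>_. 0"] exI[of _ "\<lambda>_ _. 0"]) simp
  qed
next
  case (insert i I)
  have "step_approximable p M (\<lambda>z. F i z + (\<Sum>i\<in>I. F i z))"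
    using insert assms(4) by (intro step_approximable_add borel_measurable_sum) auto
  then show ?case using insert by simp
qed

lemma step_approximable_limit:
  assumes [measurable]: "F \<in> borel_measurable (M \<Otimes>\<^sub>M M)" "\<And>i. G i \<in> borel_measurable (M \<Otimes>\<^sub>M M)"
    and G: "\<And>i :: nat. step_approximable p M (G i)" and p: "1 \<le> p"
    and lim: "(\<lambda>i. L1p_int p (M \<Otimes>\<^sub>M M) (\<lambda>z. F z - G i z)) \<longlonglongrightarrow> 0"
  shows "step_approximable p M F"
  unfolding step_approximable_def
proof (intro allI impI)
  fix e :: real assume "0 < e"
  define e' where "e' = e / (2 * 2 powr p)"
  have e': "0 < e'" using \<open>0 < e\<close> by (simp add: e'_def)
  have "eventually (\<lambda>i. L1p_int p (M \<Otimes>\<^sub>M M) (\<lambda>z. F z - G i z) < ennreal e') sequentially"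
    using e' by (intro order_tendstoD(2)[OF lim]) simp
  then obtain i where i: "L1p_int p (M \<Otimes>\<^sub>M M) (\<lambda>z. F z - G i z) < ennreal e'"
    by (auto simp: eventually_sequentially)
  obtain c :: "'a \<Rightarrow> nat" and U where c[measurable]: "c \<in> measurable M (count_space UNIV)"
    and U: "L1p_int p (M \<Otimes>\<^sub>M M) (\<lambda>z. G i z - U (c (fst z)) (c (snd z))) < ennreal e'"
    using G[of i] e' unfolding step_approximable_def by blast
  have "L1p_int p (M \<Otimes>\<^sub>M M) (\<lambda>z. F z - U (c (fst z)) (c (snd z)))
    \<le> ennreal (2 powr p) * (L1p_int p (M \<Otimes>\<^sub>M M) (\<lambda>z. F z - G i z)
      + L1p_int p (M \<Otimes>\<^sub>M M) (\<lambda>z. G i z - U (c (fst z)) (c (snd z))))"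
    using c p by (intro L1p_int_triangle) measurable
  also have "\<dots> < ennreal (2 powr p) * (ennreal e' + ennreal e')"
    using i U by (intro ennreal_mult_strict_left_mono add_strict_mono) auto
  also have "\<dots> = ennreal e"
    using e' by (simp add: e'_def field_simps flip: ennreal_plus ennreal_mult)
  finally show "\<exists>(c :: 'a \<Rightarrow> nat) U. c \<in> measurable M (count_space UNIV) \<and>
     L1p_int p (M \<Otimes>\<^sub>M M) (\<lambda>z. F z - U (c (fst z)) (c (snd z))) < ennreal e"
    using c by blast
qed

text \<open>Exhausting the space by sets \<open>A n\<close> of finite mass reduces the claim to one
  square \<open>A n \<times> A n\<close>: as \<open>H\<close> has finite measure, the measure of its
  part outside the squares tends to 0.\<close>

lemma step_approximable_indicator:
  assumes "sigma_finite_measure M" and H[measurable]: "H \<in> sets (M \<Otimes>\<^sub>M M)"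
    and fin: "emeasure (M \<Otimes>\<^sub>M M) H < \<infinity>"
  shows "step_approximable p M (indicator H)"
  unfolding step_approximable_def
proof (intro allI impI)
  fix e :: real assume "0 < e"
  interpret sigma_finite_measure M by fact
  let ?P = "M \<Otimes>\<^sub>M M"
  obtain A :: "nat \<Rightarrow> 'a set" where A: "range A \<subseteq> sets M" "(\<Union>i. A i) = space M"
    "\<And>i. emeasure M (A i) \<noteq> \<infinity>" "incseq A"
    by (rule sigma_finite_incseq) blast
  have [measurable]: "A n \<in> sets M" for n using A(1) by auto
  have Hsp: "H \<subseteq> space M \<times> space M" using sets.sets_into_space[OF H] by (simp add: space_pair_measure)
  have "(\<lambda>n. emeasure ?P (H - A n \<times> A n)) \<longlonglongrightarrow> emeasure ?P (\<Inter>n. H - A n \<times> A n)"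
  proof (rule Lim_emeasure_decseq)
    show "emeasure ?P (H - A n \<times> A n) \<noteq> \<infinity>" for n
      using emeasure_mono[of "H - A n \<times> A n" H ?P] fin by (auto simp: top_unique)
    show "decseq (\<lambda>n. H - A n \<times> A n)" using A(4) by (auto simp: decseq_def incseq_def)
  qed auto
  also have "(\<Inter>n. H - A n \<times> A n) = {}"
  proof -
    have "\<exists>n. x \<in> A n \<and> y \<in> A n" if "(x, y) \<in> H" for x y
    proof -
      obtain i j where "x \<in> A i" "y \<in> A j" using A(2) Hsp \<open>(x, y) \<in> H\<close> by blast
      then have "x \<in> A (max i j)" "y \<in> A (max i j)"
        using incseqD[OF A(4), of i "max i j"] incseqD[OF A(4), of j "max i j"] by auto
      then show ?thesis by blast
    qed
    then show ?thesis by fastforce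
  qed
  finally have "(\<lambda>n. emeasure ?P (H - A n \<times> A n)) \<longlonglongrightarrow> 0" by simp
  then have "eventually (\<lambda>n. emeasure ?P (H - A n \<times> A n) < ennreal (e / 4)) sequentially"
    using \<open>0 < e\<close> by (intro order_tendstoD) auto
  then obtain n where n: "emeasure ?P (H - A n \<times> A n) < ennreal (e / 4)"
    by (auto simp: eventually_sequentially)
  have "emeasure M (A n) < \<infinity>" using A(3)[of n] by (simp add: less_top)
  moreover have "0 < e / 4" using \<open>0 < e\<close> by simp
  ultimately obtain c :: "'a \<Rightarrow> nat" and S where c[measurable]: "c \<in> measurable M (count_space UNIV)"
    and S: "emeasure ?P {z \<in> A n \<times> A n. (z \<in> H) \<noteq> ((c (fst z), c (snd z)) \<in> S)} < ennreal (e / 4)"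
    using product_set_step_approx[OF assms(1) _ _ H, of "A n" "e / 4"] by auto
  let ?D = "{z \<in> A n \<times> A n. (z \<in> H) \<noteq> ((c (fst z), c (snd z)) \<in> S)}"
  \<comment> \<open>Label 0 is reserved for the complement of \<open>A n\<close>, where the step
    function vanishes; hence the shift by \<open>Suc\<close>.\<close>
  define C where "C x = (if x \<in> A n then Suc (c x) else 0)" for x
  define U :: "nat \<Rightarrow> nat \<Rightarrow> real" where
    "U i j = (if 0 < i \<and> 0 < j \<and> (i - 1, j - 1) \<in> S then 1 else 0)" for i j
  have C[measurable]: "C \<in> measurable M (count_space UNIV)" unfolding C_def by measurable
  have d: "\<bar>indicator H z - U (C (fst z)) (C (snd z))\<bar> = indicator ((H - A n \<times> A n) \<union> ?D) z" for z
    by (cases z) (auto simp: U_def C_def indicator_def)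
  have [measurable]: "(\<lambda>z. indicator H z - U (C (fst z)) (C (snd z))) \<in> borel_measurable ?P"
    by measurable
  \<comment> \<open>Measurability of \<open>?D\<close> is recovered from the difference itself:
    \<open>?D\<close> is where it has absolute value 1 inside the square.\<close>
  have D: "?D \<in> sets ?P"
  proof -
    have "{z \<in> space ?P. \<bar>indicator H z - U (C (fst z)) (C (snd z))\<bar> = 1 \<and> z \<in> A n \<times> A n} \<in> sets ?P"
      by measurable
    also have "{z \<in> space ?P. \<bar>indicator H z - U (C (fst z)) (C (snd z))\<bar> = 1 \<and> z \<in> A n \<times> A n} = ?D"
      unfolding d indicator_eq_1_iff using sets.sets_into_space[of "A n" M]
      by (auto simp: space_pair_measure)
    finally show ?thesis .
  qed
  \<comment> \<open>The difference takes only the values 0, 1 and -1, so all exponents give the same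
    integral and one estimate serves L1 and L^p.\<close>
  have "Lp_int q ?P (\<lambda>z. indicator H z - U (C (fst z)) (C (snd z))) < ennreal (e / 2)" for q
  proof -
    have "Lp_int q ?P (\<lambda>z. indicator H z - U (C (fst z)) (C (snd z)))
      = (\<integral>\<^sup>+ z. indicator ((H - A n \<times> A n) \<union> ?D) z \<partial>?P)"
      unfolding Lp_int_def d by (intro nn_integral_cong) (auto simp: indicator_def)
    also have "\<dots> = emeasure ?P ((H - A n \<times> A n) \<union> ?D)"
      using D by (intro nn_integral_indicator) auto
    also have "\<dots> \<le> emeasure ?P (H - A n \<times> A n) + emeasure ?P ?D"
      using D by (intro emeasure_subadditive) auto
    also have "\<dots> < ennreal (e / 4) + ennreal (e / 4)"
      using n S by (intro add_strict_mono)
    also have "\<dots> = ennreal (e / 2)" using \<open>0 < e\<close> by (simp flip: ennreal_plus)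
    finally show ?thesis .
  qed
  then have "L1p_int p ?P (\<lambda>z. indicator H z - U (C (fst z)) (C (snd z))) < ennreal (e / 2) + ennreal (e / 2)"
    unfolding L1p_int_def by (intro add_strict_mono)
  also have "\<dots> = ennreal e" using \<open>0 < e\<close> by (simp flip: ennreal_plus)
  finally show "\<exists>(c :: 'a \<Rightarrow> nat) U. c \<in> measurable M (count_space UNIV) \<and>
     L1p_int p ?P (\<lambda>z. indicator H z - U (c (fst z)) (c (snd z))) < ennreal e"
    using C by blast
qed

lemma Lp_int_dominated_limit:
  assumes [measurable]: "F \<in> borel_measurable M" "\<And>i. G i \<in> borel_measurable M" and p: "1 \<le> p"
    and lim: "\<And>z. z \<in> space M \<Longrightarrow> (\<lambda>i. G i z) \<longlonglongrightarrow> F z"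
    and bound: "\<And>i z. z \<in> space M \<Longrightarrow> \<bar>G i z\<bar> \<le> 2 * \<bar>F z\<bar>"
    and fin: "Lp_int p M F < \<infinity>"
  shows "(\<lambda>i. Lp_int p M (\<lambda>z. F z - G i z)) \<longlonglongrightarrow> 0"
proof -
  have "(\<lambda>i. \<integral>\<^sup>+ z. ennreal (\<bar>F z - G i z\<bar> powr p) \<partial>M) \<longlonglongrightarrow> (\<integral>\<^sup>+ z. 0 \<partial>M)"
  \<comment> \<open>The constant 3 is 1 + 2, one \<open>\<bar>F z\<bar>\<close> for \<open>F\<close>
    and two for the bound on \<open>G i\<close>.\<close>
  proof (rule nn_integral_dominated_convergence[where w = "\<lambda>z. ennreal (3 powr p) * ennreal (\<bar>F z\<bar> powr p)"])
    have "\<bar>F z - G i z\<bar> powr p \<le> 3 powr p * \<bar>F z\<bar> powr p" if "z \<in> space M" for i z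
    proof -
      have "\<bar>F z - G i z\<bar> powr p \<le> (3 * \<bar>F z\<bar>) powr p"
        using bound[OF that, of i] p by (intro powr_mono2) auto
      then show ?thesis by (simp add: powr_mult)
    qed
    then show "AE z in M. ennreal (\<bar>F z - G i z\<bar> powr p) \<le> ennreal (3 powr p) * ennreal (\<bar>F z\<bar> powr p)" for i
      by (intro AE_I2) (simp add: ennreal_leI flip: ennreal_mult)
    show "(\<integral>\<^sup>+ z. ennreal (3 powr p) * ennreal (\<bar>F z\<bar> powr p) \<partial>M) < \<infinity>"
      using fin by (simp add: nn_integral_cmult Lp_int_def ennreal_mult_less_top)
    have "(\<lambda>i. ennreal (\<bar>F z - G i z\<bar> powr p)) \<longlonglongrightarrow> 0" if "z \<in> space M" for z
    proof -
      have "(\<lambda>i. \<bar>F z - G i z\<bar>) \<longlonglongrightarrow> 0"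
        using tendsto_rabs[OF tendsto_diff[OF tendsto_const lim[OF that], of "F z"]] by simp
      then have "(\<lambda>i. \<bar>F z - G i z\<bar> powr p) \<longlonglongrightarrow> 0 powr p"
        using p by (intro tendsto_powr2) auto
      then show ?thesis using tendsto_ennrealI by fastforce
    qed
    then show "AE z in M. (\<lambda>i. ennreal (\<bar>F z - G i z\<bar> powr p)) \<longlonglongrightarrow> 0"
      by (intro AE_I2)
  qed measurable
  then show ?thesis by (simp add: Lp_int_def)
qed

text \<open>Simple functions converge to \<open>F\<close> with absolute values at most
  \<open>2 * \<bar>F\<bar>\<close>. This gives domination at both exponents and, because
  \<open>F\<close> is in L1, finite measure for each level set of a nonzero value; those level sets
  are covered by the case of indicators.\<close>

lemma step_approximable_L1p:
  assumes "sigma_finite_measure M" and F[measurable]: "F \<in> borel_measurable (M \<Otimes>\<^sub>M M)"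
    and fin: "L1p_int p (M \<Otimes>\<^sub>M M) F < \<infinity>" and p: "1 \<le> p"
  shows "step_approximable p M F"
proof -
  let ?P = "M \<Otimes>\<^sub>M M"
  obtain s where s: "\<And>i. simple_function ?P (s i)"
    "\<And>z. z \<in> space ?P \<Longrightarrow> (\<lambda>i. s i z) \<longlonglongrightarrow> F z"
    "\<And>i z. z \<in> space ?P \<Longrightarrow> dist (s i z) 0 \<le> 2 * dist (F z) 0"
    using borel_measurable_implies_sequence_metric[OF F, of 0] by blast
  have [measurable]: "s i \<in> borel_measurable ?P" for i
    by (rule borel_measurable_simple_function[OF s(1)])
  have fin1: "Lp_int 1 ?P F < \<infinity>" "Lp_int p ?P F < \<infinity>"
    using fin by (auto simp: L1p_int_def)
  have ap: "step_approximable p M (s i)" for i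
  proof -
    let ?S = "\<lambda>y. s i -` {y} \<inter> space ?P"
    have S[measurable]: "?S y \<in> sets ?P" for y by measurable
    have finS: "emeasure ?P (?S y) < \<infinity>" if "y \<noteq> 0" for y
    proof -
      have "ennreal \<bar>y\<bar> * emeasure ?P (?S y) = (\<integral>\<^sup>+ z. ennreal \<bar>y\<bar> * indicator (?S y) z \<partial>?P)"
        by (simp add: nn_integral_cmult)
      also have "\<dots> \<le> (\<integral>\<^sup>+ z. ennreal 2 * ennreal (\<bar>F z\<bar> powr 1) \<partial>?P)"
      proof (intro nn_integral_mono)
        fix z assume "z \<in> space ?P"
        then have "ennreal \<bar>s i z\<bar> \<le> ennreal 2 * ennreal \<bar>F z\<bar>"
          using s(3)[of z i] by (subst ennreal_mult[symmetric]) (auto intro: ennreal_leI)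
        then show "ennreal \<bar>y\<bar> * indicator (?S y) z \<le> ennreal 2 * ennreal (\<bar>F z\<bar> powr 1)"
          by (auto simp: indicator_def)
      qed
      also have "\<dots> = ennreal 2 * Lp_int 1 ?P F" 
        unfolding Lp_int_def by (rule nn_integral_cmult) measurable
      also have "\<dots> < \<infinity>" using fin1 by (simp add: ennreal_mult_less_top)
      finally show ?thesis using \<open>y \<noteq> 0\<close> by (auto simp: ennreal_mult_less_top)
    qed
    let ?I = "s i ` space ?P - {0}"
    have "step_approximable p M (\<lambda>z. \<Sum>y\<in>?I. y * indicator (?S y) z)"
      using simple_functionD(1)[OF s(1)[of i]] p
      by (intro step_approximable_sum step_approximable_cmult
          step_approximable_indicator[OF assms(1) S finS]) auto
    moreover have "(\<Sum>y\<in>?I. y * indicator (?S y) z) = s i z" if "z \<in> space ?P" for z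
    proof -
      have fI: "finite ?I" using simple_functionD(1)[OF s(1)[of i]] by simp
      have "(\<Sum>y\<in>?I. y * indicator (?S y) z) = (\<Sum>y\<in>?I. if y = s i z then y else 0)"
        using that by (intro sum.cong) (auto simp: indicator_def)
      also have "\<dots> = s i z" using that fI by (auto simp: sum.delta)
      finally show ?thesis .
    qed
    then have "L1p_int p ?P (\<lambda>z. s i z - V z) = L1p_int p ?P (\<lambda>z. (\<Sum>y\<in>?I. y * indicator (?S y) z) - V z)" for V
      by (intro L1p_int_cong) simp
    ultimately show ?thesis unfolding step_approximable_def by simp
  qed
  have "(\<lambda>i. Lp_int 1 ?P (\<lambda>z. F z - s i z) + Lp_int p ?P (\<lambda>z. F z - s i z)) \<longlonglongrightarrow> 0 + 0"
    using s fin1 p by (intro tendsto_add Lp_int_dominated_limit) auto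
  then show ?thesis
    by (intro step_approximable_limit[of F M s] ap p) (simp_all add: L1p_int_def)
qed

lemma Lp_int_swap:
  assumes "sigma_finite_measure M" and [measurable]: "F \<in> borel_measurable (M \<Otimes>\<^sub>M M)"
  shows "Lp_int p (M \<Otimes>\<^sub>M M) (\<lambda>z. F (snd z, fst z)) = Lp_int p (M \<Otimes>\<^sub>M M) F"
proof -
  interpret sigma_finite_measure M by fact
  interpret P: pair_sigma_finite M M ..
  have "Lp_int p (M \<Otimes>\<^sub>M M) F = (\<integral>\<^sup>+ z. ennreal (\<bar>F z\<bar> powr p) \<partial>distr (M \<Otimes>\<^sub>M M) (M \<Otimes>\<^sub>M M) (\<lambda>(x, y). (y, x)))"
    unfolding Lp_int_def by (subst P.distr_pair_swap) simp
  also have "\<dots> = Lp_int p (M \<Otimes>\<^sub>M M) (\<lambda>z. F (snd z, fst z))"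
    unfolding Lp_int_def by (subst nn_integral_distr) (auto simp: case_prod_beta)
  finally show ?thesis ..
qed

text \<open>Finite cells come from refining the labels by the first exhausting set that contains the
  point. Symmetry comes from averaging \<open>U\<close> with its transpose, which costs a constant
  factor because \<open>W\<close> is itself symmetric. Nonnegativity comes from cutting at 0, which
  only moves values closer to a nonnegative \<open>W\<close>.\<close>

lemma graphon_step_approx:
  fixes M :: "'a measure"
  assumes "sigma_finite_measure M" and W[measurable]: "(\<lambda>z. W (fst z) (snd z)) \<in> borel_measurable (M \<Otimes>\<^sub>M M)"
    and sym: "\<And>x y. x \<in> space M \<Longrightarrow> y \<in> space M \<Longrightarrow> W x y = W y x"
    and fin: "L1p_int p (M \<Otimes>\<^sub>M M) (\<lambda>z. W (fst z) (snd z)) < \<infinity>" and p: "1 \<le> p" and e: "0 < e"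
  shows "\<exists>(c :: 'a \<Rightarrow> nat) U. c \<in> measurable M (count_space UNIV)
    \<and> (\<forall>i. emeasure M (c -` {i} \<inter> space M) < \<infinity>) \<and> (\<forall>i j. U i j = U j i)
    \<and> ((\<forall>x\<in>space M. \<forall>y\<in>space M. 0 \<le> W x y) \<longrightarrow> (\<forall>i j. 0 \<le> U i j))
    \<and> L1p_int p (M \<Otimes>\<^sub>M M) (\<lambda>z. W (fst z) (snd z) - U (c (fst z)) (c (snd z))) < ennreal e"
proof -
  interpret sigma_finite_measure M by fact
  let ?P = "M \<Otimes>\<^sub>M M"
  let ?nn = "\<forall>x\<in>space M. \<forall>y\<in>space M. 0 \<le> W x y"
  \<comment> \<open>The denominator collects the losses of the averaging:
    \<open>1 / 2 + (1 / 2) powr p\<close> for halving, \<open>2 powr p\<close> for the sum, and 2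
    because the transpose has the same error.\<close>
  define e' where "e' = e / (2 * 2 powr p * (1 / 2 + (1 / 2) powr p))"
  have "0 < 1 / 2 + (1 / 2 :: real) powr p" by (intro add_pos_nonneg) auto
  then have pos: "0 < 2 * 2 powr p * (1 / 2 + (1 / 2 :: real) powr p)" by simp
  have e': "0 < e'" using e pos by (simp add: e'_def del: mult_pos_pos)
  obtain c :: "'a \<Rightarrow> nat" and U where c[measurable]: "c \<in> measurable M (count_space UNIV)"
    and U: "L1p_int p ?P (\<lambda>z. W (fst z) (snd z) - U (c (fst z)) (c (snd z))) < ennreal e'"
    using step_approximable_L1p[OF assms(1) W fin p] e' unfolding step_approximable_def by blast
  obtain A :: "nat \<Rightarrow> 'a set" where A: "range A \<subseteq> sets M" "(\<Union>i. A i) = space M"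
    "\<And>i. emeasure M (A i) \<noteq> \<infinity>"
    by (rule sigma_finite) blast
  have [measurable]: "A n \<in> sets M" for n using A(1) by auto
  define a where "a x = (LEAST n. x \<in> A n)" for x
  have a[measurable]: "a \<in> measurable M (count_space UNIV)" unfolding a_def by measurable
  have aA: "x \<in> A (a x)" if "x \<in> space M" for x
  proof -
    have "x \<in> (\<Union>i. A i)" using A(2) that by simp
    then obtain n where "x \<in> A n" by blast
    then show ?thesis unfolding a_def by (rule LeastI)
  qed
  define C where "C x = prod_encode (c x, a x)" for x
  define u where "u i j = U (fst (prod_decode i)) (fst (prod_decode j))" for i j
  define V where "V i j = (u i j + u j i) / 2" for i j
  define nn where "nn \<longleftrightarrow> ?nn"
  define V' where "V' i j = (if nn then max 0 (V i j) else V i j)" for i j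
  have C[measurable]: "C \<in> measurable M (count_space UNIV)"
    unfolding C_def by (rule measurable_step[OF c a]) simp
  have "emeasure M (C -` {i} \<inter> space M) < \<infinity>" for i
  proof -
    have "C -` {i} \<inter> space M \<subseteq> A (snd (prod_decode i))"
      using aA by (auto simp: C_def)
    then have "emeasure M (C -` {i} \<inter> space M) \<le> emeasure M (A (snd (prod_decode i)))"
      by (intro emeasure_mono) auto
    also have "\<dots> < \<infinity>" using A(3)[of "snd (prod_decode i)"] by (simp add: less_top)
    finally show ?thesis .
  qed
  moreover have "\<forall>i j. V' i j = V' j i"
  proof (intro allI)
    fix i j
    have "V i j = V j i" by (simp add: V_def)
    then show "V' i j = V' j i" by (simp only: V'_def)
  qed
  moreover have "?nn \<longrightarrow> (\<forall>i j. 0 \<le> V' i j)" 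
  proof (intro impI allI)
    fix i j assume ?nn
    then have nn unfolding nn_def .
    then show "0 \<le> V' i j" by (simp add: V'_def)
  qed
  moreover have "L1p_int p ?P (\<lambda>z. W (fst z) (snd z) - V' (C (fst z)) (C (snd z))) < ennreal e"
  proof -
    let ?f = "\<lambda>z. W (fst z) (snd z) - u (C (fst z)) (C (snd z))"
    have u: "L1p_int p ?P ?f < ennreal e'" using U by (simp add: u_def C_def)
    have "L1p_int p ?P (\<lambda>z. W (fst z) (snd z) - V' (C (fst z)) (C (snd z)))
       \<le> L1p_int p ?P (\<lambda>z. W (fst z) (snd z) - V (C (fst z)) (C (snd z)))"
    proof (intro L1p_int_mono p)
      fix z assume "z \<in> space ?P"
      then have "nn \<longrightarrow> 0 \<le> W (fst z) (snd z)" by (auto simp: nn_def space_pair_measure)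
      then show "\<bar>W (fst z) (snd z) - V' (C (fst z)) (C (snd z))\<bar>
          \<le> \<bar>W (fst z) (snd z) - V (C (fst z)) (C (snd z))\<bar>"
        by (cases nn) (auto simp: V'_def abs_real_def max_def)
    qed
    also have "\<dots> = L1p_int p ?P (\<lambda>z. 1 / 2 * (?f z + ?f (snd z, fst z)))"
      by (intro L1p_int_cong) (auto simp: V_def space_pair_measure sym field_simps)
    also have "\<dots> \<le> ennreal (\<bar>1/2\<bar> + \<bar>1/2\<bar> powr p) * L1p_int p ?P (\<lambda>z. ?f z + ?f (snd z, fst z))"
      by (intro L1p_int_cmult_le) measurable
    also have "\<dots> \<le> ennreal (\<bar>1/2\<bar> + \<bar>1/2\<bar> powr p) * (ennreal (2 powr p) * (L1p_int p ?P ?f + L1p_int p ?P (\<lambda>z. ?f (snd z, fst z))))"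
      using p by (intro mult_left_mono L1p_int_add_le) measurable
    also have "L1p_int p ?P (\<lambda>z. ?f (snd z, fst z)) = L1p_int p ?P ?f"
    proof -
      have "Lp_int q ?P (\<lambda>z. ?f (snd z, fst z)) = Lp_int q ?P ?f" for q
        by (rule Lp_int_swap[OF assms(1)]) measurable
      then show ?thesis by (simp only: L1p_int_def)
    qed
    also have "ennreal (\<bar>1/2\<bar> + \<bar>1/2\<bar> powr p) * (ennreal (2 powr p) * (L1p_int p ?P ?f + L1p_int p ?P ?f))
       = ennreal (2 * 2 powr p * (1 / 2 + (1 / 2) powr p)) * L1p_int p ?P ?f"
      by (simp add: ennreal_mult mult_2[symmetric] ac_simps)
    also have "\<dots> < ennreal (2 * 2 powr p * (1 / 2 + (1 / 2) powr p)) * ennreal e'"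
      using u pos by (intro ennreal_mult_strict_left_mono) (simp_all del: mult_pos_pos)
    also have "\<dots> = ennreal e" 
    proof -
      define b where "b = 2 * 2 powr p * (1 / 2 + (1 / 2 :: real) powr p)"
      have "0 < b" "e' = e / b" using pos by (simp_all only: b_def e'_def)
      then have "ennreal b * ennreal e' = ennreal e" using e by (simp flip: ennreal_mult)
      then show ?thesis by (simp only: b_def)
    qed
    finally show ?thesis .
  qed
  ultimately show ?thesis using C by blast
qed

section \<open>Splitting a non-atomic measure\<close>

text \<open>A measurable height function whose distribution function is Lipschitz: this is all
  that is used of Lebesgue measure on a half-line to split sets into pieces of prescribed measure.\<close>
locale height_measure =
  fixes M :: "'a measure" and h :: "'a \<Rightarrow> real"
  assumes h_meas[measurable]: "h \<in> borel_measurable M"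
    and h_nonneg: "x \<in> space M \<Longrightarrow> 0 \<le> h x"
    and h_Lipschitz: "a \<le> b \<Longrightarrow> emeasure M {x \<in> space M. a < h x \<and> h x \<le> b} \<le> ennreal (b - a)"
begin

lemma emeasure_h_le: "emeasure M {x \<in> space M. h x \<le> t} \<le> ennreal (t + 1)"
proof (cases "-1 \<le> t")
  case True
  \<comment> \<open>A half-open range starting at 0 would lose the points with
    \<open>h x = 0\<close>. As \<open>h\<close> is nonnegative, starting at -1 loses nothing and
    costs the + 1.\<close>
  have "{x \<in> space M. h x \<le> t} = {x \<in> space M. -1 < h x \<and> h x \<le> t}"
    using h_nonneg by (auto intro: less_le_trans[of "-1" 0])
  then show ?thesis using h_Lipschitz[OF True] by simp
next
  case False
  then have "{x \<in> space M. h x \<le> t} = {}" using h_nonneg by fastforce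
  then show ?thesis by (simp only: emeasure_empty zero_le)
qed

lemma sigma_finite: "sigma_finite_measure M"
proof (rule sigma_finite_measure.intro, intro exI[of _ "range (\<lambda>n::nat. {x \<in> space M. h x \<le> n})"] conjI ballI)
  show "\<Union> (range (\<lambda>n::nat. {x \<in> space M. h x \<le> n})) = space M"
    by (auto intro: real_arch_simple)
next
  fix a assume "a \<in> range (\<lambda>n::nat. {x \<in> space M. h x \<le> n})"
  then obtain n :: nat where "a = {x \<in> space M. h x \<le> n}" by auto
  then show "emeasure M a \<noteq> \<infinity>" using le_less_trans[OF emeasure_h_le[of n] ennreal_less_top] by auto
qed auto

text \<open>The distribution function transform: if \<open>F t\<close> is the measure of the part of
  \<open>A\<close> at height at most \<open>t\<close>, then \<open>V = F \<circ> h\<close> is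
  uniformly distributed on \<open>A\<close>. The Lipschitz bound makes \<open>F\<close> continuous,
  so \<open>F\<close> takes every value from 0 up to, but possibly excluding, the mass of
  \<open>A\<close>.\<close>

lemma exists_level:
  assumes A[measurable]: "A \<in> sets M"
  obtains V where "V \<in> borel_measurable M"
    "\<And>s. 0 \<le> s \<Longrightarrow> ennreal s \<le> emeasure M A \<Longrightarrow> emeasure M {x \<in> A. V x \<le> s} = ennreal s"
proof
  define S where "S t = {x \<in> A. h x \<le> t}" for t
  have S_eq: "S t = {x \<in> space M. x \<in> A \<and> h x \<le> t}" for t
    using sets.sets_into_space[OF A] by (auto simp: S_def)
  have S[measurable]: "S t \<in> sets M" for t unfolding S_eq by measurable
  have finS: "emeasure M (S t) < \<infinity>" for t
  proof -
    have "emeasure M (S t) \<le> emeasure M {x \<in> space M. h x \<le> t}"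
      unfolding S_eq by (intro emeasure_mono) auto
    also have "\<dots> \<le> ennreal (t + 1)" by (rule emeasure_h_le)
    finally show ?thesis by (rule le_less_trans) simp
  qed
  define F where "F t = measure M (S t)" for t
  have F: "emeasure M (S t) = ennreal (F t)" for t
    using finS[of t] by (simp add: F_def emeasure_eq_ennreal_measure)
  have F0: "0 \<le> F t" for t by (simp add: F_def)
  have Fm: "F s \<le> F t" if "s \<le> t" for s t
  proof -
    have "emeasure M (S s) \<le> emeasure M (S t)" using that by (intro emeasure_mono) (auto simp: S_def)
    then show ?thesis by (simp add: F F0)
  qed
  have FL: "F t \<le> F s + (t - s)" if "s \<le> t" for s t
  proof -
    have "emeasure M (S t) \<le> emeasure M (S s \<union> {x \<in> space M. s < h x \<and> h x \<le> t})"
      using that by (intro emeasure_mono) (auto simp: S_eq)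
    also have "\<dots> \<le> emeasure M (S s) + emeasure M {x \<in> space M. s < h x \<and> h x \<le> t}"
      by (intro emeasure_subadditive) auto
    also have "\<dots> \<le> ennreal (F s) + ennreal (t - s)"
      using h_Lipschitz[OF that] F by (intro add_mono) auto
    finally show ?thesis using that F0 by (simp add: F flip: ennreal_plus)
  qed
  have F_neg: "F t = 0" if "t < 0" for t
  proof -
    have "S t = {}" using that h_nonneg by (fastforce simp: S_eq)
    then show ?thesis by (simp add: F_def)
  qed
  have F_meas: "F \<in> borel_measurable borel"
    by (rule borel_measurable_mono) (auto simp: mono_def Fm)
  show "(\<lambda>x. F (h x)) \<in> borel_measurable M"
    using F_meas by measurable
  fix s :: real assume s: "0 \<le> s" "ennreal s \<le> emeasure M A"
  have inc: "(\<lambda>n::nat. emeasure M (S n)) \<longlonglongrightarrow> emeasure M (\<Union>n::nat. S n)"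
    by (rule Lim_emeasure_incseq) (auto simp: incseq_def S_def)
  have "(\<Union>n::nat. S n) = A" by (auto simp: S_def intro: real_arch_simple)
  with inc have inc: "(\<lambda>n::nat. ennreal (F n)) \<longlonglongrightarrow> emeasure M A" by (simp add: F)
  show "emeasure M {x \<in> A. F (h x) \<le> s} = ennreal s"
  \<comment> \<open>If \<open>s\<close> is the full mass, \<open>F\<close> may fail to attain it but
    never exceeds it, so the set is all of \<open>A\<close>. Otherwise a height \<open>u\<close>
    with \<open>F u = s\<close> is found.\<close>
  proof (cases "ennreal s = emeasure M A")
    case True
    have "F t \<le> s" for t
    proof -
      have "emeasure M (S t) \<le> emeasure M A" by (intro emeasure_mono) (auto simp: S_def)
      then have "ennreal (F t) \<le> ennreal s" by (simp only: F True)
      then show ?thesis using s(1) by simp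
    qed
    then have "{x \<in> A. F (h x) \<le> s} = A" by auto
    then show ?thesis using True by simp
  next
    case False
    then have "ennreal s < emeasure M A" using s(2) by simp
    then have "eventually (\<lambda>n. ennreal s < ennreal (F (real n))) sequentially"
      by (rule order_tendstoD(1)[OF inc])
    then obtain n where n: "s < F (real n)"
      using s(1) by (auto simp: eventually_sequentially ennreal_less_iff)
    define T where "T = {t. F t \<le> s}"
    have bdd: "bdd_above T"
    proof (rule bdd_aboveI[of _ "real n"])
      fix t assume "t \<in> T"
      then show "t \<le> real n" using Fm[of "real n" t] n by (force simp: T_def)
    qed
    have ne: "-1 \<in> T" using F_neg s by (simp add: T_def)
    define u where "u = Sup T"
    have tu: "t \<in> T \<Longrightarrow> t \<le> u" for t unfolding u_def by (intro cSup_upper bdd)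
    have "F u \<le> s"
    proof (rule field_le_epsilon)
      fix e :: real assume "0 < e"
      then have "u - e < Sup T" by (simp add: u_def)
      then obtain t where "t \<in> T" "u - e < t" using less_cSupE[of "u - e" T] ne by blast
      then show "F u \<le> s + e" using FL[of t u] tu[of t] by (simp add: T_def)
    qed
    moreover have "s \<le> F u"
    proof (rule ccontr)
      assume "\<not> s \<le> F u"
      \<comment> \<open>By the Lipschitz bound, a step to the right by the missing amount
        \<open>s - F u\<close> stays in \<open>T\<close> although it goes beyond the
        supremum.\<close>
      then have "F (u + (s - F u)) \<le> s" using FL[of u "u + (s - F u)"] by simp
      then have "u + (s - F u) \<le> u" by (intro tu) (simp add: T_def)
      then show False using \<open>\<not> s \<le> F u\<close> by simp
    qed
    ultimately have Fu: "F u = s" by simp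
    have "F (h x) \<le> s \<longleftrightarrow> h x \<le> u" for x
      using tu[of "h x"] Fm[of "h x" u] Fu by (auto simp: T_def)
    then have "{x \<in> A. F (h x) \<le> s} = S u" by (simp add: S_def)
    then show ?thesis by (simp add: F Fu)
  qed
qed

text \<open>The partial sums \<open>s j\<close> serve as levels of \<open>V\<close>: the part of
  \<open>A\<close> between levels \<open>s j\<close> and \<open>s (Suc j)\<close> has measure
  \<open>a j\<close>. Infinite mass of \<open>A\<close> is allowed because each partial sum is
  finite.\<close>

lemma split_set:
  fixes a :: "nat \<Rightarrow> real"
  assumes A[measurable]: "A \<in> sets M" and a0: "\<And>j. 0 \<le> a j"
    and sum: "(\<Sum>j. ennreal (a j)) = emeasure M A"
  obtains g :: "'a \<Rightarrow> nat" where "g \<in> measurable M (count_space UNIV)"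
    "\<And>j. emeasure M {x \<in> A. g x = j} = ennreal (a j)"
proof -
  obtain V where V[measurable]: "V \<in> borel_measurable M"
    and level: "\<And>s. 0 \<le> s \<Longrightarrow> ennreal s \<le> emeasure M A \<Longrightarrow> emeasure M {x \<in> A. V x \<le> s} = ennreal s"
    using exists_level[OF A] by blast
  define s where "s j = (\<Sum>i<j. a i)" for j
  have s0: "0 \<le> s j" for j using a0 by (simp add: s_def sum_nonneg)
  have sSuc: "s (Suc j) = s j + a j" for j by (simp add: s_def)
  have smono: "i \<le> j \<Longrightarrow> s i \<le> s j" for i j
    using lift_Suc_mono_le[of s i j] sSuc a0 by simp
  have slim: "(\<lambda>j. ennreal (s j)) \<longlonglongrightarrow> emeasure M A"
    using summable_LIMSEQ[of "\<lambda>j. ennreal (a j)"] sum a0 by (simp add: s_def)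
  have sA: "ennreal (s j) \<le> emeasure M A" for j
  proof -
    have "(\<Sum>i<j. ennreal (a i)) \<le> (\<Sum>j. ennreal (a j))" by (rule sum_le_suminf) auto
    then show ?thesis using sum a0 by (simp add: s_def)
  qed
  define L where "L t = {x \<in> A. V x \<le> t}" for t
  have L_eq: "L t = {x \<in> space M. x \<in> A \<and> V x \<le> t}" for t
    using sets.sets_into_space[OF A] by (auto simp: L_def)
  have L[measurable]: "L t \<in> sets M" for t unfolding L_eq by measurable
  have eL: "emeasure M (L (s j)) = ennreal (s j)" for j
    unfolding L_def by (rule level[OF s0 sA])
  define D where "D j = L (s (Suc j)) - L (s j)" for j
  have D[measurable]: "D j \<in> sets M" for j by (simp add: D_def)
  have eD: "emeasure M (D j) = ennreal (a j)" for j
  proof -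
    have "emeasure M (D j) = emeasure M (L (s (Suc j))) - emeasure M (L (s j))"
      unfolding D_def using smono[of j "Suc j"] by (intro emeasure_Diff) (auto simp: eL, auto simp: L_def)
    also have "\<dots> = ennreal (s j + a j) - ennreal (s j)" by (simp only: eL flip: sSuc)
    also have "\<dots> = ennreal (a j)" using s0 a0 by (simp add: ennreal_minus)
    finally show ?thesis .
  qed
  \<comment> \<open>Where no \<open>j\<close> fits, \<open>LEAST\<close> returns an unspecified
    label; within \<open>A\<close> this happens only on \<open>R\<close>, which is shown to be
    null.\<close>
  define g where "g x = (LEAST j. s j < V x \<and> V x \<le> s (Suc j))" for x
  have g: "g \<in> measurable M (count_space UNIV)" unfolding g_def by measurable
  have gD: "g x = j" if "x \<in> D j" for x j
    unfolding g_def
  proof (rule Least_equality)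
    show "s j < V x \<and> V x \<le> s (Suc j)" using that by (auto simp: D_def L_def)
    fix i assume "s i < V x \<and> V x \<le> s (Suc i)"
    then have "\<not> s (Suc i) \<le> s j" using \<open>s j < V x \<and> V x \<le> s (Suc j)\<close> by linarith
    then have "\<not> Suc i \<le> j" using smono by blast
    then show "j \<le> i" by simp
  qed
  define R where "R = A - (\<Union>j. D j)"
  have R[measurable]: "R \<in> sets M" by (simp add: R_def)
  have LD: "L (s j) \<subseteq> L 0 \<union> (\<Union>j. D j)" for j
  proof (induction j)
    case 0 then show ?case by (simp add: s_def)
  next
    case (Suc j) then show ?case by (auto simp: D_def)
  qed
  \<comment> \<open>Points of \<open>R\<close> below some level satisfy
    \<open>V x \<le> s 0 = 0\<close>, and these have measure 0. Points above all levels are left to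
    \<open>R2\<close>: there are none if the levels tend to infinity, and they form a null set if
    the levels exhaust a finite mass.\<close>
  have R1: "R \<inter> (\<Union>j. L (s j)) \<in> null_sets M"
  proof -
    have "emeasure M (L 0) = 0" using eL[of 0] by (simp add: s_def)
    then have n: "L 0 \<in> null_sets M" by (intro null_setsI L)
    have m: "R \<inter> (\<Union>j. L (s j)) \<in> sets M" by (intro sets.Int sets.countable_UN image_subsetI R L)
    have "R \<inter> (\<Union>j. L (s j)) \<subseteq> L 0" using LD by (auto simp: R_def)
    then show ?thesis by (rule null_sets_subset[OF n m])
  qed
  have R2: "A - (\<Union>j. L (s j)) \<in> null_sets M"
  proof (cases "emeasure M A = \<infinity>")
    case True
    have "x \<in> (\<Union>j. L (s j))" if "x \<in> A" for x
    proof -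
      have "eventually (\<lambda>j. ennreal (V x) < ennreal (s j)) sequentially"
        by (rule order_tendstoD(1)[OF slim]) (simp add: True)
      then obtain j where "ennreal (V x) < ennreal (s j)" by (auto simp: eventually_sequentially)
      then have "\<not> s j \<le> V x" using ennreal_leI[of "s j" "V x"] by (auto simp: not_less[symmetric])
      then have "V x \<le> s j" by simp
      then show ?thesis using that by (auto simp: L_def)
    qed
    then have "A - (\<Union>j. L (s j)) = {}" by blast
    then show ?thesis by (simp only: null_sets.empty_sets)
  next
    case False
    have "(\<lambda>j. emeasure M (L (s j))) \<longlonglongrightarrow> emeasure M (\<Union>j. L (s j))"
    proof (rule Lim_emeasure_incseq)
      show "incseq (\<lambda>j. L (s j))" unfolding incseq_def L_def using smono by force
    qed auto
    then have "(\<lambda>j. ennreal (s j)) \<longlonglongrightarrow> emeasure M (\<Union>j. L (s j))" by (simp only: eL)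
    then have eq: "emeasure M (\<Union>j. L (s j)) = emeasure M A" using slim LIMSEQ_unique by blast
    have "emeasure M (A - (\<Union>j. L (s j))) = emeasure M A - emeasure M (\<Union>j. L (s j))"
      using False eq by (intro emeasure_Diff) (auto simp: L_def)
    also have "\<dots> = 0" unfolding eq using False by simp
    finally show ?thesis
      by (rule null_setsI) (intro sets.Diff A sets.countable_UN image_subsetI L)
  qed
  have Rn: "R \<in> null_sets M"
    by (rule null_sets_subset[OF null_sets.Un[OF R1 R2] R]) (auto simp: R_def)
  have "emeasure M {x \<in> A. g x = j} = ennreal (a j)" for j
  proof -
    have sub: "D j \<subseteq> {x \<in> A. g x = j}" "{x \<in> A. g x = j} \<subseteq> D j \<union> R"
      using gD by (auto simp: D_def L_def R_def)
    have "{x \<in> A. g x = j} = {x \<in> space M. x \<in> A \<and> g x = j}" using sets.sets_into_space[OF A] by auto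
    then have m: "{x \<in> A. g x = j} \<in> sets M" using g by simp
    have "emeasure M {x \<in> A. g x = j} \<le> emeasure M (D j \<union> R)" by (intro emeasure_mono sub) simp
    also have "\<dots> = emeasure M (D j)" by (rule emeasure_Un_null_set[OF D Rn])
    finally show ?thesis using emeasure_mono[OF sub(1) m] by (simp add: eD)
  qed
  with g show thesis by (rule that)
qed

end

section \<open>The extended space\<close>

text \<open>Preimages under the two injections commute with unions and complements, so in this form
  the family inherits the closure properties of \<open>M\<close> and \<open>borel\<close>. It
  follows that generating a sigma-algebra in \<open>ext_space\<close> adds no new sets.\<close>

lemma sets_ext_space_aux:
  "{Inl ` A \<union> Inr ` B | A B. A \<in> sets M \<and> B \<in> sets borel}
    = {C. C \<subseteq> Inl ` space M \<union> range Inr \<and> Inl -` C \<in> sets M \<and> Inr -` C \<in> sets (borel :: real measure)}"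
  (is "?L = ?R")
proof
  show "?L \<subseteq> ?R"
  proof
    fix C assume "C \<in> ?L"
    then obtain A B where AB: "C = Inl ` A \<union> Inr ` B" "A \<in> sets M" "B \<in> sets borel" by blast
    then have "Inl -` C = A" "Inr -` C = B" by auto
    then show "C \<in> ?R" using AB sets.sets_into_space[of A M] by auto
  qed
  show "?R \<subseteq> ?L"
  proof
    fix C :: "('a + real) set" assume C: "C \<in> ?R"
    have "C = Inl ` (Inl -` C) \<union> Inr ` (Inr -` C)"
    proof (intro set_eqI)
      fix x show "x \<in> C \<longleftrightarrow> x \<in> Inl ` (Inl -` C) \<union> Inr ` (Inr -` C)" by (cases x) auto
    qed
    then show "C \<in> ?L" using C by blast
  qed
qed

lemma sigma_algebra_ext_space:
  "sigma_algebra (Inl ` space M \<union> range Inr)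
    {C. C \<subseteq> Inl ` space M \<union> range Inr \<and> Inl -` C \<in> sets M \<and> Inr -` C \<in> sets (borel :: real measure)}"
  (is "sigma_algebra ?S ?C")
  unfolding sigma_algebra_iff2
proof (intro conjI ballI allI impI)
  show "{} \<in> ?C" by simp
  fix C assume C: "C \<in> ?C"
  have "Inl -` (?S - C) = space M - Inl -` C" "Inr -` (?S - C) = UNIV - Inr -` C" by auto
  then show "?S - C \<in> ?C" using C by (auto simp: Compl_eq_Diff_UNIV[symmetric])
next
  fix A :: "nat \<Rightarrow> ('a + real) set" assume A: "range A \<subseteq> ?C"
  have "Inl -` (\<Union>i. A i) \<in> sets M" "Inr -` (\<Union>i. A i) \<in> sets borel"
    unfolding vimage_UN using A by (auto intro!: sets.countable_UN)
  then show "(\<Union>i. A i) \<in> ?C" using A by blast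
qed auto

lemma space_ext_space: "space (ext_space M) = Inl ` space M \<union> range Inr"
  unfolding ext_space_def by (rule space_measure_of) (auto dest: sets.sets_into_space)

lemma sets_ext_space:
  "sets (ext_space M) = {C. C \<subseteq> Inl ` space M \<union> range Inr \<and> Inl -` C \<in> sets M \<and> Inr -` C \<in> sets borel}"
  unfolding ext_space_def sets_ext_space_aux
  by (rule sigma_algebra.sets_measure_of_eq[OF sigma_algebra_ext_space])

lemma emeasure_ext_space:
  assumes C: "C \<in> sets (ext_space M)"
  shows "emeasure (ext_space M) C = emeasure M (Inl -` C) + emeasure lborel (Inr -` C)"
  unfolding ext_space_def sets_ext_space_aux
proof (rule emeasure_measure_of_sigma[OF sigma_algebra_ext_space,
      where \<mu> = "\<lambda>C. emeasure M (Inl -` C) + emeasure lborel (Inr -` C)"])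
  show "countably_additive {C. C \<subseteq> Inl ` space M \<union> range Inr \<and> Inl -` C \<in> sets M \<and> Inr -` C \<in> sets (borel :: real measure)}
     (\<lambda>C. emeasure M (Inl -` C) + emeasure lborel (Inr -` C))"
  proof (rule countably_additiveI)
    fix A :: "nat \<Rightarrow> ('a + real) set"
    assume A: "range A \<subseteq> {C. C \<subseteq> Inl ` space M \<union> range Inr \<and> Inl -` C \<in> sets M \<and> Inr -` C \<in> sets (borel :: real measure)}"
      and disj: "disjoint_family A"
    have d: "disjoint_family (\<lambda>i. Inl -` A i)" "disjoint_family (\<lambda>i. Inr -` A i)"
      using disj by (auto simp: disjoint_family_on_def)
    have "(\<Sum>i. emeasure M (Inl -` A i) + emeasure lborel (Inr -` A i))
      = (\<Sum>i. emeasure M (Inl -` A i)) + (\<Sum>i. emeasure lborel (Inr -` A i))"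
      by (intro suminf_add[symmetric] summableI)
    also have "(\<Sum>i. emeasure M (Inl -` A i)) = emeasure M (\<Union>i. Inl -` A i)"
      using A d by (intro suminf_emeasure) auto
    also have "(\<Sum>i. emeasure lborel (Inr -` A i)) = emeasure lborel (\<Union>i. Inr -` A i)"
      using A d by (intro suminf_emeasure) auto
    finally show "(\<Sum>i. emeasure M (Inl -` A i) + emeasure lborel (Inr -` A i))
      = emeasure M (Inl -` (\<Union>i. A i)) + emeasure lborel (Inr -` (\<Union>i. A i))"
      by (simp only: vimage_UN)
  qed
next
  show "C \<in> {C. C \<subseteq> Inl ` space M \<union> range Inr \<and> Inl -` C \<in> sets M \<and> Inr -` C \<in> sets (borel :: real measure)}"
    using C by (simp only: sets_ext_space)
qed (simp add: positive_def)

section \<open>Measurable maps and integrals on the extended space\<close>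

lemma measurable_Inl_ext_space [measurable]: "Inl \<in> measurable M (ext_space M)"
  by (rule measurableI)
     (auto simp: space_ext_space sets_ext_space dest: sets.Int_space_eq2 intro: sets.Int)

lemma measurable_Inr_ext_space [measurable]: "Inr \<in> measurable borel (ext_space M)"
  by (rule measurableI) (auto simp: space_ext_space sets_ext_space)

lemma measurable_ext_spaceI:
  assumes "(\<lambda>x. f (Inl x)) \<in> measurable M N" "(\<lambda>t. f (Inr t)) \<in> measurable borel N"
  shows "f \<in> measurable (ext_space M) N"
proof (rule measurableI)
  fix s assume "s \<in> space (ext_space M)"
  then show "f s \<in> space N"
    using measurable_space[OF assms(1)] measurable_space[OF assms(2)] by (auto simp: space_ext_space)
next
  fix B assume "B \<in> sets N"
  moreover have "Inl -` (f -` B \<inter> space (ext_space M)) = (\<lambda>x. f (Inl x)) -` B \<inter> space M"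
    "Inr -` (f -` B \<inter> space (ext_space M)) = (\<lambda>x. f (Inr x)) -` B \<inter> space borel"
    by (auto simp: space_ext_space)
  ultimately show "f -` B \<inter> space (ext_space M) \<in> sets (ext_space M)"
    using measurable_sets[OF assms(1)] measurable_sets[OF assms(2)]
    by (auto simp: sets_ext_space space_ext_space)
qed

lemma nn_integral_ext_space:
  assumes "f \<in> borel_measurable (ext_space M)"
  shows "(\<integral>\<^sup>+ s. f s \<partial>ext_space M) = (\<integral>\<^sup>+ x. f (Inl x) \<partial>M) + (\<integral>\<^sup>+ t. f (Inr t) \<partial>lborel)"
  using assms
proof induction
  case (cong f g)
  have "(\<integral>\<^sup>+ s. f s \<partial>ext_space M) = (\<integral>\<^sup>+ s. g s \<partial>ext_space M)"
    using cong(3) by (intro nn_integral_cong) auto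
  moreover have "(\<integral>\<^sup>+ x. f (Inl x) \<partial>M) = (\<integral>\<^sup>+ x. g (Inl x) \<partial>M)"
    using cong(3) by (intro nn_integral_cong) (auto simp: space_ext_space)
  moreover have "(\<integral>\<^sup>+ t. f (Inr t) \<partial>lborel) = (\<integral>\<^sup>+ t. g (Inr t) \<partial>lborel)"
    using cong(3) by (intro nn_integral_cong) (auto simp: space_ext_space)
  ultimately show ?case using cong by simp
next
  case (set A)
  have [measurable]: "Inl -` A \<in> sets M" "Inr -` A \<in> sets borel"
    using set by (auto simp: sets_ext_space)
  have "(\<integral>\<^sup>+ x. indicator A (Inl x) \<partial>M) = (\<integral>\<^sup>+ x. indicator (Inl -` A) x \<partial>M)"
    "(\<integral>\<^sup>+ x. indicator A (Inr x) \<partial>lborel) = (\<integral>\<^sup>+ x. indicator (Inr -` A) x \<partial>lborel)"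
    by (simp_all add: indicator_def)
  then show ?case using set by (simp add: emeasure_ext_space)
next
  case (mult u c)
  have [measurable]: "(\<lambda>x. u (Inl x)) \<in> borel_measurable M" "(\<lambda>x. u (Inr x)) \<in> borel_measurable borel"
    using mult(2) by measurable
  show ?case using mult by (simp add: nn_integral_cmult distrib_left)
next
  case (add u v)
  have [measurable]: "(\<lambda>x. u (Inl x)) \<in> borel_measurable M" "(\<lambda>x. u (Inr x)) \<in> borel_measurable borel"
    "(\<lambda>x. v (Inl x)) \<in> borel_measurable M" "(\<lambda>x. v (Inr x)) \<in> borel_measurable borel"
    using add.hyps by measurable
  show ?case using add by (simp add: nn_integral_add ac_simps)
next
  case (seq U)
  have [measurable]: "(\<lambda>x. U i (Inl x)) \<in> borel_measurable M" "(\<lambda>x. U i (Inr x)) \<in> borel_measurable borel" for i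
    using seq(1)[of i] by measurable
  have inc: "incseq (\<lambda>i x. U i (Inl x))" "incseq (\<lambda>i x. U i (Inr x))"
    using seq(3) by (auto simp: incseq_def le_fun_def)
  have inc': "incseq (\<lambda>i. \<integral>\<^sup>+ x. U i (Inl x) \<partial>M)" "incseq (\<lambda>i. \<integral>\<^sup>+ x. U i (Inr x) \<partial>lborel)"
    using inc by (auto simp: incseq_def le_fun_def intro!: nn_integral_mono)
  have "(\<integral>\<^sup>+ s. (SUP i. U i s) \<partial>ext_space M) = (SUP i. (\<integral>\<^sup>+ x. U i (Inl x) \<partial>M) + (\<integral>\<^sup>+ x. U i (Inr x) \<partial>lborel))"
    using seq by (subst nn_integral_monotone_convergence_SUP) auto
  also have "\<dots> = (SUP i. \<integral>\<^sup>+ x. U i (Inl x) \<partial>M) + (SUP i. \<integral>\<^sup>+ x. U i (Inr x) \<partial>lborel)"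
    by (rule ennreal_SUP_add[OF inc'])
  also have "\<dots> = (\<integral>\<^sup>+ x. (SUP i. U i (Inl x)) \<partial>M) + (\<integral>\<^sup>+ x. (SUP i. U i (Inr x)) \<partial>lborel)"
    using inc by (subst (1 2) nn_integral_monotone_convergence_SUP) auto
  finally show ?case by (simp add: image_comp SUP_apply)
qed

lemma sigma_finite_ext_space:
  assumes "sigma_finite_measure M"
  shows "sigma_finite_measure (ext_space M)"
proof -
  interpret sigma_finite_measure M by fact
  obtain A where A: "countable A" "A \<subseteq> sets M" "\<Union>A = space M" "\<forall>a\<in>A. emeasure M a \<noteq> \<infinity>"
    using sigma_finite_countable by blast
  let ?B = "(\<lambda>a. Inl ` a) ` A \<union> range (\<lambda>n::nat. Inr ` {- real n .. real n})"
  have v: "Inl -` Inl ` a = a" "Inr -` Inl ` a = {}" "Inr -` Inr ` b = b" "Inl -` Inr ` b = {}" for a :: "'a set" and b :: "real set"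
    by auto
  have i: "Inl ` a \<in> sets (ext_space M)" if "a \<in> A" for a
    using that A sets.sets_into_space[of a M] by (auto simp: sets_ext_space v)
  have j: "Inr ` b \<in> sets (ext_space M)" if "b \<in> sets borel" for b
    using that by (auto simp: sets_ext_space v)
  have "\<exists>n::nat. - real n \<le> t \<and> t \<le> real n" for t
  proof -
    obtain n :: nat where "\<bar>t\<bar> \<le> real n" using real_arch_simple by blast
    then show ?thesis by (intro exI[of _ n]) auto
  qed
  then have U2: "(\<Union>n::nat. Inr ` {- real n .. real n}) = range Inr" by fastforce
  have U1: "\<Union>((\<lambda>a. Inl ` a) ` A) = Inl ` \<Union>A" by blast
  have "\<Union>?B = Inl ` \<Union>A \<union> range Inr" by (simp only: Union_Un_distrib U1 U2)
  then have "\<Union>?B = space (ext_space M)" by (simp only: A(3) space_ext_space)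
  moreover have "emeasure (ext_space M) b \<noteq> \<infinity>" if "b \<in> ?B" for b
    using that A(4) i j by (auto simp: emeasure_ext_space v)
  moreover have "?B \<subseteq> sets (ext_space M)" using i j by auto
  moreover have "countable ?B" using A(1) by auto
  ultimately show ?thesis by (intro sigma_finite_measure.intro exI[of _ ?B] conjI ballI)
qed

text \<open>What makes extension by zero harmless: errors computed on the extended space are errors
  on \<open>M\<close>.\<close>

lemma nn_integral_ext_space_pair:
  assumes "sigma_finite_measure M" and f[measurable]: "f \<in> borel_measurable (ext_space M \<Otimes>\<^sub>M ext_space M)"
    and "\<And>s t. f (Inr t, s) = 0" "\<And>s t. f (s, Inr t) = 0"
  shows "(\<integral>\<^sup>+ z. f z \<partial>(ext_space M \<Otimes>\<^sub>M ext_space M)) = (\<integral>\<^sup>+ z. f (Inl (fst z), Inl (snd z)) \<partial>(M \<Otimes>\<^sub>M M))"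
proof -
  interpret sigma_finite_measure M by fact
  interpret E: sigma_finite_measure "ext_space M" by (rule sigma_finite_ext_space) fact
  have "(\<integral>\<^sup>+ z. f z \<partial>(ext_space M \<Otimes>\<^sub>M ext_space M)) = (\<integral>\<^sup>+ s. \<integral>\<^sup>+ t. f (s, t) \<partial>ext_space M \<partial>ext_space M)"
    by (rule E.nn_integral_fst[symmetric]) measurable
  also have "\<dots> = (\<integral>\<^sup>+ x. \<integral>\<^sup>+ t. f (Inl x, t) \<partial>ext_space M \<partial>M)"
    using assms by (subst nn_integral_ext_space) auto
  also have "\<dots> = (\<integral>\<^sup>+ x. \<integral>\<^sup>+ y. f (Inl x, Inl y) \<partial>M \<partial>M)"
  proof (intro nn_integral_cong)
    fix x assume "x \<in> space M"
    then have "Inl x \<in> space (ext_space M)" by (simp add: space_ext_space)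
    then have "(\<lambda>t. f (Inl x, t)) \<in> borel_measurable (ext_space M)" by measurable
    then show "(\<integral>\<^sup>+ t. f (Inl x, t) \<partial>ext_space M) = (\<integral>\<^sup>+ y. f (Inl x, Inl y) \<partial>M)"
      using assms(4) by (subst nn_integral_ext_space) auto
  qed
  also have "\<dots> = (\<integral>\<^sup>+ z. f (Inl (fst z), Inl (snd z)) \<partial>(M \<Otimes>\<^sub>M M))"
    by (subst nn_integral_fst[symmetric]) auto
  finally show ?thesis .
qed

lemma ext_fun_Inr [simp]: "ext_fun W (Inr t) s = 0" "ext_fun W s (Inr t) = 0"
  by (cases s; simp)+

lemma borel_measurable_ext_fun:
  assumes W: "(\<lambda>z. W (fst z) (snd z)) \<in> borel_measurable (M \<Otimes>\<^sub>M M)"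
  shows "(\<lambda>z. ext_fun W (fst z) (snd z)) \<in> borel_measurable (ext_space M \<Otimes>\<^sub>M ext_space M)"
proof (cases "space M = {}")
  case True
  have "(\<lambda>z. 0 :: real) \<in> borel_measurable (ext_space M \<Otimes>\<^sub>M ext_space M)" by simp
  then show ?thesis
    by (rule measurable_cong[THEN iffD1, rotated])
       (auto simp: space_pair_measure space_ext_space True)
next
  case False
  then obtain x0 where x0: "x0 \<in> space M" by blast
  \<comment> \<open>A retraction onto \<open>M\<close> makes \<open>W\<close> applicable to extended
    points; the line goes to the arbitrary point \<open>x0\<close>, and \<open>b\<close> masks the
    values obtained there. An empty \<open>M\<close> has no such point and was split off.\<close>
  define r where "r s = (case s of Inl x \<Rightarrow> x | Inr t \<Rightarrow> x0)" for s :: "'a + real"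
  have r[measurable]: "r \<in> measurable (ext_space M) M"
    by (rule measurable_ext_spaceI) (auto simp: r_def x0)
  define b where "b s = (case s of Inl x \<Rightarrow> True | Inr t \<Rightarrow> False)" for s :: "'a + real"
  have b[measurable]: "b \<in> measurable (ext_space M) (count_space UNIV)"
    by (rule measurable_ext_spaceI) (auto simp: b_def)
  have "(\<lambda>z. W (fst (r (fst z), r (snd z))) (snd (r (fst z), r (snd z)))) \<in> borel_measurable (ext_space M \<Otimes>\<^sub>M ext_space M)"
    by (rule measurable_compose[OF _ W]) measurable
  then have [measurable]: "(\<lambda>z. W (r (fst z)) (r (snd z))) \<in> borel_measurable (ext_space M \<Otimes>\<^sub>M ext_space M)"
    by simp
  have "(\<lambda>z. if b (fst z) \<and> b (snd z) then W (r (fst z)) (r (snd z)) else 0) \<in> borel_measurable (ext_space M \<Otimes>\<^sub>M ext_space M)"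
    by measurable
  moreover have "(if b s \<and> b t then W (r s) (r t) else 0) = ext_fun W s t" for s t
    by (cases s; cases t) (auto simp: b_def r_def)
  ultimately show ?thesis by simp
qed

section \<open>Transport and coupling of step functions\<close>

abbreviation law :: "'a measure \<Rightarrow> ('a \<Rightarrow> 'i) \<Rightarrow> 'i measure" where
  "law M c \<equiv> distr M (count_space UNIV) c"

lemma emeasure_law_singleton:
  assumes "c \<in> measurable M (count_space UNIV)"
  shows "emeasure (law M c) {i} = emeasure M (c -` {i} \<inter> space M)"
  by (rule emeasure_distr[OF assms]) simp

lemma law_eqI:
  fixes c :: "'a \<Rightarrow> 'i :: countable"
  assumes "c \<in> measurable M (count_space UNIV)" "d \<in> measurable N (count_space UNIV)"
    "\<And>i. emeasure M (c -` {i} \<inter> space M) = emeasure N (d -` {i} \<inter> space N)"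
  shows "law M c = law N d"
  by (rule measure_eqI_countable[of _ UNIV])
     (simp_all add: emeasure_law_singleton[OF assms(1)] emeasure_law_singleton[OF assms(2)] assms(3))

lemma sigma_finite_law:
  fixes c :: "'a \<Rightarrow> 'i :: countable"
  assumes "c \<in> measurable M (count_space UNIV)"
    "\<And>i. emeasure M (c -` {i} \<inter> space M) < \<infinity>"
  shows "sigma_finite_measure (law M c)"
proof (rule sigma_finite_measure.intro, intro exI[of _ "range (\<lambda>i. {i})"] conjI ballI)
  fix a assume "a \<in> range (\<lambda>i::'i. {i})"
  then obtain i where "a = {i}" by blast
  then show "emeasure (law M c) a \<noteq> \<infinity>"
    using assms(2)[of i] by (simp add: emeasure_law_singleton[OF assms(1)])
qed auto

lemma Lp_int_distr_pair:
  assumes f[measurable]: "f \<in> measurable N E" and "sigma_finite_measure (distr N E f)"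
    and F[measurable]: "F \<in> borel_measurable (E \<Otimes>\<^sub>M E)"
  shows "Lp_int p (N \<Otimes>\<^sub>M N) (\<lambda>z. F (f (fst z), f (snd z))) = Lp_int p (distr N E f \<Otimes>\<^sub>M distr N E f) F"
  unfolding Lp_int_def pair_measure_distr[OF f f assms(2)]
  by (subst nn_integral_distr) (auto simp: case_prod_beta)

text \<open>Both sides are the integral of \<open>H\<close> over the square of the common law.
  Finite cells make that law sigma-finite, so the product of push-forwards is the push-forward of
  the product.\<close>

lemma Lp_int_same_law:
  fixes c :: "'a \<Rightarrow> 'i :: countable"
  assumes c: "c \<in> measurable M (count_space UNIV)" and d: "d \<in> measurable N (count_space UNIV)"
    and law: "law M c = law N d" and fin: "\<And>i. emeasure M (c -` {i} \<inter> space M) < \<infinity>"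
  shows "Lp_int p (M \<Otimes>\<^sub>M M) (\<lambda>z. H (c (fst z)) (c (snd z))) = Lp_int p (N \<Otimes>\<^sub>M N) (\<lambda>z. H (d (fst z)) (d (snd z)))"
proof -
  have sf: "sigma_finite_measure (law M c)" by (rule sigma_finite_law[OF c fin])
  have H: "(\<lambda>z. H (fst z) (snd z)) \<in> borel_measurable (count_space (UNIV :: 'i set) \<Otimes>\<^sub>M count_space UNIV)"
    by (simp add: pair_measure_countable)
  show ?thesis
    using Lp_int_distr_pair[OF c sf H, of p] Lp_int_distr_pair[OF d _ H, of p] sf law by simp
qed

lemma couplingsD:
  assumes "\<nu> \<in> couplings M1 M2"
  shows "sigma_finite_measure \<nu>" "fst \<in> measurable \<nu> M1" "snd \<in> measurable \<nu> M2"
    "distr \<nu> M1 fst = M1" "distr \<nu> M2 snd = M2"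
proof -
  have s: "sets \<nu> = sets (M1 \<Otimes>\<^sub>M M2)" using assms by (simp add: couplings_def)
  show "fst \<in> measurable \<nu> M1" "snd \<in> measurable \<nu> M2"
    by (simp_all add: measurable_cong_sets[OF s refl])
qed (use assms in \<open>auto simp: couplings_def\<close>)

section \<open>Realising label laws and couplings on a height measure\<close>

context height_measure
begin

text \<open>Provides the first labelling of the chain. The total masses must agree; for the laws
  arising from extended spaces both are infinite.\<close>

lemma exists_law:
  fixes m :: "nat \<Rightarrow> ennreal"
  assumes fin: "\<And>i. m i < \<infinity>" and total: "(\<Sum>i. m i) = emeasure M (space M)"
  obtains f :: "'a \<Rightarrow> nat" where "f \<in> measurable M (count_space UNIV)"
    "\<And>i. emeasure M (f -` {i} \<inter> space M) = m i"
proof -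
  have m: "ennreal (enn2real (m i)) = m i" for i using fin[of i] by simp
  obtain f :: "'a \<Rightarrow> nat" where f: "f \<in> measurable M (count_space UNIV)"
    "\<And>i. emeasure M {x \<in> space M. f x = i} = ennreal (enn2real (m i))"
    using split_set[of "space M" "\<lambda>i. enn2real (m i)"] total by (auto simp: m)
  have "f -` {i} \<inter> space M = {x \<in> space M. f x = i}" for i by auto
  then show thesis using that[OF f(1)] f(2) m by simp
qed

text \<open>The pairs \<open>(f, g)\<close> and \<open>(c1, c2)\<close> receive the same joint law,
  stated through an arbitrary \<open>H\<close> of the four labels because what is compared later is
  a difference of two kernels, one per side. That \<open>g\<close> has the law of \<open>c2\<close>
  lets the construction be iterated.\<close>

lemma transport:
  fixes c1 :: "'b \<Rightarrow> nat" and c2 :: "'c \<Rightarrow> nat" and f :: "'a \<Rightarrow> nat"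
  assumes \<nu>: "\<nu> \<in> couplings M1 M2"
    and c1[measurable]: "c1 \<in> measurable M1 (count_space UNIV)"
    and c2[measurable]: "c2 \<in> measurable M2 (count_space UNIV)"
    and fin: "\<And>i. emeasure M1 (c1 -` {i} \<inter> space M1) < \<infinity>"
    and f[measurable]: "f \<in> measurable M (count_space UNIV)" and law: "law M f = law M1 c1"
  obtains g :: "'a \<Rightarrow> nat" where "g \<in> measurable M (count_space UNIV)" "law M g = law M2 c2"
    "\<And>H p. Lp_int p (M \<Otimes>\<^sub>M M) (\<lambda>z. H (f (fst z)) (f (snd z)) (g (fst z)) (g (snd z)))
      = Lp_int p (\<nu> \<Otimes>\<^sub>M \<nu>) (\<lambda>z. H (c1 (fst (fst z))) (c1 (fst (snd z))) (c2 (snd (fst z))) (c2 (snd (snd z))))"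
proof -
  note [measurable] = couplingsD(2,3)[OF \<nu>]
  define C where "C z = (c1 (fst z), c2 (snd z))" for z
  have C[measurable]: "C \<in> measurable \<nu> (count_space UNIV)"
    unfolding C_def
    by (rule measurable_step[OF measurable_compose[OF couplingsD(2)[OF \<nu>] c1]
        measurable_compose[OF couplingsD(3)[OF \<nu>] c2]]) simp
  have cell1: "emeasure \<nu> {z \<in> space \<nu>. c1 (fst z) = i} = emeasure M (f -` {i} \<inter> space M)" for i
  proof -
    have "emeasure M (f -` {i} \<inter> space M) = emeasure (law M1 c1) {i}"
      by (simp add: emeasure_law_singleton flip: law)
    also have "\<dots> = emeasure (distr \<nu> M1 fst) (c1 -` {i} \<inter> space M1)"
      by (simp add: emeasure_law_singleton couplingsD(4)[OF \<nu>])
    also have "\<dots> = emeasure \<nu> (fst -` (c1 -` {i} \<inter> space M1) \<inter> space \<nu>)"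
      by (rule emeasure_distr) auto
    also have "fst -` (c1 -` {i} \<inter> space M1) \<inter> space \<nu> = {z \<in> space \<nu>. c1 (fst z) = i}"
      using measurable_space[OF couplingsD(2)[OF \<nu>]] by auto
    finally show ?thesis ..
  qed
  have finf: "emeasure M (f -` {i} \<inter> space M) < \<infinity>" for i
    using fin[of i] emeasure_law_singleton[OF c1, of i] emeasure_law_singleton[OF f, of i] law by simp
  have Cle: "emeasure \<nu> (C -` {(i, j)} \<inter> space \<nu>) \<le> emeasure M (f -` {i} \<inter> space M)" for i j
    unfolding cell1[symmetric] by (intro emeasure_mono) (auto simp: C_def)
  have Cfin: "emeasure \<nu> (C -` {ij} \<inter> space \<nu>) < \<infinity>" for ij
    using Cle[of "fst ij" "snd ij"] finf[of "fst ij"] by (simp add: le_less_trans)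
  define a where "a i j = measure \<nu> (C -` {(i, j)} \<inter> space \<nu>)" for i j
  have a: "ennreal (a i j) = emeasure \<nu> (C -` {(i, j)} \<inter> space \<nu>)" for i j
    using Cfin[of "(i, j)"] by (simp add: a_def emeasure_eq_ennreal_measure)
  \<comment> \<open>Row \<open>i\<close> of the joint law adds up to the first marginal, which is
    the mass of the cell of \<open>f\<close> labelled \<open>i\<close>: exactly the condition for
    splitting that cell.\<close>
  have sum: "(\<Sum>j. ennreal (a i j)) = emeasure M (f -` {i} \<inter> space M)" for i
  proof -
    have "(\<Sum>j. ennreal (a i j)) = emeasure \<nu> (\<Union>j. C -` {(i, j)} \<inter> space \<nu>)"
      unfolding a by (intro suminf_emeasure) (auto simp: disjoint_family_on_def)
    also have "(\<Union>j. C -` {(i, j)} \<inter> space \<nu>) = {z \<in> space \<nu>. c1 (fst z) = i}"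
      by (auto simp: C_def)
    finally show ?thesis by (simp add: cell1)
  qed
  have "\<exists>g :: 'a \<Rightarrow> nat. g \<in> measurable M (count_space UNIV) \<and>
      (\<forall>j. emeasure M {x \<in> f -` {i} \<inter> space M. g x = j} = ennreal (a i j))" for i
  proof -
    have "f -` {i} \<inter> space M \<in> sets M" by measurable
    moreover have "0 \<le> a i j" for j by (simp add: a_def)
    ultimately obtain g :: "'a \<Rightarrow> nat" where "g \<in> measurable M (count_space UNIV)"
      "\<And>j. emeasure M {x \<in> f -` {i} \<inter> space M. g x = j} = ennreal (a i j)"
      using split_set[of "f -` {i} \<inter> space M" "a i"] sum by blast
    then show ?thesis by blast
  qed
  then obtain G :: "nat \<Rightarrow> 'a \<Rightarrow> nat" where G[measurable]: "\<And>i. G i \<in> measurable M (count_space UNIV)"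
    and Ga: "\<And>i j. emeasure M {x \<in> f -` {i} \<inter> space M. G i x = j} = ennreal (a i j)"
    by metis
  \<comment> \<open>Each cell of \<open>f\<close> has its own splitting function, and the label
    \<open>f x\<close> selects the one that applies.\<close>
  define g where "g x = G (f x) x" for x
  have g[measurable]: "g \<in> measurable M (count_space UNIV)"
    unfolding g_def by measurable
  define P where "P x = (f x, g x)" for x
  have P[measurable]: "P \<in> measurable M (count_space UNIV)"
    unfolding P_def by (rule measurable_step[OF f g]) simp
  have lawP: "law \<nu> C = law M P"
  proof (rule law_eqI[OF C P])
    fix ij :: "nat \<times> nat"
    have "P -` {ij} \<inter> space M = {x \<in> f -` {fst ij} \<inter> space M. G (fst ij) x = snd ij}"
      by (auto simp: P_def g_def)
    then show "emeasure \<nu> (C -` {ij} \<inter> space \<nu>) = emeasure M (P -` {ij} \<inter> space M)"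
      by (simp only: Ga a prod.collapse)
  qed
  have "law M g = distr (law M P) (count_space UNIV) snd"
    by (subst distr_distr) (auto simp: P_def comp_def)
  also have "\<dots> = distr (distr \<nu> M2 snd) (count_space UNIV) c2"
    unfolding lawP[symmetric] by (subst (1 2) distr_distr) (auto simp: C_def comp_def)
  also have "\<dots> = law M2 c2" by (simp add: couplingsD(5)[OF \<nu>])
  finally have law_g: "law M g = law M2 c2" .
  show thesis
  proof (rule that[OF g law_g])
    fix H :: "nat \<Rightarrow> nat \<Rightarrow> nat \<Rightarrow> nat \<Rightarrow> real" and p
    show "Lp_int p (M \<Otimes>\<^sub>M M) (\<lambda>z. H (f (fst z)) (f (snd z)) (g (fst z)) (g (snd z)))
      = Lp_int p (\<nu> \<Otimes>\<^sub>M \<nu>) (\<lambda>z. H (c1 (fst (fst z))) (c1 (fst (snd z))) (c2 (snd (fst z))) (c2 (snd (snd z))))"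
      using Lp_int_same_law[OF C P lawP Cfin, of p "\<lambda>u v. H (fst u) (fst v) (snd u) (snd v)"]
      by (simp add: P_def C_def)
  qed
qed

end

text \<open>There are countably many null cells, so their union is null. This discards the labels at
  which the density of the coupling below is infinite.\<close>

lemma AE_law_nonzero:
  fixes c :: "'a \<Rightarrow> 'i :: countable"
  assumes [measurable]: "c \<in> measurable M (count_space UNIV)"
  shows "AE x in M. emeasure M (c -` {c x} \<inter> space M) \<noteq> 0"
proof -
  have "AE x in M. emeasure M (c -` {i} \<inter> space M) = 0 \<longrightarrow> c x \<noteq> i" for i
  proof (cases "emeasure M (c -` {i} \<inter> space M) = 0")
    case True
    then have "c -` {i} \<inter> space M \<in> null_sets M" by (intro null_setsI) measurable
    then have "AE x in M. x \<notin> c -` {i} \<inter> space M" by (rule AE_not_in)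
    then show ?thesis using AE_space by eventually_elim auto
  qed simp
  then have "AE x in M. \<forall>i. emeasure M (c -` {i} \<inter> space M) = 0 \<longrightarrow> c x \<noteq> i"
    by (simp add: AE_all_countable)
  then show ?thesis by eventually_elim auto
qed

text \<open>Conditionally on the common value of \<open>c\<close> and \<open>d\<close>, the coupling is a product measure.\<close>
lemma exists_coupling_same_law:
  fixes c :: "'a \<Rightarrow> nat" and d :: "'b \<Rightarrow> nat"
  assumes "sigma_finite_measure M" "sigma_finite_measure N"
    and c[measurable]: "c \<in> measurable M (count_space UNIV)"
    and d[measurable]: "d \<in> measurable N (count_space UNIV)"
    and law: "law M c = law N d" and fin: "\<And>i. emeasure M (c -` {i} \<inter> space M) < \<infinity>"
  obtains \<nu> where "\<nu> \<in> couplings M N" "AE z in \<nu>. c (fst z) = d (snd z)"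
proof -
  interpret M: sigma_finite_measure M by fact
  interpret N: sigma_finite_measure N by fact
  interpret P: pair_sigma_finite M N ..
  define m where "m i = emeasure M (c -` {i} \<inter> space M)" for i
  have mN: "m i = emeasure N (d -` {i} \<inter> space N)" for i
    using emeasure_law_singleton[OF c, of i] emeasure_law_singleton[OF d, of i] law by (simp add: m_def)
  have inv: "m i * inverse (m i) = 1" if "m i \<noteq> 0" for i
    using that fin[of i] ennreal_inverse_mult[of "m i"]
    by (simp add: m_def mult.commute less_top flip: divide_ennreal_def)
  \<comment> \<open>The two cells labelled \<open>i\<close> both have mass \<open>m i\<close>, so
    their product has mass \<open>m i * m i\<close>; dividing by \<open>m i\<close> makes both
    marginals correct. On null cells the density is infinite, which the almost everywhere argument
    for the marginals ignores.\<close>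
  define D where "D z = (if c (fst z) = d (snd z) then inverse (m (c (fst z))) else 0)" for z
  have D[measurable]: "D \<in> borel_measurable (M \<Otimes>\<^sub>M N)"
    unfolding D_def
    by (rule measurable_fst_snd_step[OF c d, of "\<lambda>i j. if i = j then inverse (m i) else 0"]) simp
  define \<nu> where "\<nu> = density (M \<Otimes>\<^sub>M N) D"
  have s\<nu>: "sets \<nu> = sets (M \<Otimes>\<^sub>M N)" by (simp add: \<nu>_def)
  have [measurable]: "fst \<in> measurable \<nu> M" "snd \<in> measurable \<nu> N"
    by (simp_all add: measurable_cong_sets[OF s\<nu> refl])
  have in1: "(\<integral>\<^sup>+ y. D (x, y) \<partial>N) = inverse (m (c x)) * m (c x)" for x
  proof -
    have "(\<integral>\<^sup>+ y. D (x, y) \<partial>N) = (\<integral>\<^sup>+ y. inverse (m (c x)) * indicator (d -` {c x} \<inter> space N) y \<partial>N)"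
      by (intro nn_integral_cong) (simp add: D_def indicator_def)
    also have "\<dots> = inverse (m (c x)) * m (c x)"
      unfolding mN by (rule nn_integral_cmult_indicator) measurable
    finally show ?thesis .
  qed
  have in2: "(\<integral>\<^sup>+ x. D (x, y) \<partial>M) = inverse (m (d y)) * m (d y)" for y
  proof -
    have "(\<integral>\<^sup>+ x. D (x, y) \<partial>M) = (\<integral>\<^sup>+ x. inverse (m (d y)) * indicator (c -` {d y} \<inter> space M) x \<partial>M)"
      by (intro nn_integral_cong) (simp add: D_def indicator_def)
    also have "\<dots> = inverse (m (d y)) * m (d y)"
      unfolding m_def by (rule nn_integral_cmult_indicator) measurable
    finally show ?thesis .
  qed
  have m1: "distr \<nu> M fst = M"
  proof (rule measure_eqI)
    fix A assume "A \<in> sets (distr \<nu> M fst)"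
    then have A[measurable]: "A \<in> sets M" by simp
    have pA: "fst -` A \<inter> space \<nu> \<in> sets (M \<Otimes>\<^sub>M N)"
      unfolding s\<nu>[symmetric] by measurable
    have "emeasure (distr \<nu> M fst) A = emeasure \<nu> (fst -` A \<inter> space \<nu>)" by (rule emeasure_distr) auto
    also have "\<dots> = (\<integral>\<^sup>+ z. D z * indicator (fst -` A \<inter> space \<nu>) z \<partial>(M \<Otimes>\<^sub>M N))"
      unfolding \<nu>_def using pA by (intro emeasure_density) (simp_all add: \<nu>_def)
    also have "\<dots> = (\<integral>\<^sup>+ z. D z * indicator A (fst z) \<partial>(M \<Otimes>\<^sub>M N))"
      by (intro nn_integral_cong) (auto simp: \<nu>_def indicator_def)
    also have "\<dots> = (\<integral>\<^sup>+ x. \<integral>\<^sup>+ y. D (x, y) * indicator A x \<partial>N \<partial>M)"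
      by (subst N.nn_integral_fst[symmetric]) auto
    also have "\<dots> = (\<integral>\<^sup>+ x. indicator A x \<partial>M)"
    proof (rule nn_integral_cong_AE, use AE_law_nonzero[OF c] AE_space in eventually_elim)
      fix x assume nz: "emeasure M (c -` {c x} \<inter> space M) \<noteq> 0" and x: "x \<in> space M"
      have "(\<lambda>y. D (x, y)) \<in> borel_measurable N" using x by measurable
      then have "(\<integral>\<^sup>+ y. D (x, y) * indicator A x \<partial>N) = (inverse (m (c x)) * m (c x)) * indicator A x"
        by (simp add: nn_integral_multc in1)
      also have "\<dots> = indicator A x" using inv[of "c x"] nz by (simp add: m_def mult.commute)
      finally show "(\<integral>\<^sup>+ y. D (x, y) * indicator A x \<partial>N) = indicator A x" .
    qed
    finally show "emeasure (distr \<nu> M fst) A = emeasure M A" by simp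
  qed simp
  have m2: "distr \<nu> N snd = N"
  proof (rule measure_eqI)
    fix A assume "A \<in> sets (distr \<nu> N snd)"
    then have A[measurable]: "A \<in> sets N" by simp
    have pA: "snd -` A \<inter> space \<nu> \<in> sets (M \<Otimes>\<^sub>M N)"
      unfolding s\<nu>[symmetric] by measurable
    have "emeasure (distr \<nu> N snd) A = emeasure \<nu> (snd -` A \<inter> space \<nu>)" by (rule emeasure_distr) auto
    also have "\<dots> = (\<integral>\<^sup>+ z. D z * indicator (snd -` A \<inter> space \<nu>) z \<partial>(M \<Otimes>\<^sub>M N))"
      unfolding \<nu>_def using pA by (intro emeasure_density) (simp_all add: \<nu>_def)
    also have "\<dots> = (\<integral>\<^sup>+ z. D z * indicator A (snd z) \<partial>(M \<Otimes>\<^sub>M N))"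
      by (intro nn_integral_cong) (auto simp: \<nu>_def indicator_def)
    also have "\<dots> = (\<integral>\<^sup>+ y. \<integral>\<^sup>+ x. D (x, y) * indicator A y \<partial>M \<partial>N)"
      by (subst P.nn_integral_snd[symmetric]) auto
    also have "\<dots> = (\<integral>\<^sup>+ y. indicator A y \<partial>N)"
    proof (rule nn_integral_cong_AE, use AE_law_nonzero[OF d] AE_space in eventually_elim)
      fix y assume nz: "emeasure N (d -` {d y} \<inter> space N) \<noteq> 0" and y: "y \<in> space N"
      have "(\<lambda>x. D (x, y)) \<in> borel_measurable M" using y by measurable
      then have "(\<integral>\<^sup>+ x. D (x, y) * indicator A y \<partial>M) = (inverse (m (d y)) * m (d y)) * indicator A y"
        by (simp add: nn_integral_multc in2)
      also have "\<dots> = indicator A y" using inv[of "d y"] nz by (simp add: mN mult.commute)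
      finally show "(\<integral>\<^sup>+ x. D (x, y) * indicator A y \<partial>M) = indicator A y" .
    qed
    finally show "emeasure (distr \<nu> N snd) A = emeasure N A" by simp
  qed simp
  \<comment> \<open>Sigma-finiteness is pulled back from \<open>M\<close>, the image of \<nu> under
    \<open>fst\<close>.\<close>
  have "sigma_finite_measure \<nu>"
    by (rule sigma_finite_measure_distr[of \<nu> M fst]) (auto simp: m1 assms)
  then have "\<nu> \<in> couplings M N" by (simp add: couplings_def s\<nu> m1 m2)
  moreover have "AE z in \<nu>. c (fst z) = d (snd z)"
    unfolding \<nu>_def by (subst AE_density) (auto simp: D_def)
  ultimately show thesis by (rule that)
qed

section \<open>Pull-backs to couplings, and \<open>delta\<close> in terms of p-th powers\<close>

lemma coupling_projections:
  assumes \<nu>: "\<nu> \<in> couplings M1 M2"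
  shows "sigma_finite_measure M1 \<Longrightarrow> F \<in> borel_measurable (M1 \<Otimes>\<^sub>M M1) \<Longrightarrow>
      Lp_int p (\<nu> \<Otimes>\<^sub>M \<nu>) (\<lambda>z. F (fst (fst z), fst (snd z))) = Lp_int p (M1 \<Otimes>\<^sub>M M1) F"
    and "sigma_finite_measure M2 \<Longrightarrow> G \<in> borel_measurable (M2 \<Otimes>\<^sub>M M2) \<Longrightarrow>
      Lp_int p (\<nu> \<Otimes>\<^sub>M \<nu>) (\<lambda>z. G (snd (fst z), snd (snd z))) = Lp_int p (M2 \<Otimes>\<^sub>M M2) G"
  using Lp_int_distr_pair[of fst \<nu> M1 F p] Lp_int_distr_pair[of snd \<nu> M2 G p] couplingsD[OF \<nu>]
  by simp_all

text \<open>Together with its converse below, the only place where \<open>enn_root\<close> is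
  unfolded; all other estimates concern p-th powers. A strict bound on the infimum yields an actual
  coupling.\<close>

lemma delta_less_imp_coupling:
  assumes "delta p G1 G2 < ennreal e" "0 < e" "0 < p"
  obtains \<nu> where "\<nu> \<in> couplings (ext_space (fst G1)) (ext_space (fst G2))"
    "Lp_int p (\<nu> \<Otimes>\<^sub>M \<nu>) (\<lambda>z. ext_fun (snd G1) (fst (fst z)) (fst (snd z))
        - ext_fun (snd G2) (snd (fst z)) (snd (snd z))) < ennreal (e powr p)"
proof -
  let ?I = "\<lambda>\<nu>. Lp_int p (\<nu> \<Otimes>\<^sub>M \<nu>) (\<lambda>z. ext_fun (snd G1) (fst (fst z)) (fst (snd z))
        - ext_fun (snd G2) (snd (fst z)) (snd (snd z)))"
  obtain \<nu> where \<nu>: "\<nu> \<in> couplings (ext_space (fst G1)) (ext_space (fst G2))" "enn_root p (?I \<nu>) < ennreal e"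
    using assms(1) unfolding delta_def Lp_int_def INF_less_iff by blast
  then have fin: "?I \<nu> \<noteq> \<infinity>" by (auto simp: enn_root_def)
  then obtain r where r: "?I \<nu> = ennreal r" "0 \<le> r"
    by (cases "?I \<nu>" rule: ennreal_cases) auto
  then have "r powr (1 / p) < e"
    using \<nu>(2) by (simp add: enn_root_def ennreal_less_iff)
  then have "(r powr (1 / p)) powr p < e powr p"
    using assms by (intro powr_less_mono2) auto
  then have "r < e powr p" using assms r by (simp add: powr_powr)
  then have "?I \<nu> < ennreal (e powr p)"
    unfolding r(1) using r(2) by (simp add: ennreal_less_iff)
  with \<nu>(1) show thesis by (rule that)
qed

lemma coupling_imp_delta_less:
  assumes \<nu>: "\<nu> \<in> couplings (ext_space (fst G1)) (ext_space (fst G2))"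
    "Lp_int p (\<nu> \<Otimes>\<^sub>M \<nu>) (\<lambda>z. ext_fun (snd G1) (fst (fst z)) (fst (snd z))
        - ext_fun (snd G2) (snd (fst z)) (snd (snd z))) < ennreal (e powr p)"
    and "0 < e" "0 < p"
  shows "delta p G1 G2 < ennreal e"
proof -
  let ?I = "Lp_int p (\<nu> \<Otimes>\<^sub>M \<nu>) (\<lambda>z. ext_fun (snd G1) (fst (fst z)) (fst (snd z))
        - ext_fun (snd G2) (snd (fst z)) (snd (snd z)))"
  have fin: "?I < \<infinity>" using \<nu>(2) by (rule less_trans) simp
  then obtain r where r: "?I = ennreal r" "0 \<le> r"
    by (cases ?I rule: ennreal_cases) auto
  have "r < e powr p" using \<nu>(2) unfolding r(1) using r(2) by (simp add: ennreal_less_iff)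
  then have "r powr (1 / p) < (e powr p) powr (1 / p)"
    using assms(4) r(2) by (intro powr_less_mono2) auto
  then have "r powr (1 / p) < e" using assms(3,4) by (simp add: powr_powr)
  then have "enn_root p ?I < ennreal e"
    unfolding r(1) using r(2) by (simp add: enn_root_def ennreal_less_iff)
  then show ?thesis
    using \<nu>(1) unfolding delta_def Lp_int_def INF_less_iff by blast
qed

section \<open>Step representations of graphons\<close>

lemma measurable_int_encode_floor [measurable]:
  "(\<lambda>t::real. int_encode \<lfloor>t\<rfloor>) \<in> measurable borel (count_space UNIV)"
  by (rule measurable_compose[of floor borel "count_space UNIV"]) auto

lemma emeasure_lborel_unit_cell: "emeasure lborel {t::real. int_encode \<lfloor>t\<rfloor> = k} = 1"
proof -
  have "{t::real. int_encode \<lfloor>t\<rfloor> = k} = {of_int (int_decode k) ..< of_int (int_decode k) + 1}"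
  proof -
    have "int_encode i = k \<longleftrightarrow> i = int_decode k" for i
      by (metis int_decode_inverse int_encode_inverse)
    then show ?thesis by (auto simp: floor_eq_iff)
  qed
  then show ?thesis by simp
qed

lemma Lp_int_ext_space:
  assumes "sigma_finite_measure M"
    and [measurable]: "(\<lambda>z. F (fst z) (snd z)) \<in> borel_measurable (ext_space M \<Otimes>\<^sub>M ext_space M)"
    and "\<And>s t. F (Inr t) s = 0" "\<And>s t. F s (Inr t) = 0"
  shows "Lp_int p (ext_space M \<Otimes>\<^sub>M ext_space M) (\<lambda>z. F (fst z) (snd z))
    = Lp_int p (M \<Otimes>\<^sub>M M) (\<lambda>z. F (Inl (fst z)) (Inl (snd z)))"
  unfolding Lp_int_def
  using nn_integral_ext_space_pair[OF assms(1), of "\<lambda>z. ennreal (\<bar>F (fst z) (snd z)\<bar> powr p)"] assms(3,4)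
  by simp

text \<open>Odd labels are meant for the added line, even ones for the original space. Equal mass
  makes all odd cells interchangeable, and since \<open>U\<close> vanishes on them, relabelling
  among them does not affect the kernel; these two properties carry
  \<open>step_rep_coupling\<close>. By symmetry of \<open>U\<close>, vanishing for odd
  \<open>i\<close> includes vanishing for odd \<open>j\<close>.\<close>

definition step_rep :: "real \<Rightarrow> real \<Rightarrow> 'a graphon \<Rightarrow> ('a + real \<Rightarrow> nat) \<Rightarrow> (nat \<Rightarrow> nat \<Rightarrow> real) \<Rightarrow> bool" where
  "step_rep p e G c U \<longleftrightarrow> c \<in> measurable (ext_space (fst G)) (count_space UNIV)
    \<and> (\<forall>i. emeasure (ext_space (fst G)) (c -` {i} \<inter> space (ext_space (fst G))) < \<infinity>)
    \<and> (\<forall>i. odd i \<longrightarrow> emeasure (ext_space (fst G)) (c -` {i} \<inter> space (ext_space (fst G))) = 1)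
    \<and> (\<forall>i j. U i j = U j i) \<and> (\<forall>i j. odd i \<longrightarrow> U i j = 0)
    \<and> ((\<forall>x\<in>space (fst G). \<forall>y\<in>space (fst G). 0 \<le> snd G x y) \<longrightarrow> (\<forall>i j. 0 \<le> U i j))
    \<and> L1p_int p (ext_space (fst G) \<Otimes>\<^sub>M ext_space (fst G))
        (\<lambda>z. ext_fun (snd G) (fst z) (snd z) - U (c (fst z)) (c (snd z))) < ennreal e"

lemma emeasure_ext_space_vimage:
  assumes "c \<in> measurable (ext_space M) (count_space UNIV)"
  shows "emeasure (ext_space M) (c -` {i} \<inter> space (ext_space M))
    = emeasure M {x \<in> space M. c (Inl x) = i} + emeasure lborel {t. c (Inr t) = i}"
proof -
  have "Inl -` (c -` {i} \<inter> space (ext_space M)) = {x \<in> space M. c (Inl x) = i}"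
    "Inr -` (c -` {i} \<inter> space (ext_space M)) = {t. c (Inr t) = i}"
    by (auto simp: space_ext_space)
  then show ?thesis
    using emeasure_ext_space[OF measurable_sets[OF assms, of "{i}"]] by simp
qed

lemma exists_step_rep:
  fixes G :: "'a graphon"
  assumes sf: "sigma_finite_measure (fst G)"
    and W: "(\<lambda>z. snd G (fst z) (snd z)) \<in> borel_measurable (fst G \<Otimes>\<^sub>M fst G)"
    and sym: "\<And>x y. x \<in> space (fst G) \<Longrightarrow> y \<in> space (fst G) \<Longrightarrow> snd G x y = snd G y x"
    and fin: "L1p_int p (fst G \<Otimes>\<^sub>M fst G) (\<lambda>z. snd G (fst z) (snd z)) < \<infinity>" and p: "1 \<le> p" and e: "0 < e"
  shows "\<exists>c U. step_rep p e G c U"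
proof -
  define M where "M = fst G"
  note ext_meas[measurable] = borel_measurable_ext_fun[OF W]
  obtain c :: "'a \<Rightarrow> nat" and U where c[measurable]: "c \<in> measurable M (count_space UNIV)"
    and c_fin: "\<And>i. emeasure M (c -` {i} \<inter> space M) < \<infinity>" and U_sym: "\<And>i j. U i j = U j i"
    and U_nn: "(\<forall>x\<in>space M. \<forall>y\<in>space M. 0 \<le> snd G x y) \<longrightarrow> (\<forall>i j. 0 \<le> U i j)"
    and U: "L1p_int p (M \<Otimes>\<^sub>M M) (\<lambda>z. snd G (fst z) (snd z) - U (c (fst z)) (c (snd z))) < ennreal e"
    using graphon_step_approx[OF sf W sym fin p e] unfolding M_def by blast
  \<comment> \<open>The unit intervals of the line are numbered by the encoded floor, and doubling
    keeps the two kinds of labels apart.\<close>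
  define C where "C s = (case s of Inl x \<Rightarrow> 2 * c x | Inr t \<Rightarrow> 2 * int_encode \<lfloor>t\<rfloor> + 1)" for s :: "'a + real"
  define V where "V i j = (if even i \<and> even j then U (i div 2) (j div 2) else 0)" for i j
  have C[measurable]: "C \<in> measurable (ext_space M) (count_space UNIV)"
  proof (rule measurable_ext_spaceI)
    show "(\<lambda>x. C (Inl x)) \<in> measurable M (count_space UNIV)"
      unfolding C_def sum.case by (rule measurable_compose[OF c]) simp
    show "(\<lambda>t. C (Inr t)) \<in> measurable borel (count_space UNIV)"
      unfolding C_def sum.case by (rule measurable_compose[OF measurable_int_encode_floor]) simp
  qed
  have cells: "emeasure (ext_space M) (C -` {i} \<inter> space (ext_space M))
      = (if odd i then 1 else emeasure M (c -` {i div 2} \<inter> space M))" for i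
  proof (cases "odd i")
    case True
    then obtain k where i: "i = 2 * k + 1" by (elim oddE)
    have "2 * a \<noteq> 2 * k + 1" for a :: nat by presburger
    then have e1: "{x \<in> space M. C (Inl x) = i} = {}" by (simp add: i C_def)
    have e2: "{t. C (Inr t) = i} = {t. int_encode \<lfloor>t\<rfloor> = k}" by (simp add: i C_def)
    have "emeasure (ext_space M) (C -` {i} \<inter> space (ext_space M)) = 1"
      by (simp only: emeasure_ext_space_vimage[OF C] e1 e2 emeasure_empty emeasure_lborel_unit_cell add_0)
    then show ?thesis using True by simp
  next
    case False
    then obtain k where i: "i = 2 * k" by (auto elim: evenE)
    have "{x \<in> space M. C (Inl x) = i} = c -` {k} \<inter> space M" by (auto simp: i C_def)
    moreover have "2 * a + 1 \<noteq> 2 * k" for a :: nat by presburger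
    then have "{t. C (Inr t) = i} = {}" by (simp add: i C_def)
    ultimately show ?thesis using False i by (simp add: emeasure_ext_space_vimage[OF C])
  qed
  \<comment> \<open>\<open>V\<close> vanishes as soon as one label is odd, and
    \<open>ext_fun\<close> vanishes on the line, so the extension adds no error.\<close>
  have L: "Lp_int q (ext_space M \<Otimes>\<^sub>M ext_space M)
      (\<lambda>z. ext_fun (snd G) (fst z) (snd z) - V (C (fst z)) (C (snd z)))
    = Lp_int q (M \<Otimes>\<^sub>M M) (\<lambda>z. snd G (fst z) (snd z) - U (c (fst z)) (c (snd z)))" for q
  proof -
    have "(\<lambda>z. ext_fun (snd G) (fst z) (snd z) - V (C (fst z)) (C (snd z)))
        \<in> borel_measurable (ext_space M \<Otimes>\<^sub>M ext_space M)"
      unfolding M_def by (intro borel_measurable_diff ext_meas borel_measurable_step C[unfolded M_def])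
    then show ?thesis
      using Lp_int_ext_space[of M "\<lambda>s t. ext_fun (snd G) s t - V (C s) (C t)" q] sf
      by (simp add: M_def V_def C_def)
  qed
  have "step_rep p e G C V"
    unfolding step_rep_def M_def[symmetric] L1p_int_def L
    using C c_fin U_nn U by (auto simp: cells V_def U_sym L1p_int_def intro: U_sym)
  then show ?thesis by blast
qed

text \<open>The half-line added to \<open>N\<close> is absorbed by relabelling: odd cells all have mass 1,
  so the cells \<open>4k+1\<close> of \<open>g'\<close> may come from \<open>N\<close> and the cells \<open>4k+3\<close> from the added line.\<close>
lemma step_rep_coupling:
  fixes G :: "'a graphon" and N :: "'b measure" and g :: "'b \<Rightarrow> nat"
  assumes rep: "step_rep p e G c U"
    and W: "(\<lambda>z. snd G (fst z) (snd z)) \<in> borel_measurable (fst G \<Otimes>\<^sub>M fst G)"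
    and sf: "sigma_finite_measure (fst G)" "sigma_finite_measure N"
    and g: "g \<in> measurable N (count_space UNIV)" and law: "law N g = law (ext_space (fst G)) c"
    and V: "(\<lambda>z. V (fst z) (snd z)) \<in> borel_measurable (N \<Otimes>\<^sub>M N)" and p: "1 \<le> p"
  obtains \<nu> where "\<nu> \<in> couplings (ext_space (fst G)) (ext_space N)"
    "Lp_int p (\<nu> \<Otimes>\<^sub>M \<nu>) (\<lambda>z. ext_fun (snd G) (fst (fst z)) (fst (snd z)) - ext_fun V (snd (fst z)) (snd (snd z)))
      \<le> ennreal (2 powr p) * (ennreal e + Lp_int p (N \<Otimes>\<^sub>M N) (\<lambda>z. U (g (fst z)) (g (snd z)) - V (fst z) (snd z)))"
proof -
  let ?E = "ext_space (fst G)" and ?N = "ext_space N"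
  have c: "c \<in> measurable ?E (count_space UNIV)"
    and fin: "\<And>i. emeasure ?E (c -` {i} \<inter> space ?E) < \<infinity>"
    and odd1: "\<And>i. odd i \<Longrightarrow> emeasure ?E (c -` {i} \<inter> space ?E) = 1"
    and U0: "\<And>i j. odd i \<Longrightarrow> U i j = 0" "\<And>i j. odd j \<Longrightarrow> U i j = 0"
    and err: "L1p_int p (?E \<Otimes>\<^sub>M ?E) (\<lambda>z. ext_fun (snd G) (fst z) (snd z) - U (c (fst z)) (c (snd z))) < ennreal e"
    using rep unfolding step_rep_def by (metis (no_types, lifting))+
  \<comment> \<open>On odd labels \<open>2 * g w - 1\<close> maps \<open>2k + 1\<close> to
    \<open>4k + 1\<close>. Even labels must stay, since they carry the values of
    \<open>U\<close>.\<close>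
  define g' where "g' s = (case s of Inl w \<Rightarrow> (if even (g w) then g w else 2 * g w - 1)
      | Inr t \<Rightarrow> 4 * int_encode \<lfloor>t\<rfloor> + 3)" for s :: "'b + real"
  have g': "g' \<in> measurable ?N (count_space UNIV)"
  proof (rule measurable_ext_spaceI)
    show "(\<lambda>x. g' (Inl x)) \<in> measurable N (count_space UNIV)"
      unfolding g'_def sum.case by (rule measurable_compose[OF g]) simp
    show "(\<lambda>t. g' (Inr t)) \<in> measurable borel (count_space UNIV)"
      unfolding g'_def sum.case by (rule measurable_compose[OF measurable_int_encode_floor]) simp
  qed
  have cell: "emeasure N {x \<in> space N. g x = i} = emeasure ?E (c -` {i} \<inter> space ?E)" for i
  proof -
    have "{x \<in> space N. g x = i} = g -` {i} \<inter> space N" by auto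
    then show ?thesis
      using emeasure_law_singleton[OF g, of i] emeasure_law_singleton[OF c, of i] law by simp
  qed
  have law': "law ?E c = law ?N g'"
  proof (rule law_eqI[OF c g'])
    fix i :: nat
    consider k where "i = 2 * k" | k where "i = 4 * k + 1" | k where "i = 4 * k + 3"
    proof -
      have "i = 2 * (i div 2) \<or> i = 4 * (i div 4) + 1 \<or> i = 4 * (i div 4) + 3" by presburger
      then show thesis using that by blast
    qed
    then show "emeasure ?E (c -` {i} \<inter> space ?E) = emeasure ?N (g' -` {i} \<inter> space ?N)"
    proof cases
      case 1
      have "(if even n then n else 2 * n - 1) = i \<longleftrightarrow> n = i" for n :: nat using 1 by presburger
      then have "{x \<in> space N. g' (Inl x) = i} = {x \<in> space N. g x = i}" by (simp add: g'_def)
      moreover have "4 * a + 3 \<noteq> 2 * k" for a by presburger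
      then have "{t. g' (Inr t) = i} = {}" by (simp add: 1 g'_def)
      ultimately show ?thesis by (simp add: emeasure_ext_space_vimage[OF g'] cell)
    next
      case 2
      have "(if even n then n else 2 * n - 1) = i \<longleftrightarrow> n = 2 * k + 1" for n :: nat using 2 by presburger
      then have "{x \<in> space N. g' (Inl x) = i} = {x \<in> space N. g x = 2 * k + 1}" by (simp add: g'_def)
      moreover have "4 * a + 3 \<noteq> 4 * k + 1" for a by presburger
      then have "{t. g' (Inr t) = i} = {}" by (simp add: 2 g'_def)
      \<comment> \<open>The cell \<open>4k + 1\<close> of \<open>g'\<close> is the cell
        \<open>2k + 1\<close> of \<open>g\<close>: different labels, but both odd and hence both of
        mass 1.\<close>
      ultimately show ?thesis using odd1[of i] odd1[of "2 * k + 1"] 2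
        by (simp add: emeasure_ext_space_vimage[OF g'] cell)
    next
      case 3
      have "\<not> (if even n then n else 2 * n - 1) = i" for n :: nat using 3 by presburger
      then have e1: "{x \<in> space N. g' (Inl x) = i} = {}" by (simp add: g'_def)
      have e2: "{t. g' (Inr t) = i} = {t. int_encode \<lfloor>t\<rfloor> = k}" by (simp add: 3 g'_def)
      have "emeasure ?N (g' -` {i} \<inter> space ?N) = 1"
        by (simp only: emeasure_ext_space_vimage[OF g'] e1 e2 emeasure_empty emeasure_lborel_unit_cell add_0)
      then show ?thesis using odd1[of i] 3 by simp
    qed
  qed
  obtain \<nu> where \<nu>: "\<nu> \<in> couplings ?E ?N" and AE1: "AE z in \<nu>. c (fst z) = g' (snd z)"
    using exists_coupling_same_law[OF sigma_finite_ext_space[OF sf(1)] sigma_finite_ext_space[OF sf(2)] c g' law' fin] .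
  interpret \<nu>: sigma_finite_measure \<nu> by (rule couplingsD(1)[OF \<nu>])
  note [measurable] = couplingsD(2,3)[OF \<nu>] c g' borel_measurable_ext_fun[OF W] borel_measurable_ext_fun[OF V]
  obtain Z where Z: "Z \<in> null_sets \<nu>" "{z \<in> space \<nu>. c (fst z) \<noteq> g' (snd z)} \<subseteq> Z"
    using AE1 by (auto simp: eventually_ae_filter)
  \<comment> \<open>The exceptional set of the product is covered by two null strips, one for each
    coordinate.\<close>
  have "Z \<times> space \<nu> \<union> space \<nu> \<times> Z \<in> null_sets (\<nu> \<Otimes>\<^sub>M \<nu>)"
    by (rule null_sets.Un[OF \<nu>.times_in_null_sets1[OF Z(1) sets.top] \<nu>.times_in_null_sets2[OF sets.top Z(1)]])
  then have AE2: "AE z in \<nu> \<Otimes>\<^sub>M \<nu>. c (fst (fst z)) = g' (snd (fst z)) \<and> c (fst (snd z)) = g' (snd (snd z))"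
    by (rule AE_I') (use Z(2) in \<open>auto simp: space_pair_measure\<close>)
  let ?F = "\<lambda>z. ext_fun (snd G) (fst (fst z)) (fst (snd z))"
  let ?H = "\<lambda>z. U (c (fst (fst z))) (c (fst (snd z)))"
  let ?V = "\<lambda>z. ext_fun V (snd (fst z)) (snd (snd z))"
  have F: "?F \<in> borel_measurable (\<nu> \<Otimes>\<^sub>M \<nu>)"
    using measurable_compose[OF _ borel_measurable_ext_fun[OF W], of "\<lambda>z. (fst (fst z), fst (snd z))" "\<nu> \<Otimes>\<^sub>M \<nu>"] by simp
  have H: "?H \<in> borel_measurable (\<nu> \<Otimes>\<^sub>M \<nu>)"
    using measurable_compose[OF _ borel_measurable_step[OF c c, of U], of "\<lambda>z. (fst (fst z), fst (snd z))" "\<nu> \<Otimes>\<^sub>M \<nu>"] by simp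
  have V': "?V \<in> borel_measurable (\<nu> \<Otimes>\<^sub>M \<nu>)"
    using measurable_compose[OF _ borel_measurable_ext_fun[OF V], of "\<lambda>z. (snd (fst z), snd (snd z))" "\<nu> \<Otimes>\<^sub>M \<nu>"] by simp
  have e1: "Lp_int p (\<nu> \<Otimes>\<^sub>M \<nu>) (\<lambda>z. ?F z - ?H z) \<le> ennreal e"
  proof -
    have "Lp_int p (\<nu> \<Otimes>\<^sub>M \<nu>) (\<lambda>z. ?F z - ?H z)
      = Lp_int p (?E \<Otimes>\<^sub>M ?E) (\<lambda>z. ext_fun (snd G) (fst z) (snd z) - U (c (fst z)) (c (snd z)))"
      using coupling_projections(1)[OF \<nu> sigma_finite_ext_space[OF sf(1)],
          of "\<lambda>z. ext_fun (snd G) (fst z) (snd z) - U (c (fst z)) (c (snd z))" p] by simp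
    also have "\<dots> \<le> L1p_int p (?E \<Otimes>\<^sub>M ?E) (\<lambda>z. ext_fun (snd G) (fst z) (snd z) - U (c (fst z)) (c (snd z)))"
      by (simp add: L1p_int_def)
    finally show ?thesis using err by simp
  qed
  have "Lp_int p (\<nu> \<Otimes>\<^sub>M \<nu>) (\<lambda>z. ?H z - ?V z)
     = Lp_int p (\<nu> \<Otimes>\<^sub>M \<nu>) (\<lambda>z. U (g' (snd (fst z))) (g' (snd (snd z))) - ?V z)"
    by (rule Lp_int_cong_AE) (use AE2 in eventually_elim, simp)
  also have "\<dots> = Lp_int p (?N \<Otimes>\<^sub>M ?N) (\<lambda>z. U (g' (fst z)) (g' (snd z)) - ext_fun V (fst z) (snd z))"
    using coupling_projections(2)[OF \<nu> sigma_finite_ext_space[OF sf(2)],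
          of "\<lambda>z. U (g' (fst z)) (g' (snd z)) - ext_fun V (fst z) (snd z)" p] by simp
  also have "\<dots> = Lp_int p (N \<Otimes>\<^sub>M N) (\<lambda>z. U (g' (Inl (fst z))) (g' (Inl (snd z))) - V (fst z) (snd z))"
  proof -
    have o: "odd (g' (Inr t))" for t by (simp add: g'_def)
    have "(\<lambda>z. U (g' (fst z)) (g' (snd z)) - ext_fun V (fst z) (snd z)) \<in> borel_measurable (?N \<Otimes>\<^sub>M ?N)"
      by measurable
    then show ?thesis
      using Lp_int_ext_space[OF sf(2), of "\<lambda>s t. U (g' s) (g' t) - ext_fun V s t" p] U0 o by simp
  qed
  \<comment> \<open>The relabelling does not change the kernel: even labels are fixed, and an odd
    label stays odd, where \<open>U\<close> is 0.\<close>
  also have "(\<lambda>z. U (g' (Inl (fst z))) (g' (Inl (snd z))) - V (fst z) (snd z))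
      = (\<lambda>z. U (g (fst z)) (g (snd z)) - V (fst z) (snd z))"
  proof
    have o: "odd (g' (Inl w))" if "odd (g w)" for w
    proof -
      have "2 * g w - 1 = Suc (2 * (g w - 1))" using that by (cases "g w") auto
      then show ?thesis using that by (simp add: g'_def)
    qed
    have ev: "g' (Inl w) = g w" if "even (g w)" for w using that by (simp add: g'_def)
    fix z
    have "U (g' (Inl (fst z))) (g' (Inl (snd z))) = U (g (fst z)) (g (snd z))"
      by (cases "even (g (fst z))"; cases "even (g (snd z))") (simp_all add: o ev U0)
    then show "U (g' (Inl (fst z))) (g' (Inl (snd z))) - V (fst z) (snd z)
      = U (g (fst z)) (g (snd z)) - V (fst z) (snd z)" by simp
  qed
  finally have e2: "Lp_int p (\<nu> \<Otimes>\<^sub>M \<nu>) (\<lambda>z. ?H z - ?V z)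
    = Lp_int p (N \<Otimes>\<^sub>M N) (\<lambda>z. U (g (fst z)) (g (snd z)) - V (fst z) (snd z))" .
  have "Lp_int p (\<nu> \<Otimes>\<^sub>M \<nu>) (\<lambda>z. ?F z - ?V z)
    \<le> ennreal (2 powr p) * (Lp_int p (\<nu> \<Otimes>\<^sub>M \<nu>) (\<lambda>z. ?F z - ?H z) + Lp_int p (\<nu> \<Otimes>\<^sub>M \<nu>) (\<lambda>z. ?H z - ?V z))"
    using p by (intro Lp_int_triangle F H V') simp
  also have "\<dots> \<le> ennreal (2 powr p) * (ennreal e + Lp_int p (N \<Otimes>\<^sub>M N) (\<lambda>z. U (g (fst z)) (g (snd z)) - V (fst z) (snd z)))"
    unfolding e2 by (intro mult_left_mono add_right_mono e1) simp
  finally show thesis using that[OF \<nu>] by blast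
qed

text \<open>Lebesgue measure on the half-line, carried to the type in which the limit graphon is
  sought: \<open>e\<close> embeds a real as a constant sequence. Pulling the sigma-algebra back
  along the left inverse \<open>r\<close> makes both maps measurable. The mass is infinite so as to
  match the extended spaces.\<close>

lemma exists_height_measure:
  "\<exists>(M :: (nat \<Rightarrow> 'a + real) measure) h. height_measure M h \<and> emeasure M (space M) = \<infinity>"
proof -
  define e where "e t = (\<lambda>_ :: nat. Inr t :: 'a + real)" for t
  define r :: "(nat \<Rightarrow> 'a + real) \<Rightarrow> real" where "r w = case_sum (\<lambda>_. 0) (\<lambda>t. t) (w 0)" for w
  have re: "r (e t) = t" for t by (simp add: r_def e_def)
  let ?V = "vimage_algebra UNIV r borel"
  define L where "L = density lborel (indicator {0 :: real ..})"
  define M where "M = distr L ?V e"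
  have r: "r \<in> measurable ?V borel" by (rule measurable_vimage_algebra1) simp
  have e: "e \<in> measurable L ?V"
    by (rule measurable_vimage_algebra2) (simp_all add: re L_def)
  have sM: "sets M = sets ?V" "space M = UNIV" by (simp_all add: M_def)
  \<comment> \<open>Sequences with \<open>r w < 0\<close> are still points of the space, though they
    form a null set; the cut at 0 makes \<open>h\<close> nonnegative on them too.\<close>
  define h where "h w = max 0 (r w)" for w
  have h: "h \<in> borel_measurable M"
    unfolding h_def measurable_cong_sets[OF sM(1) refl] using r by measurable
  have "emeasure M {x \<in> space M. a < h x \<and> h x \<le> b} \<le> ennreal (b - a)" if "a \<le> b" for a b
  proof -
    have "{x \<in> space M. a < h x \<and> h x \<le> b} \<in> sets M" using h by measurable
    then have "emeasure M {x \<in> space M. a < h x \<and> h x \<le> b}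
        = emeasure L (e -` {x \<in> space M. a < h x \<and> h x \<le> b} \<inter> space L)"
      unfolding M_def by (intro emeasure_distr e) simp
    also have "e -` {x \<in> space M. a < h x \<and> h x \<le> b} \<inter> space L = {t. a < max 0 t \<and> max 0 t \<le> b}"
      by (auto simp: sM h_def re L_def)
    also have "emeasure L {t. a < max 0 t \<and> max 0 t \<le> b}
        = (\<integral>\<^sup>+ t. indicator {0..} t * indicator {t. a < max 0 t \<and> max 0 t \<le> b} t \<partial>lborel)"
      unfolding L_def by (intro emeasure_density) auto
    also have "\<dots> \<le> (\<integral>\<^sup>+ t. indicator {a..b} t \<partial>lborel)"
      by (intro nn_integral_mono) (auto simp: indicator_def)
    also have "\<dots> = ennreal (b - a)" using that by simp
    finally show ?thesis .
  qed
  then have "height_measure M h"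
    using h by unfold_locales (auto simp: h_def)
  moreover have "emeasure M (space M) = \<infinity>"
  proof -
    have "emeasure M (space M) = emeasure L (e -` space ?V \<inter> space L)"
      unfolding M_def space_distr by (rule emeasure_distr[OF e sets.top])
    also have "e -` space ?V \<inter> space L = UNIV" by (auto simp: L_def)
    also have "emeasure L UNIV = (\<integral>\<^sup>+ t. indicator {0 :: real ..} t * indicator UNIV t \<partial>lborel)"
      unfolding L_def by (intro emeasure_density) auto
    also have "\<dots> = emeasure lborel {0 :: real ..}" by simp
    also have "\<dots> = \<infinity>"
    proof (rule ccontr)
      assume "emeasure lborel {0 :: real ..} \<noteq> \<infinity>"
      then obtain x where x: "emeasure lborel {0 :: real ..} = ennreal x" "0 \<le> x"
        by (cases "emeasure lborel {0 :: real ..}" rule: ennreal_cases) auto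
      have "emeasure lborel {0 .. x + 1} \<le> emeasure lborel {0 :: real ..}"
        by (intro emeasure_mono) auto
      then show False using x by (simp del: ennreal_plus)
    qed
    finally show ?thesis .
  qed
  ultimately show ?thesis by blast
qed

text \<open>One link of the chain: from kernel to graphon, across a nearly optimal coupling, and
  from graphon to kernel. Since \<open>delta\<close> is a norm while \<open>e\<close> bounds p-th
  powers, the hypothesis reads \<open>e powr (1 / p)\<close>.\<close>

lemma (in height_measure) transport_step_rep:
  fixes G1 :: "'b graphon" and G2 :: "'c graphon"
  assumes rep1: "step_rep p e G1 c1 U1" and rep2: "step_rep p e G2 c2 U2"
    and W1: "(\<lambda>z. snd G1 (fst z) (snd z)) \<in> borel_measurable (fst G1 \<Otimes>\<^sub>M fst G1)"
    and W2: "(\<lambda>z. snd G2 (fst z) (snd z)) \<in> borel_measurable (fst G2 \<Otimes>\<^sub>M fst G2)"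
    and sf: "sigma_finite_measure (fst G1)" "sigma_finite_measure (fst G2)"
    and delta: "delta p G1 G2 < ennreal (e powr (1 / p))" and e: "0 < e" and p: "1 \<le> p"
    and f: "f \<in> measurable M (count_space UNIV)" and law: "law M f = law (ext_space (fst G1)) c1"
  obtains g where "g \<in> measurable M (count_space UNIV)" "law M g = law (ext_space (fst G2)) c2"
    "Lp_int p (M \<Otimes>\<^sub>M M) (\<lambda>z. U1 (f (fst z)) (f (snd z)) - U2 (g (fst z)) (g (snd z)))
      \<le> ennreal (3 * (2 powr p * 2 powr p) * e)"
proof -
  let ?E1 = "ext_space (fst G1)" and ?E2 = "ext_space (fst G2)"
  have "0 < e powr (1 / p)" "(e powr (1 / p)) powr p = e" using e p by (simp_all add: powr_powr)
  then obtain \<nu> where \<nu>: "\<nu> \<in> couplings ?E1 ?E2"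
    and d: "Lp_int p (\<nu> \<Otimes>\<^sub>M \<nu>) (\<lambda>z. ext_fun (snd G1) (fst (fst z)) (fst (snd z))
        - ext_fun (snd G2) (snd (fst z)) (snd (snd z))) < ennreal e"
    using delta_less_imp_coupling[OF delta] p by auto
  have c1: "c1 \<in> measurable ?E1 (count_space UNIV)"
    and fin: "\<And>i. emeasure ?E1 (c1 -` {i} \<inter> space ?E1) < \<infinity>"
    and err1: "L1p_int p (?E1 \<Otimes>\<^sub>M ?E1) (\<lambda>z. ext_fun (snd G1) (fst z) (snd z) - U1 (c1 (fst z)) (c1 (snd z))) < ennreal e"
    using rep1 unfolding step_rep_def by blast+
  have c2: "c2 \<in> measurable ?E2 (count_space UNIV)"
    and err2: "L1p_int p (?E2 \<Otimes>\<^sub>M ?E2) (\<lambda>z. ext_fun (snd G2) (fst z) (snd z) - U2 (c2 (fst z)) (c2 (snd z))) < ennreal e"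
    using rep2 unfolding step_rep_def by blast+
  obtain g where g: "g \<in> measurable M (count_space UNIV)" "law M g = law ?E2 c2"
    and tr: "\<And>H q. Lp_int q (M \<Otimes>\<^sub>M M) (\<lambda>z. H (f (fst z)) (f (snd z)) (g (fst z)) (g (snd z)))
      = Lp_int q (\<nu> \<Otimes>\<^sub>M \<nu>) (\<lambda>z. H (c1 (fst (fst z))) (c1 (fst (snd z))) (c2 (snd (fst z))) (c2 (snd (snd z))))"
    by (rule transport[OF \<nu> c1 c2 fin f law]) blast
  note [measurable] = couplingsD(2,3)[OF \<nu>] c1 c2
  let ?A1 = "\<lambda>z. U1 (c1 (fst (fst z))) (c1 (fst (snd z)))"
  let ?W1 = "\<lambda>z. ext_fun (snd G1) (fst (fst z)) (fst (snd z))"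
  let ?W2 = "\<lambda>z. ext_fun (snd G2) (snd (fst z)) (snd (snd z))"
  let ?A2 = "\<lambda>z. U2 (c2 (snd (fst z))) (c2 (snd (snd z)))"
  have m1: "?W1 \<in> borel_measurable (\<nu> \<Otimes>\<^sub>M \<nu>)" "?A1 \<in> borel_measurable (\<nu> \<Otimes>\<^sub>M \<nu>)"
    using measurable_compose[OF _ borel_measurable_ext_fun[OF W1], of "\<lambda>z. (fst (fst z), fst (snd z))" "\<nu> \<Otimes>\<^sub>M \<nu>"]
      measurable_compose[OF _ borel_measurable_step[OF c1 c1, of U1], of "\<lambda>z. (fst (fst z), fst (snd z))" "\<nu> \<Otimes>\<^sub>M \<nu>"]
    by simp_all
  have m2: "?W2 \<in> borel_measurable (\<nu> \<Otimes>\<^sub>M \<nu>)" "?A2 \<in> borel_measurable (\<nu> \<Otimes>\<^sub>M \<nu>)"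
    using measurable_compose[OF _ borel_measurable_ext_fun[OF W2], of "\<lambda>z. (snd (fst z), snd (snd z))" "\<nu> \<Otimes>\<^sub>M \<nu>"]
      measurable_compose[OF _ borel_measurable_step[OF c2 c2, of U2], of "\<lambda>z. (snd (fst z), snd (snd z))" "\<nu> \<Otimes>\<^sub>M \<nu>"]
    by simp_all
  have e1: "Lp_int p (\<nu> \<Otimes>\<^sub>M \<nu>) (\<lambda>z. ?A1 z - ?W1 z) \<le> ennreal e"
  proof -
    have "(\<lambda>z. ext_fun (snd G1) (fst z) (snd z) - U1 (c1 (fst z)) (c1 (snd z))) \<in> borel_measurable (?E1 \<Otimes>\<^sub>M ?E1)"
      by (intro borel_measurable_diff borel_measurable_ext_fun[OF W1] borel_measurable_step c1)
    then have "Lp_int p (\<nu> \<Otimes>\<^sub>M \<nu>) (\<lambda>z. ?W1 z - ?A1 z)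
      = Lp_int p (?E1 \<Otimes>\<^sub>M ?E1) (\<lambda>z. ext_fun (snd G1) (fst z) (snd z) - U1 (c1 (fst z)) (c1 (snd z)))"
      using coupling_projections(1)[OF \<nu> sigma_finite_ext_space[OF sf(1)],
          of "\<lambda>z. ext_fun (snd G1) (fst z) (snd z) - U1 (c1 (fst z)) (c1 (snd z))" p] by simp
    also have "\<dots> \<le> L1p_int p (?E1 \<Otimes>\<^sub>M ?E1) (\<lambda>z. ext_fun (snd G1) (fst z) (snd z) - U1 (c1 (fst z)) (c1 (snd z)))"
      by (simp add: L1p_int_def)
    also have "\<dots> \<le> ennreal e" using err1 by simp
    finally show ?thesis by (subst Lp_int_minus_commute)
  qed
  have e2: "Lp_int p (\<nu> \<Otimes>\<^sub>M \<nu>) (\<lambda>z. ?W2 z - ?A2 z) \<le> ennreal e"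
  proof -
    have "(\<lambda>z. ext_fun (snd G2) (fst z) (snd z) - U2 (c2 (fst z)) (c2 (snd z))) \<in> borel_measurable (?E2 \<Otimes>\<^sub>M ?E2)"
      by (intro borel_measurable_diff borel_measurable_ext_fun[OF W2] borel_measurable_step c2)
    then have "Lp_int p (\<nu> \<Otimes>\<^sub>M \<nu>) (\<lambda>z. ?W2 z - ?A2 z)
      = Lp_int p (?E2 \<Otimes>\<^sub>M ?E2) (\<lambda>z. ext_fun (snd G2) (fst z) (snd z) - U2 (c2 (fst z)) (c2 (snd z)))"
      using coupling_projections(2)[OF \<nu> sigma_finite_ext_space[OF sf(2)],
          of "\<lambda>z. ext_fun (snd G2) (fst z) (snd z) - U2 (c2 (fst z)) (c2 (snd z))" p] by simp
    also have "\<dots> \<le> L1p_int p (?E2 \<Otimes>\<^sub>M ?E2) (\<lambda>z. ext_fun (snd G2) (fst z) (snd z) - U2 (c2 (fst z)) (c2 (snd z)))"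
      by (simp add: L1p_int_def)
    also have "\<dots> \<le> ennreal e" using err2 by simp
    finally show ?thesis .
  qed
  \<comment> \<open>Three errors of size \<open>e\<close> pass through two nested triangle
    inequalities with factor \<open>K\<close>; the outcome \<open>K * (e + K * (e + e))\<close> is
    at most \<open>3 * (K * K) * e\<close> because \<open>K\<close> is at least 1.\<close>
  define K where "K = (2 :: real) powr p"
  have K: "1 \<le> K" using p by (simp add: K_def ge_one_powr_ge_zero)
  have "Lp_int p (M \<Otimes>\<^sub>M M) (\<lambda>z. U1 (f (fst z)) (f (snd z)) - U2 (g (fst z)) (g (snd z)))
      = Lp_int p (\<nu> \<Otimes>\<^sub>M \<nu>) (\<lambda>z. ?A1 z - ?A2 z)"
    by (rule tr[of p "\<lambda>i j k l. U1 i j - U2 k l"])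
  also have "\<dots> \<le> ennreal K * (Lp_int p (\<nu> \<Otimes>\<^sub>M \<nu>) (\<lambda>z. ?A1 z - ?W1 z) + Lp_int p (\<nu> \<Otimes>\<^sub>M \<nu>) (\<lambda>z. ?W1 z - ?A2 z))"
    unfolding K_def using p by (intro Lp_int_triangle m1 m2) simp
  also have "\<dots> \<le> ennreal K * (ennreal e + ennreal K * (ennreal e + ennreal e))"
  proof (intro mult_left_mono add_mono e1 zero_le)
    have "Lp_int p (\<nu> \<Otimes>\<^sub>M \<nu>) (\<lambda>z. ?W1 z - ?A2 z)
      \<le> ennreal K * (Lp_int p (\<nu> \<Otimes>\<^sub>M \<nu>) (\<lambda>z. ?W1 z - ?W2 z) + Lp_int p (\<nu> \<Otimes>\<^sub>M \<nu>) (\<lambda>z. ?W2 z - ?A2 z))"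
      unfolding K_def using p by (intro Lp_int_triangle m1 m2) simp
    also have "\<dots> \<le> ennreal K * (ennreal e + ennreal e)"
      using d by (intro mult_left_mono add_mono e2) auto
    finally show "Lp_int p (\<nu> \<Otimes>\<^sub>M \<nu>) (\<lambda>z. ?W1 z - ?A2 z) \<le> ennreal K * (ennreal e + ennreal e)" .
  qed
  also have "\<dots> = ennreal (K * (e + K * (e + e)))"
    using e K by (simp add: ennreal_mult mult_2[symmetric])
  also have "\<dots> \<le> ennreal (3 * (K * K) * e)"
  proof (rule ennreal_leI)
    have "K * e \<le> K * (K * e)" using mult_right_mono[OF K, of "K * e"] e K by simp
    then show "K * (e + K * (e + e)) \<le> 3 * (K * K) * e" by (simp add: algebra_simps)
  qed
  finally show thesis using that[OF g] by (simp add: K_def)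
qed

section \<open>Completeness\<close>

text \<open>Serves both statements, with p = 1 and with p > 1; the L1 bound and nonnegativity are
  implications so that they can be used in the second only. For p > 1, membership of the limit in L1
  is obtained from the bound \<open>C\<close>.\<close>

lemma delta_Cauchy_limit:
  fixes X :: "nat \<Rightarrow> 'a graphon"
  assumes sf: "\<And>n. sigma_finite_measure (fst (X n))"
    and W: "\<And>n. (\<lambda>z. snd (X n) (fst z) (snd z)) \<in> borel_measurable (fst (X n) \<Otimes>\<^sub>M fst (X n))"
    and sym: "\<And>n x y. x \<in> space (fst (X n)) \<Longrightarrow> y \<in> space (fst (X n)) \<Longrightarrow> snd (X n) x y = snd (X n) y x"
    and fin: "\<And>n. L1p_int p (fst (X n) \<Otimes>\<^sub>M fst (X n)) (\<lambda>z. snd (X n) (fst z) (snd z)) < \<infinity>"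
    and p: "1 \<le> p" and Cauchy: "delta_Cauchy p X"
  shows "\<exists>G :: (nat \<Rightarrow> 'a + real) graphon. sigma_finite_measure (fst G) \<and> (\<forall>x y. snd G x y = snd G y x)
    \<and> (\<lambda>z. snd G (fst z) (snd z)) \<in> borel_measurable (fst G \<Otimes>\<^sub>M fst G)
    \<and> Lp_int p (fst G \<Otimes>\<^sub>M fst G) (\<lambda>z. snd G (fst z) (snd z)) < \<infinity>
    \<and> delta_converges p X G
    \<and> (\<forall>C\<ge>0. (\<forall>n. Lp_int 1 (fst (X n) \<Otimes>\<^sub>M fst (X n)) (\<lambda>z. snd (X n) (fst z) (snd z)) \<le> ennreal C)
        \<longrightarrow> Lp_int 1 (fst G \<Otimes>\<^sub>M fst G) (\<lambda>z. snd G (fst z) (snd z)) \<le> ennreal C)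
    \<and> ((\<forall>n. \<forall>x\<in>space (fst (X n)). \<forall>y\<in>space (fst (X n)). 0 \<le> snd (X n) x y) \<longrightarrow> (\<forall>x y. 0 \<le> snd G x y))"
proof -
  define K where "K = (2 :: real) powr p"
  have K: "1 \<le> K" using p by (simp add: K_def ge_one_powr_ge_zero)
  \<comment> \<open>The rate required by \<open>Lp_int_fast_limit\<close>.\<close>
  define r where "r = 1 / (2 * K)"
  have r: "0 < r" "r < 1" using K by (simp_all add: r_def)
  \<comment> \<open>Chosen so that the error \<open>3 * (K * K) * \<epsilon> k\<close> of one
    transport is exactly \<open>r ^ k\<close>.\<close>
  define \<epsilon> where "\<epsilon> k = r ^ k / (3 * (K * K))" for k
  have \<epsilon>: "0 < \<epsilon> k" "3 * (K * K) * \<epsilon> k = r ^ k" for k using r K by (simp_all add: \<epsilon>_def)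
  have r_lim: "(\<lambda>k. r ^ k) \<longlonglongrightarrow> 0" using r by (intro LIMSEQ_realpow_zero) auto
  have \<epsilon>_lim: "\<epsilon> \<longlonglongrightarrow> 0"
    using tendsto_divide[OF r_lim tendsto_const, of "3 * (K * K)"] K unfolding \<epsilon>_def by simp
  let ?E = "\<lambda>n. ext_space (fst (X n))"
  have "\<forall>n. \<exists>cU. step_rep p (1 / real (Suc n)) (X n) (fst cU) (snd cU)"
  proof
    fix n
    obtain c U where "step_rep p (1 / real (Suc n)) (X n) c U"
      using exists_step_rep[OF sf W sym fin p, of n "1 / real (Suc n)"] by auto
    then show "\<exists>cU. step_rep p (1 / real (Suc n)) (X n) (fst cU) (snd cU)"
      by (intro exI[of _ "(c, U)"]) simp
  qed
  from choice[OF this] obtain cU where rep0: "\<And>n. step_rep p (1 / real (Suc n)) (X n) (fst (cU n)) (snd (cU n))"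
    by blast
  define c where "c n = fst (cU n)" for n
  define U where "U n = snd (cU n)" for n
  have rep0: "step_rep p (1 / real (Suc n)) (X n) (c n) (U n)" for n using rep0 by (simp add: c_def U_def)
  have c[measurable]: "c n \<in> measurable (?E n) (count_space UNIV)"
    and c_fin: "emeasure (?E n) (c n -` {i} \<inter> space (?E n)) < \<infinity>"
    and c_odd: "odd i \<Longrightarrow> emeasure (?E n) (c n -` {i} \<inter> space (?E n)) = 1"
    and U_sym: "U n i j = U n j i"
    and U_nn: "(\<forall>x\<in>space (fst (X n)). \<forall>y\<in>space (fst (X n)). 0 \<le> snd (X n) x y) \<longrightarrow> (\<forall>i j. 0 \<le> U n i j)"
    and U_err: "L1p_int p (?E n \<Otimes>\<^sub>M ?E n)
        (\<lambda>z. ext_fun (snd (X n)) (fst z) (snd z) - U n (c n (fst z)) (c n (snd z))) < ennreal (1 / real (Suc n))"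
    for n i j
    using rep0[of n] unfolding step_rep_def by blast+
  have rep: "step_rep p e (X n) (c n) (U n)" if "1 / real (Suc n) \<le> e" for n e
    using rep0[of n] less_le_trans[OF U_err ennreal_leI[OF that]] unfolding step_rep_def by blast
  have "\<forall>k. \<exists>N. \<forall>n\<ge>N. 1 / real (Suc n) \<le> \<epsilon> k \<and> (\<forall>m\<ge>N. delta p (X m) (X n) < ennreal (\<epsilon> k powr (1 / p)))"
  proof
    fix k
    have "0 < \<epsilon> k powr (1 / p)" using \<epsilon>(1)[of k] by simp
    then obtain N1 where N1: "\<forall>m\<ge>N1. \<forall>n\<ge>N1. delta p (X m) (X n) < ennreal (\<epsilon> k powr (1 / p))"
      using Cauchy unfolding delta_Cauchy_def by blast
    obtain N2 where "1 / \<epsilon> k \<le> real N2" using real_arch_simple by blast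
    then have "1 / real (Suc n) \<le> \<epsilon> k" if "N2 \<le> n" for n
    proof -
      have "1 / \<epsilon> k \<le> real (Suc n)" using that \<open>1 / \<epsilon> k \<le> real N2\<close> by simp
      then have "1 / real (Suc n) \<le> 1 / (1 / \<epsilon> k)" using \<epsilon>(1)[of k] by (intro divide_left_mono) auto
      then show ?thesis by simp
    qed
    then show "\<exists>N. \<forall>n\<ge>N. 1 / real (Suc n) \<le> \<epsilon> k \<and> (\<forall>m\<ge>N. delta p (X m) (X n) < ennreal (\<epsilon> k powr (1 / p)))"
      using N1 by (intro exI[of _ "max N1 N2"]) auto
  qed
  from choice[OF this] obtain N0 where N0: "\<And>k n. N0 k \<le> n \<Longrightarrow> 1 / real (Suc n) \<le> \<epsilon> k"
    "\<And>k n m. N0 k \<le> n \<Longrightarrow> N0 k \<le> m \<Longrightarrow> delta p (X m) (X n) < ennreal (\<epsilon> k powr (1 / p))"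
    by blast
  \<comment> \<open>Partial sums of the thresholds are monotone and dominate each
    \<open>N0 k\<close>, so \<open>N k\<close> and \<open>N (Suc k)\<close> both lie beyond
    threshold \<open>k\<close>.\<close>
  define N where "N k = (\<Sum>j\<le>k. N0 j)" for k
  have N0N: "N0 k \<le> N k" for k unfolding N_def by (rule member_le_sum) auto
  have NSuc: "N k \<le> N (Suc k)" for k by (simp add: N_def)
  obtain M :: "(nat \<Rightarrow> 'a + real) measure" and h where hm: "height_measure M h"
    and infM: "emeasure M (space M) = \<infinity>"
    using exists_height_measure by blast
  interpret height_measure M h by fact
  have sfM: "sigma_finite_measure M" by (rule sigma_finite)
  let ?P = "M \<Otimes>\<^sub>M M"
  \<comment> \<open>Stated for any two indices beyond threshold \<open>k\<close>: it builds
    consecutive links of the chain, and at the end it reaches an arbitrary late \<open>X n\<close>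
    from link \<open>k\<close>.\<close>
  have tr: "\<exists>g. g \<in> measurable M (count_space UNIV) \<and> law M g = law (?E n) (c n) \<and>
      Lp_int p ?P (\<lambda>z. U m (f (fst z)) (f (snd z)) - U n (g (fst z)) (g (snd z))) \<le> ennreal (r ^ k)"
    if km: "N0 k \<le> m" and kn: "N0 k \<le> n" and f: "f \<in> measurable M (count_space UNIV)"
      and lf: "law M f = law (?E m) (c m)" for k m n f
  proof -
    obtain g where "g \<in> measurable M (count_space UNIV)" "law M g = law (?E n) (c n)"
      "Lp_int p ?P (\<lambda>z. U m (f (fst z)) (f (snd z)) - U n (g (fst z)) (g (snd z)))
        \<le> ennreal (3 * (2 powr p * 2 powr p) * \<epsilon> k)"
      using transport_step_rep[OF rep[OF N0(1)[OF km]] rep[OF N0(1)[OF kn]] W W sf sf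
          N0(2)[OF kn km] \<epsilon>(1) p f lf] .
    then show ?thesis using \<epsilon>(2)[of k] by (auto simp: K_def)
  qed
  have "\<exists>f. \<forall>k. (f k \<in> measurable M (count_space UNIV) \<and> law M (f k) = law (?E (N k)) (c (N k))) \<and>
      Lp_int p ?P (\<lambda>z. U (N k) (f k (fst z)) (f k (snd z)) - U (N (Suc k)) (f (Suc k) (fst z)) (f (Suc k) (snd z)))
        \<le> ennreal (r ^ k)"
  proof (rule dependent_nat_choice)
    define m where "m i = emeasure (?E (N 0)) (c (N 0) -` {i} \<inter> space (?E (N 0)))" for i
    \<comment> \<open>The odd cells alone contribute mass 1 each, so the total is infinite, as for
      \<open>M\<close>.\<close>
    have "(\<Sum>i. m i) = \<infinity>"
    proof -
      have "of_nat n \<le> (\<Sum>i. m i)" for n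
      proof -
        have "(\<Sum>i\<in>(\<lambda>j. 2 * j + 1) ` {..<n}. m i) = (\<Sum>j<n. m (2 * j + 1))"
          by (subst sum.reindex) (auto simp: inj_on_def)
        also have "\<dots> = of_nat n" by (simp add: m_def c_odd)
        finally show ?thesis
          using sum_le_suminf[of m "(\<lambda>j. 2 * j + 1) ` {..<n}"] by auto
      qed
      then show ?thesis using ennreal_SUP_of_nat_eq_top by (metis SUP_least infinity_ennreal_def top.extremum_uniqueI)
    qed
    then obtain f0 where f0: "f0 \<in> measurable M (count_space UNIV)" "\<And>i. emeasure M (f0 -` {i} \<inter> space M) = m i"
      using exists_law[of m] c_fin infM by (auto simp: m_def)
    have "law M f0 = law (?E (N 0)) (c (N 0))"
      by (rule law_eqI[OF f0(1) c]) (simp add: f0(2) m_def)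
    with f0(1) show "\<exists>f. f \<in> measurable M (count_space UNIV) \<and> law M f = law (?E (N 0)) (c (N 0))" by blast
  next
    fix f k assume "f \<in> measurable M (count_space UNIV) \<and> law M f = law (?E (N k)) (c (N k))"
    then show "\<exists>g. (g \<in> measurable M (count_space UNIV) \<and> law M g = law (?E (N (Suc k))) (c (N (Suc k)))) \<and>
       Lp_int p ?P (\<lambda>z. U (N k) (f (fst z)) (f (snd z)) - U (N (Suc k)) (g (fst z)) (g (snd z))) \<le> ennreal (r ^ k)"
      using tr[of k "N k" "N (Suc k)" f] N0N[of k] NSuc[of k] by auto
  qed
  then obtain f where f[measurable]: "\<And>k. f k \<in> measurable M (count_space UNIV)"
    and f_law: "\<And>k. law M (f k) = law (?E (N k)) (c (N k))"
    and f_step: "\<And>k. Lp_int p ?P (\<lambda>z. U (N k) (f k (fst z)) (f k (snd z))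
        - U (N (Suc k)) (f (Suc k) (fst z)) (f (Suc k) (snd z))) \<le> ennreal (r ^ k)"
    by blast
  define F where "F k z = U (N k) (f k (fst z)) (f k (snd z))" for k z
  have F[measurable]: "F k \<in> borel_measurable ?P" for k
    unfolding F_def by (rule borel_measurable_step[OF f f])
  have F_fast: "Lp_int p ?P (\<lambda>z. F (Suc k) z - F k z) \<le> ennreal ((1 / (2 * 2 powr p)) ^ k)" for k
    using f_step[of k] by (subst Lp_int_minus_commute) (simp add: F_def r_def K_def)
  note lim = Lp_int_fast_limit[OF F p F_fast]
  define nn where "nn \<longleftrightarrow> (\<forall>n. \<forall>x\<in>space (fst (X n)). \<forall>y\<in>space (fst (X n)). 0 \<le> snd (X n) x y)"
  \<comment> \<open>Where \<open>F k\<close> does not converge, \<open>lim\<close> is unspecified.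
    The cut at 0 makes the limit nonnegative at every point, and by \<open>F_V\<close> it changes
    values only on a null set.\<close>
  define V where "V x y = (if nn then max 0 (lim (\<lambda>k. F k (x, y))) else lim (\<lambda>k. F k (x, y)))" for x y
  have V: "(\<lambda>z. V (fst z) (snd z)) \<in> borel_measurable ?P"
    unfolding V_def by simp
  have F_V: "AE z in ?P. (\<lambda>k. F k z) \<longlonglongrightarrow> V (fst z) (snd z) \<and> lim (\<lambda>k. F k z) = V (fst z) (snd z)"
    using lim(1)
  proof eventually_elim
    fix z assume L: "(\<lambda>k. F k z) \<longlonglongrightarrow> lim (\<lambda>k. F k z)"
    have "0 \<le> lim (\<lambda>k. F k z)" if nn
    proof (rule LIMSEQ_le_const[OF L], intro exI allI impI)
      show "0 \<le> F k z" for k using U_nn[of "N k"] that by (simp add: nn_def F_def)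
    qed
    then have "V (fst z) (snd z) = lim (\<lambda>k. F k z)" by (auto simp: V_def)
    then show "(\<lambda>k. F k z) \<longlonglongrightarrow> V (fst z) (snd z) \<and> lim (\<lambda>k. F k z) = V (fst z) (snd z)" using L by simp
  qed
  have FV: "Lp_int p ?P (\<lambda>z. F k z - V (fst z) (snd z)) \<le> ennreal (K * (2 / 2 ^ k))" for k
  proof -
    have "Lp_int p ?P (\<lambda>z. F k z - V (fst z) (snd z)) = Lp_int p ?P (\<lambda>z. F k z - lim (\<lambda>k. F k z))"
      by (rule Lp_int_cong_AE) (use F_V in eventually_elim, simp)
    then show ?thesis using lim(2)[of k] by (simp add: K_def)
  qed
  have ext_m: "(\<lambda>z. ext_fun (snd (X n)) (fst z) (snd z)) \<in> borel_measurable (?E n \<Otimes>\<^sub>M ?E n)"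
    "(\<lambda>z. U n (c n (fst z)) (c n (snd z))) \<in> borel_measurable (?E n \<Otimes>\<^sub>M ?E n)" for n
    by (rule borel_measurable_ext_fun[OF W], rule borel_measurable_step[OF c c])
  have ext_Lp: "Lp_int q (?E n \<Otimes>\<^sub>M ?E n) (\<lambda>z. ext_fun (snd (X n)) (fst z) (snd z))
      = Lp_int q (fst (X n) \<Otimes>\<^sub>M fst (X n)) (\<lambda>z. snd (X n) (fst z) (snd z))" for q n
    using Lp_int_ext_space[OF sf ext_m(1), of n q] by simp
  have F_Lp: "Lp_int q ?P (F k) = Lp_int q (?E (N k) \<Otimes>\<^sub>M ?E (N k)) (\<lambda>z. U (N k) (c (N k) (fst z)) (c (N k) (snd z)))" for q k
    unfolding F_def by (rule Lp_int_same_law[OF c f f_law[symmetric] c_fin, symmetric])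
  let ?D = "\<lambda>n z. U n (c n (fst z)) (c n (snd z)) - ext_fun (snd (X n)) (fst z) (snd z)"
  have D_err: "L1p_int p (?E n \<Otimes>\<^sub>M ?E n) (?D n) < ennreal (1 / real (Suc n))" for n
    using U_err[of n] unfolding L1p_int_def
    by (subst (1 2) Lp_int_minus_commute)
  have Vp: "Lp_int p ?P (\<lambda>z. V (fst z) (snd z)) < \<infinity>"
  proof -
    have "Lp_int p ?P (F 0) \<le> ennreal K * (Lp_int p (?E (N 0) \<Otimes>\<^sub>M ?E (N 0)) (?D (N 0))
        + Lp_int p (?E (N 0) \<Otimes>\<^sub>M ?E (N 0)) (\<lambda>z. ext_fun (snd (X (N 0))) (fst z) (snd z)))"
      unfolding F_Lp K_def using p by (intro Lp_int_bound_add ext_m) simp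
    also have "\<dots> < \<infinity>"
      using fin[of "N 0"] less_trans[OF D_err ennreal_less_top, of "N 0"]
      by (auto simp: ext_Lp L1p_int_def ennreal_mult_less_top)
    finally have "Lp_int p ?P (F 0) < \<infinity>" .
    moreover have "Lp_int p ?P (\<lambda>z. V (fst z) (snd z))
        \<le> ennreal K * (Lp_int p ?P (\<lambda>z. V (fst z) (snd z) - F 0 z) + Lp_int p ?P (F 0))"
      unfolding K_def using p V by (intro Lp_int_bound_add F) simp_all
    moreover have "Lp_int p ?P (\<lambda>z. V (fst z) (snd z) - F 0 z) < \<infinity>"
      using le_less_trans[OF FV[of 0] ennreal_less_top] by (subst Lp_int_minus_commute) simp
    ultimately show ?thesis by (auto simp: ennreal_mult_less_top intro: le_less_trans)
  qed
  \<comment> \<open>For p > 1, \<open>F k\<close> may fail to converge to \<open>V\<close> in L1,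
    but its L1 norm is at most \<open>\<epsilon> k + C\<close>. Almost everywhere convergence and
    Fatou's lemma then give \<open>C\<close> without loss.\<close>
  have V1: "Lp_int 1 ?P (\<lambda>z. V (fst z) (snd z)) \<le> ennreal C"
    if C: "0 \<le> C" "\<And>n. Lp_int 1 (fst (X n) \<Otimes>\<^sub>M fst (X n)) (\<lambda>z. snd (X n) (fst z) (snd z)) \<le> ennreal C" for C
  proof -
    have bd: "Lp_int 1 ?P (F k) \<le> ennreal (\<epsilon> k + C)" for k
    proof -
      have "Lp_int 1 ?P (F k) \<le> Lp_int 1 (?E (N k) \<Otimes>\<^sub>M ?E (N k)) (?D (N k))
        + Lp_int 1 (?E (N k) \<Otimes>\<^sub>M ?E (N k)) (\<lambda>z. ext_fun (snd (X (N k))) (fst z) (snd z))"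
        unfolding F_Lp by (intro Lp_int_1_triangle ext_m)
      also have "\<dots> \<le> ennreal (\<epsilon> k) + ennreal C"
      proof (intro add_mono)
        have "Lp_int 1 (?E (N k) \<Otimes>\<^sub>M ?E (N k)) (?D (N k)) \<le> L1p_int p (?E (N k) \<Otimes>\<^sub>M ?E (N k)) (?D (N k))"
          by (simp add: L1p_int_def)
        also have "\<dots> \<le> ennreal (1 / real (Suc (N k)))" using D_err by (rule less_imp_le)
        also have "\<dots> \<le> ennreal (\<epsilon> k)" by (intro ennreal_leI N0 N0N)
        finally show "Lp_int 1 (?E (N k) \<Otimes>\<^sub>M ?E (N k)) (?D (N k)) \<le> ennreal (\<epsilon> k)" .
        show "Lp_int 1 (?E (N k) \<Otimes>\<^sub>M ?E (N k)) (\<lambda>z. ext_fun (snd (X (N k))) (fst z) (snd z)) \<le> ennreal C"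
          unfolding ext_Lp by (rule C(2))
      qed
      also have "\<dots> = ennreal (\<epsilon> k + C)" using \<epsilon>(1)[of k] C(1) by (intro ennreal_plus[symmetric]) auto
      finally show ?thesis .
    qed
    have "Lp_int 1 ?P (\<lambda>z. V (fst z) (snd z)) = (\<integral>\<^sup>+ z. liminf (\<lambda>k. ennreal (\<bar>F k z\<bar> powr 1)) \<partial>?P)"
      unfolding Lp_int_def
    proof (rule nn_integral_cong_AE, use F_V in eventually_elim)
      fix z assume "(\<lambda>k. F k z) \<longlonglongrightarrow> V (fst z) (snd z) \<and> lim (\<lambda>k. F k z) = V (fst z) (snd z)"
      then have "(\<lambda>k. ennreal \<bar>F k z\<bar>) \<longlonglongrightarrow> ennreal \<bar>V (fst z) (snd z)\<bar>"
        by (intro tendsto_ennrealI tendsto_rabs) simp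
      then have "liminf (\<lambda>k. ennreal \<bar>F k z\<bar>) = ennreal \<bar>V (fst z) (snd z)\<bar>"
        by (intro lim_imp_Liminf) simp_all
      then show "ennreal (\<bar>V (fst z) (snd z)\<bar> powr 1) = liminf (\<lambda>k. ennreal (\<bar>F k z\<bar> powr 1))" by simp
    qed
    also have "\<dots> \<le> liminf (\<lambda>k. Lp_int 1 ?P (F k))"
      unfolding Lp_int_def by (intro nn_integral_liminf) measurable
    also have "\<dots> \<le> liminf (\<lambda>k. ennreal (\<epsilon> k + C))"
      by (intro Liminf_mono always_eventually allI bd)
    also have "\<dots> = ennreal C"
    proof (intro lim_imp_Liminf)
      show "(\<lambda>k. ennreal (\<epsilon> k + C)) \<longlonglongrightarrow> ennreal C"
        using tendsto_add[OF \<epsilon>_lim tendsto_const[of C]] by (intro tendsto_ennrealI) simp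
    qed simp
    finally show ?thesis .
  qed
  have conv: "delta_converges p X (M, V)"
    unfolding delta_converges_def
  proof (intro allI impI)
    fix e :: real assume e: "0 < e"
    \<comment> \<open>The three terms are the step error of \<open>X n\<close>, the distance of its
      transported kernel from link \<open>k\<close>, and the distance of link \<open>k\<close> from
      \<open>V\<close>. One \<open>k\<close> serves all late \<open>n\<close>, so the whole sequence
      converges and not just a subsequence.\<close>
    have "(\<lambda>k. K * (\<epsilon> k + K * (r ^ k + K * (2 * (1/2) ^ k)))) \<longlonglongrightarrow> K * (0 + K * (0 + K * (2 * 0)))"
      by (intro tendsto_intros \<epsilon>_lim r_lim LIMSEQ_realpow_zero) auto
    then have "eventually (\<lambda>k. K * (\<epsilon> k + K * (r ^ k + K * (2 * (1/2) ^ k))) < e powr p) sequentially"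
      using e by (intro order_tendstoD(2)) auto
    then obtain k where "K * (\<epsilon> k + K * (r ^ k + K * (2 * (1/2) ^ k))) < e powr p"
      by (auto simp: eventually_sequentially)
    then have k: "K * (\<epsilon> k + K * (r ^ k + K * (2 / 2 ^ k))) < e powr p"
      by (simp add: power_divide)
    show "\<exists>n0. \<forall>n\<ge>n0. delta p (X n) (M, V) < ennreal e"
    proof (intro exI allI impI)
      fix n assume n: "N k \<le> n"
      then have n0: "N0 k \<le> n" using N0N[of k] by simp
      obtain g where g: "g \<in> measurable M (count_space UNIV)" "law M g = law (?E n) (c n)"
        and gF: "Lp_int p ?P (\<lambda>z. U (N k) (f k (fst z)) (f k (snd z)) - U n (g (fst z)) (g (snd z))) \<le> ennreal (r ^ k)"
        using tr[OF N0N n0 f f_law] by blast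
      have gm: "(\<lambda>z. U n (g (fst z)) (g (snd z))) \<in> borel_measurable ?P"
        by (rule borel_measurable_step[OF g(1) g(1)])
      have gV: "Lp_int p ?P (\<lambda>z. U n (g (fst z)) (g (snd z)) - V (fst z) (snd z))
          \<le> ennreal (K * (r ^ k + K * (2 / 2 ^ k)))"
      proof -
        have "Lp_int p ?P (\<lambda>z. U n (g (fst z)) (g (snd z)) - V (fst z) (snd z))
          \<le> ennreal K * (Lp_int p ?P (\<lambda>z. U n (g (fst z)) (g (snd z)) - F k z) + Lp_int p ?P (\<lambda>z. F k z - V (fst z) (snd z)))"
          unfolding K_def using p by (intro Lp_int_triangle gm F V) simp
        also have "\<dots> \<le> ennreal K * (ennreal (r ^ k) + ennreal (K * (2 / 2 ^ k)))"
          using gF by (intro mult_left_mono add_mono FV) (simp_all add: F_def Lp_int_minus_commute[of _ _ "\<lambda>z. U n (g (fst z)) (g (snd z))"])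
        also have "\<dots> = ennreal (K * (r ^ k + K * (2 / 2 ^ k)))"
          using K r by (simp add: ennreal_mult ennreal_plus)
        finally show ?thesis .
      qed
      obtain \<nu> where \<nu>: "\<nu> \<in> couplings (?E n) (ext_space M)"
        and \<nu>e: "Lp_int p (\<nu> \<Otimes>\<^sub>M \<nu>) (\<lambda>z. ext_fun (snd (X n)) (fst (fst z)) (fst (snd z)) - ext_fun V (snd (fst z)) (snd (snd z)))
          \<le> ennreal (2 powr p) * (ennreal (\<epsilon> k) + Lp_int p ?P (\<lambda>z. U n (g (fst z)) (g (snd z)) - V (fst z) (snd z)))"
        using step_rep_coupling[OF rep[OF N0(1)[OF n0]] W sf sfM g V p] .
      have "ennreal K * (ennreal (\<epsilon> k) + Lp_int p ?P (\<lambda>z. U n (g (fst z)) (g (snd z)) - V (fst z) (snd z)))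
          \<le> ennreal K * (ennreal (\<epsilon> k) + ennreal (K * (r ^ k + K * (2 / 2 ^ k))))"
        by (intro mult_left_mono add_left_mono gV) simp
      also have "\<dots> = ennreal (K * (\<epsilon> k + K * (r ^ k + K * (2 / 2 ^ k))))"
      proof -
        have "0 \<le> K * (r ^ k + K * (2 / 2 ^ k))" "0 \<le> \<epsilon> k" using K r \<epsilon>(1)[of k] by auto
        then show ?thesis using K by (subst ennreal_plus[symmetric], simp, simp, subst ennreal_mult) auto
      qed
      also have "\<dots> < ennreal (e powr p)" using k e by (intro ennreal_lessI) auto
      finally have "Lp_int p (\<nu> \<Otimes>\<^sub>M \<nu>) (\<lambda>z. ext_fun (snd (X n)) (fst (fst z)) (fst (snd z)) - ext_fun V (snd (fst z)) (snd (snd z)))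
          < ennreal (e powr p)"
        using \<nu>e unfolding K_def by (rule le_less_trans[rotated])
      then show "delta p (X n) (M, V) < ennreal e"
        using \<nu> e p by (intro coupling_imp_delta_less[of \<nu>]) simp_all
    qed
  qed
  \<comment> \<open>Symmetry holds at every point, even where \<open>lim\<close> is unspecified: the
    \<open>F k\<close> are symmetric, so both sides apply \<open>lim\<close> to the same
    sequence.\<close>
  have "V x y = V y x" for x y
    by (simp add: V_def F_def U_sym)
  moreover have "0 \<le> V x y" if nn for x y using that by (simp add: V_def)
  ultimately show ?thesis
    using sfM V Vp conv V1 by (intro exI[of _ "(M, V)"]) (auto simp: nn_def)
qed

section \<open>From graphons to integrals and back; the two completeness statements\<close>

lemma graphonD:
  assumes "graphon G"
  shows "sigma_finite_measure (fst G)"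
    "\<And>x y. x \<in> space (fst G) \<Longrightarrow> y \<in> space (fst G) \<Longrightarrow> snd G x y = snd G y x"
    "(\<lambda>z. snd G (fst z) (snd z)) \<in> borel_measurable (fst G \<Otimes>\<^sub>M fst G)"
    "Lp_int 1 (fst G \<Otimes>\<^sub>M fst G) (\<lambda>z. snd G (fst z) (snd z)) = ennreal (graphon_L1_norm G)"
proof -
  have G: "sigma_finite_measure (fst G)" "\<forall>x\<in>space (fst G). \<forall>y\<in>space (fst G). snd G x y = snd G y x"
    and int: "integrable (fst G \<Otimes>\<^sub>M fst G) (\<lambda>z. snd G (fst z) (snd z))"
    using assms by (auto simp: graphon_def case_prod_beta')
  show "sigma_finite_measure (fst G)" by (rule G(1))
  show "snd G x y = snd G y x" if "x \<in> space (fst G)" "y \<in> space (fst G)" for x y using G(2) that by blast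
  show "(\<lambda>z. snd G (fst z) (snd z)) \<in> borel_measurable (fst G \<Otimes>\<^sub>M fst G)"
    using int by (rule borel_measurable_integrable)
  have "integrable (fst G \<Otimes>\<^sub>M fst G) (\<lambda>z. \<bar>snd G (fst z) (snd z)\<bar>)" using int by (rule integrable_abs)
  then have "(\<integral>\<^sup>+ z. ennreal \<bar>snd G (fst z) (snd z)\<bar> \<partial>(fst G \<Otimes>\<^sub>M fst G)) = ennreal (graphon_L1_norm G)"
    unfolding graphon_L1_norm_def by (rule nn_integral_eq_integral) simp
  then show "Lp_int 1 (fst G \<Otimes>\<^sub>M fst G) (\<lambda>z. snd G (fst z) (snd z)) = ennreal (graphon_L1_norm G)"
    by (simp add: Lp_int_def)
qed

lemma graphonI:
  assumes "sigma_finite_measure (fst G)" "\<forall>x y. snd G x y = snd G y x"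
    and m: "(\<lambda>z. snd G (fst z) (snd z)) \<in> borel_measurable (fst G \<Otimes>\<^sub>M fst G)"
    and f: "Lp_int 1 (fst G \<Otimes>\<^sub>M fst G) (\<lambda>z. snd G (fst z) (snd z)) < \<infinity>"
  shows "graphon G"
proof -
  have "integrable (fst G \<Otimes>\<^sub>M fst G) (\<lambda>z. snd G (fst z) (snd z))"
    using m f by (intro integrableI_bounded) (simp_all add: Lp_int_def)
  then show ?thesis using assms by (simp add: graphon_def case_prod_beta')
qed

theorem mainTheorem13:
  shows "(\<forall>X :: nat \<Rightarrow> 'a graphon.
            (\<forall>n. graphon (X n)) \<and> delta_Cauchy 1 X \<longrightarrow>
            (\<exists>G :: (nat \<Rightarrow> 'a + real) graphon. graphon G \<and> delta_converges 1 X G))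
       \<and> (\<forall>(p::real) (C::real) (X :: nat \<Rightarrow> 'a graphon). 1 < p \<longrightarrow>
            (\<forall>n. nonneg_graphon (X n) \<and> graphon_in_Lp p (X n) \<and> graphon_L1_norm (X n) \<le> C) \<and>
            delta_Cauchy p X \<longrightarrow>
            (\<exists>G :: (nat \<Rightarrow> 'a + real) graphon.
               nonneg_graphon G \<and> graphon_in_Lp p G \<and> graphon_L1_norm G \<le> C \<and>
               delta_converges p X G))"
proof (intro conjI allI impI)
  fix X :: "nat \<Rightarrow> 'a graphon"
  assume X: "(\<forall>n. graphon (X n)) \<and> delta_Cauchy 1 X"
  then have g: "graphon (X n)" for n by blast
  \<comment> \<open>At p = 1 the two summands of \<open>L1p_int\<close> coincide.\<close>
  have fin: "L1p_int 1 (fst (X n) \<Otimes>\<^sub>M fst (X n)) (\<lambda>z. snd (X n) (fst z) (snd z)) < \<infinity>" for n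
    by (simp add: L1p_int_def graphonD(4)[OF g])
  obtain G :: "(nat \<Rightarrow> 'a + real) graphon" where "sigma_finite_measure (fst G)"
    "\<forall>x y. snd G x y = snd G y x"
    "(\<lambda>z. snd G (fst z) (snd z)) \<in> borel_measurable (fst G \<Otimes>\<^sub>M fst G)"
    "Lp_int 1 (fst G \<Otimes>\<^sub>M fst G) (\<lambda>z. snd G (fst z) (snd z)) < \<infinity>" "delta_converges 1 X G"
    using delta_Cauchy_limit[where X = X, OF graphonD(1,3,2)[OF g] fin order_refl] X by blast
  then show "\<exists>G :: (nat \<Rightarrow> 'a + real) graphon. graphon G \<and> delta_converges 1 X G"
    by (intro exI[of _ G] conjI graphonI)
next
  fix p C :: real and X :: "nat \<Rightarrow> 'a graphon"
  assume p: "1 < p" and X: "(\<forall>n. nonneg_graphon (X n) \<and> graphon_in_Lp p (X n) \<and> graphon_L1_norm (X n) \<le> C) \<and>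
    delta_Cauchy p X"
  then have g: "graphon (X n)" and nn: "\<forall>x\<in>space (fst (X n)). \<forall>y\<in>space (fst (X n)). 0 \<le> snd (X n) x y"
    and Lp: "graphon_in_Lp p (X n)" and le_C: "graphon_L1_norm (X n) \<le> C" for n
    by (auto simp: nonneg_graphon_def)
  \<comment> \<open>The limit lemma states its L1 bound for nonnegative constants; here
    \<open>C\<close> is at least the norm of \<open>X 0\<close>.\<close>
  have C: "0 \<le> C"
    using le_C[of 0] by (rule order_trans[rotated]) (simp add: graphon_L1_norm_def)
  have fin: "L1p_int p (fst (X n) \<Otimes>\<^sub>M fst (X n)) (\<lambda>z. snd (X n) (fst z) (snd z)) < \<infinity>" for n
    using Lp[of n] unfolding graphon_in_Lp_def Lp_int_def[symmetric]
    by (simp add: L1p_int_def graphonD(4)[OF g])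
  have L1: "Lp_int 1 (fst (X n) \<Otimes>\<^sub>M fst (X n)) (\<lambda>z. snd (X n) (fst z) (snd z)) \<le> ennreal C" for n
    unfolding graphonD(4)[OF g] by (rule ennreal_leI[OF le_C])
  obtain G :: "(nat \<Rightarrow> 'a + real) graphon" where G: "sigma_finite_measure (fst G)"
    "\<forall>x y. snd G x y = snd G y x"
    "(\<lambda>z. snd G (fst z) (snd z)) \<in> borel_measurable (fst G \<Otimes>\<^sub>M fst G)"
    and G_Lp: "Lp_int p (fst G \<Otimes>\<^sub>M fst G) (\<lambda>z. snd G (fst z) (snd z)) < \<infinity>"
    and G_conv: "delta_converges p X G"
    and G_L1: "Lp_int 1 (fst G \<Otimes>\<^sub>M fst G) (\<lambda>z. snd G (fst z) (snd z)) \<le> ennreal C"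
    and G_nn: "\<forall>x y. 0 \<le> snd G x y"
    using delta_Cauchy_limit[where X = X, OF graphonD(1,3,2)[OF g] fin less_imp_le[OF p]] X C L1 nn by blast
  have gG: "graphon G"
    using le_less_trans[OF G_L1] by (intro graphonI G) simp
  have "graphon_L1_norm G \<le> C"
    using G_L1 C unfolding graphonD(4)[OF gG] by simp
  moreover have "graphon_in_Lp p G"
    using G_Lp unfolding graphon_in_Lp_def Lp_int_def .
  ultimately show "\<exists>G :: (nat \<Rightarrow> 'a + real) graphon. nonneg_graphon G \<and> graphon_in_Lp p G \<and>
      graphon_L1_norm G \<le> C \<and> delta_converges p X G"
    using gG G_nn G_conv by (intro exI[of _ G]) (simp add: nonneg_graphon_def)
qed

end
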